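(* Let $M$ be a manifold with base point $m_0$ such that $\pi_1(M)=\pi_1(M,m_0)$ has no element of order 2 or 3. Then $\Gamma(M)$ is determined by the action of $\pi_1(M)$ on $\pi_2(M)=\pi_2(M,m_0)$ and a class in $HS^3(\pi_1(M),\pi_2(M))$; precisely, there exists a 3-cocycle $\alpha\in ZS^3(\pi_1(M),\pi_2(M))$ and an isomorphism of $\Delta$-groups based at $\pi_1(M)$ $$\Gamma(M)\simeq T(\pi_1(M),\pi_2(M),\alpha).$$
   Context: **$\Delta$-groups.** Let $G$ be a group. A $\Delta$-group based at $G$ is a collection of sets $T=\{T(g,h)\}_{g,h\in G}$ with operations, for all $g,h,k\in G$, $$m:T(g,h^{-1})\times T(h,k^{-1})\times T(h^{-1}g,k^{-1}h)\to T(g,k^{-1}),$$ $$P:T(g,h)\to T(h,g^{-1}h^{-1}),\qquad Q:T(g,h)\to T(g^{-1},hg),$$ such that, whenever the expressions are defined, (1) $P^3=\mathrm{id}$, $Q^2=\mathrm{id}$, $P^2Q=QP$; (2) $P(m(a,b,c))=m(P(b),P(c),P(a))$; (3) $Q(m(a,b,c))=m(Q(a),Q(c),Q(b))$; (4) $m(m(a,b,c),d,e)=m(a,m(b,d,f),m(c,Q(f),e))$, for $a\in T(g,h^{-1})$, $b\in T(h,k^{-1})$, $c\in T(h^{-1}g,k^{-1}h)$, $d\in T(k,l^{-1})$, $e\in T(k^{-1}g,l^{-1}k)$, $f\in T(k^{-1}h,l^{-1}k)$; (5) $m(m(f,a,b),P^2Q(a),PQ(b))=f$, for $f\in T(g,h^{-1})$,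 $a\in T(h,k^{-1})$, $b\in T(h^{-1}g,k^{-1}h)$. An isomorphism of $\Delta$-groups $T\to T'$ based at the same group $G$ is a family of bijections $T(g,h)\to T'(g,h)$ commuting with $m,P,Q$. **$\Gamma(M)$.** The product $gh$ in $\pi_1(M)$ is "$g$ followed by $h$". Fix a section $s$ assigning to each class in $\pi_1(M)$ a loop at $m_0$ representing it, such that $s(\alpha^{-1})$ is the reverse path $t\mapsto s(\alpha)(1-t)$ and $s(1)$ is the constant loop. We identify $\alpha\in\pi_1(M)$ with the loop $s(\alpha)$; thus $\beta\alpha$ as a loop means the chosen representative of the product. Let $\Delta_2=\{(x_0,x_1,x_2): x_i\ge 0,\ \sum x_i=1\}$ with vertices $[0],[1],[2]$, and similarly $\Delta_3$. For a map $a$ on a simplex, $a_{|[i,j]}$ is the path obtained by restricting $a$ to the edge traversed from $[i]$ to $[j]$; for $\omega$ on $\Delta_3$, $\omega_{|[i,j,l]}$ is the composite of $\omega$ with the affine map $\Delta_2\to\Delta_3$ sending $[0],[1],[2]$ to $[i],[j],[l]$. $\Gamma(\alpha,\beta)$ is the set of homotopy classes, relative to $\partial\Delta_2$, of continuous maps $a:\Delta_2\to M$ with $a_{|[1,0]}=\alpha$, $a_{|[2,1]}=\beta$, $a_{|[2,0]}=\beta\alpha$. $\Gamma(M)=\{\Gamma(\alpha,\beta)\}_{\alpha,\beta\in\pi_1(M)}$ is a $\Delta$-group with operations $P(a)=a\circ p$, $p(x_0,x_1,x_2)=(x_2,x_0,x_1)$; $Q(a)=a\circ q$, $q(x_0,x_1,x_2)=(x_1,x_0,x_2)$;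 and, for $a\in\Gamma(\alpha,\beta^{-1})$, $b\in\Gamma(\beta,\gamma^{-1})$, $c\in\Gamma(\beta^{-1}\alpha,\gamma^{-1}\beta)$, $m(a,b,c)=\omega_{|[1,2,3]}$ where $\omega:\Delta_3\to M$ is any map with $\omega_{|[1,2,0]}=a$, $\omega_{|[0,2,3]}=b$, $\omega_{|[1,0,3]}=c$. **$T(G,A,\alpha)$.** For a group $G$, a $G$-module $A$ and $\alpha:G^3\to A$, it is the collection of sets $T(g,h)=\{(a,(g,h)):a\in A\}$ with $$m\big((a,(g,h^{-1})),(b,(h,k^{-1})),(c,(h^{-1}g,k^{-1}h))\big)=\big(a+(g^{-1}h)b+c+\alpha(g^{-1}h,h^{-1}k,k^{-1}),(g,k^{-1})\big),$$ $$P((a,(g,h^{-1})))=(ga,(h^{-1},g^{-1}h)),\qquad Q((a,(g,h^{-1})))=(-ga,(g^{-1},h^{-1}g)).$$ **Symmetric cohomology in degree 3.** Let $C^n(G,A)$ be the group of all maps $G^n\to A$ with the usual inhomogeneous coboundary $\partial$. $CS^2(G,A)$ is the subgroup of $\sigma\in C^2(G,A)$ with $\sigma(x,y)=-x\sigma(x^{-1},xy)=-\sigma(xy,y^{-1})$. $CS^3(G,A)$ is the subgroup of $\alpha\in C^3(G,A)$ with $\alpha(x,y,z)=-x\alpha(x^{-1},xy,z)=-\alpha(xy,y^{-1},yz)=-\alpha(x,yz,z^{-1})$. $ZS^3(G,A)$ is the group of $\alpha\in CS^3(G,A)$ with $\partial\alpha=0$, $BS^3(G,A)=\partial(CS^2(G,A))$,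 and $HS^3(G,A)=ZS^3(G,A)/BS^3(G,A)$. *)

theory Defs
  imports "HOL-Analysis.Analysis" "HOL-Algebra.Multiplicative_Group"
begin

section \<open>Topological manifolds\<close>

text \<open>A space is a subset \<open>M\<close> of an arbitrary topological space type, with the subspace topology.
  Manifolds have no boundary; neither connectedness nor smoothness is required.\<close>

definition manifold :: "nat \<Rightarrow> 'a::topological_space set \<Rightarrow> bool" where
  "manifold n M \<longleftrightarrow>
     Hausdorff_space (top_of_set M) \<and> second_countable (top_of_set M) \<and>
     (\<forall>x\<in>M. \<exists>U V. openin (top_of_set M) U \<and> x \<in> U \<and> openin (Euclidean_space n) V \<and>
        top_of_set U homeomorphic_space subtopology (Euclidean_space n) V)"


section \<open>The fundamental group\<close>

definition loops :: "'a::topological_space set \<Rightarrow> 'a \<Rightarrow> (real \<Rightarrow> 'a) set" where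
  "loops M m0 = {p. path p \<and> path_image p \<subseteq> M \<and> pathstart p = m0 \<and> pathfinish p = m0}"

definition path_class :: "'a::topological_space set \<Rightarrow> (real \<Rightarrow> 'a) \<Rightarrow> (real \<Rightarrow> 'a) set" where
  "path_class M p = {q. homotopic_paths M p q}"

text \<open>The product \<open>g h\<close> is ``\<open>g\<close> followed by \<open>h\<close>''.\<close>

definition pi1 :: "'a::topological_space set \<Rightarrow> 'a \<Rightarrow> (real \<Rightarrow> 'a) set monoid" where
  "pi1 M m0 =
     \<lparr> carrier = path_class M ` loops M m0,
       monoid.mult = (\<lambda>g h. \<Union>p\<in>g. \<Union>q\<in>h. path_class M (p +++ q)),
       one = path_class M (\<lambda>_. m0) \<rparr>"

definition loop_section ::
  "'a::topological_space set \<Rightarrow> 'a \<Rightarrow> ((real \<Rightarrow> 'a) set \<Rightarrow> real \<Rightarrow> 'a) \<Rightarrow> bool" where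
  "loop_section M m0 s \<longleftrightarrow>
     (\<forall>\<alpha> \<in> carrier (pi1 M m0).
        s \<alpha> \<in> \<alpha> \<and> (\<forall>t\<in>{0..1}. s (inv\<^bsub>pi1 M m0\<^esub> \<alpha>) t = s \<alpha> (1 - t))) \<and>
     (\<forall>t\<in>{0..1}. s \<one>\<^bsub>pi1 M m0\<^esub> t = m0)"


section \<open>The second homotopy group as a module over the fundamental group\<close>

abbreviation unit_square :: "(real \<times> real) set" where
  "unit_square \<equiv> {0..1} \<times> {0..1}"

definition square_boundary :: "(real \<times> real) set" where
  "square_boundary = {(u, v) \<in> unit_square. u \<in> {0, 1} \<or> v \<in> {0, 1}}"

definition spheroids :: "'a::topological_space set \<Rightarrow> 'a \<Rightarrow> (real \<times> real \<Rightarrow> 'a) set" where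
  "spheroids M m0 =
     {f. continuous_on unit_square f \<and> f ` unit_square \<subseteq> M \<and> (\<forall>z\<in>square_boundary. f z = m0)}"

definition spheroid_class ::
  "'a::topological_space set \<Rightarrow> 'a \<Rightarrow> (real \<times> real \<Rightarrow> 'a) \<Rightarrow> (real \<times> real \<Rightarrow> 'a) set" where
  "spheroid_class M m0 f =
     {f'. homotopic_with_canon (\<lambda>h. \<forall>z\<in>square_boundary. h z = m0) unit_square M f f'}"

definition spheroid_join ::
  "(real \<times> real \<Rightarrow> 'a) \<Rightarrow> (real \<times> real \<Rightarrow> 'a) \<Rightarrow> real \<times> real \<Rightarrow> 'a" where
  "spheroid_join f f' = (\<lambda>(u, v). if u \<le> 1/2 then f (2 * u, v) else f' (2 * u - 1, v))"

text \<open>The abelian group \<open>\<pi>\<^sub>2(M, m0)\<close>, written multiplicatively as always for HOL-Algebra groups.\<close>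

definition pi2 :: "'a::topological_space set \<Rightarrow> 'a \<Rightarrow> (real \<times> real \<Rightarrow> 'a) set monoid" where
  "pi2 M m0 =
     \<lparr> carrier = spheroid_class M m0 ` spheroids M m0,
       monoid.mult = (\<lambda>x y. \<Union>f\<in>x. \<Union>f'\<in>y. spheroid_class M m0 (spheroid_join f f')),
       one = spheroid_class M m0 (\<lambda>_. m0) \<rparr>"

text \<open>Shrink \<open>f\<close> to the concentric square of half the size and insert \<open>p\<close>, traversed from the
  outside to the inside, on each radial segment of the shell. As the product in \<open>pi1\<close> is
  ``first factor first'', this induces a left action.\<close>

definition spheroid_drag :: "(real \<Rightarrow> 'a) \<Rightarrow> (real \<times> real \<Rightarrow> 'a) \<Rightarrow> real \<times> real \<Rightarrow> 'a" where
  "spheroid_drag p f = (\<lambda>(u, v).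
     let r = max \<bar>2 * u - 1\<bar> \<bar>2 * v - 1\<bar>
     in if r \<le> 1/2 then f (2 * u - 1/2, 2 * v - 1/2) else p (2 * (1 - r)))"

definition pi1_act ::
  "'a::topological_space set \<Rightarrow> 'a \<Rightarrow> (real \<Rightarrow> 'a) set \<Rightarrow> (real \<times> real \<Rightarrow> 'a) set
     \<Rightarrow> (real \<times> real \<Rightarrow> 'a) set" where
  "pi1_act M m0 g x = (\<Union>p\<in>g. \<Union>f\<in>x. spheroid_class M m0 (spheroid_drag p f))"


section \<open>Delta-groups\<close>

text \<open>The sets \<open>T(g,h)\<close> need not be disjoint, so the operations carry their indices:
  \<open>m_op T g h k\<close> is the operation
  \<open>T(g,h\<^sup>-\<^sup>1) \<times> T(h,k\<^sup>-\<^sup>1) \<times> T(h\<^sup>-\<^sup>1g,k\<^sup>-\<^sup>1h) \<rightarrow> T(g,k\<^sup>-\<^sup>1)\<close>, and \<open>P_op T g h\<close>, \<open>Q_op T g h\<close> are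
  defined on \<open>T(g,h)\<close>. Values at arguments outside these domains are irrelevant.\<close>

record ('g, 't) delta_ops =
  cell :: "'g \<Rightarrow> 'g \<Rightarrow> 't set"
  m_op :: "'g \<Rightarrow> 'g \<Rightarrow> 'g \<Rightarrow> 't \<Rightarrow> 't \<Rightarrow> 't \<Rightarrow> 't"
  P_op :: "'g \<Rightarrow> 'g \<Rightarrow> 't \<Rightarrow> 't"
  Q_op :: "'g \<Rightarrow> 'g \<Rightarrow> 't \<Rightarrow> 't"

text \<open>The composites \<open>P\<^sup>2\<close>, \<open>PQ\<close> and \<open>P\<^sup>2Q\<close> (\<open>Q\<close> is applied first) on \<open>T(g,h)\<close>.\<close>

definition PP_op :: "('g, 'n) monoid_scheme \<Rightarrow> ('g, 't) delta_ops \<Rightarrow> 'g \<Rightarrow> 'g \<Rightarrow> 't \<Rightarrow> 't" where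
  "PP_op G T g h x = P_op T h (inv\<^bsub>G\<^esub> g \<otimes>\<^bsub>G\<^esub> inv\<^bsub>G\<^esub> h) (P_op T g h x)"

definition PQ_op :: "('g, 'n) monoid_scheme \<Rightarrow> ('g, 't) delta_ops \<Rightarrow> 'g \<Rightarrow> 'g \<Rightarrow> 't \<Rightarrow> 't" where
  "PQ_op G T g h x = P_op T (inv\<^bsub>G\<^esub> g) (h \<otimes>\<^bsub>G\<^esub> g) (Q_op T g h x)"

definition PPQ_op :: "('g, 'n) monoid_scheme \<Rightarrow> ('g, 't) delta_ops \<Rightarrow> 'g \<Rightarrow> 'g \<Rightarrow> 't \<Rightarrow> 't" where
  "PPQ_op G T g h x = PP_op G T (inv\<^bsub>G\<^esub> g) (h \<otimes>\<^bsub>G\<^esub> g) (Q_op T g h x)"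

locale delta_group = group G for G :: "('g, 'n) monoid_scheme" (structure) and T :: "('g, 't) delta_ops" +
  assumes m_closed:
    "\<lbrakk>g \<in> carrier G; h \<in> carrier G; k \<in> carrier G;
      a \<in> cell T g (inv h); b \<in> cell T h (inv k); c \<in> cell T (inv h \<otimes> g) (inv k \<otimes> h)\<rbrakk>
     \<Longrightarrow> m_op T g h k a b c \<in> cell T g (inv k)"
  and P_closed:
    "\<lbrakk>g \<in> carrier G; h \<in> carrier G; x \<in> cell T g h\<rbrakk>
     \<Longrightarrow> P_op T g h x \<in> cell T h (inv g \<otimes> inv h)"
  and Q_closed:
    "\<lbrakk>g \<in> carrier G; h \<in> carrier G; x \<in> cell T g h\<rbrakk>
     \<Longrightarrow> Q_op T g h x \<in> cell T (inv g) (h \<otimes> g)"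
  and P_cubed:
    "\<lbrakk>g \<in> carrier G; h \<in> carrier G; x \<in> cell T g h\<rbrakk>
     \<Longrightarrow> P_op T (inv g \<otimes> inv h) g (PP_op G T g h x) = x"
  and Q_squared:
    "\<lbrakk>g \<in> carrier G; h \<in> carrier G; x \<in> cell T g h\<rbrakk>
     \<Longrightarrow> Q_op T (inv g) (h \<otimes> g) (Q_op T g h x) = x"
  and PPQ_eq_QP:
    "\<lbrakk>g \<in> carrier G; h \<in> carrier G; x \<in> cell T g h\<rbrakk>
     \<Longrightarrow> PPQ_op G T g h x = Q_op T h (inv g \<otimes> inv h) (P_op T g h x)"
  and P_m:
    "\<lbrakk>g \<in> carrier G; h \<in> carrier G; k \<in> carrier G;
      a \<in> cell T g (inv h); b \<in> cell T h (inv k); c \<in> cell T (inv h \<otimes> g) (inv k \<otimes> h)\<rbrakk>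
     \<Longrightarrow> P_op T g (inv k) (m_op T g h k a b c) =
         m_op T (inv k) (inv k \<otimes> h) (inv k \<otimes> g)
           (P_op T h (inv k) b)
           (P_op T (inv h \<otimes> g) (inv k \<otimes> h) c)
           (P_op T g (inv h) a)"
  and Q_m:
    "\<lbrakk>g \<in> carrier G; h \<in> carrier G; k \<in> carrier G;
      a \<in> cell T g (inv h); b \<in> cell T h (inv k); c \<in> cell T (inv h \<otimes> g) (inv k \<otimes> h)\<rbrakk>
     \<Longrightarrow> Q_op T g (inv k) (m_op T g h k a b c) =
         m_op T (inv g) (inv g \<otimes> h) (inv g \<otimes> k)
           (Q_op T g (inv h) a)
           (Q_op T (inv h \<otimes> g) (inv k \<otimes> h) c)
           (Q_op T h (inv k) b)"
  and m_assoc':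
    "\<lbrakk>g \<in> carrier G; h \<in> carrier G; k \<in> carrier G; l \<in> carrier G;
      a \<in> cell T g (inv h); b \<in> cell T h (inv k); c \<in> cell T (inv h \<otimes> g) (inv k \<otimes> h);
      d \<in> cell T k (inv l); e \<in> cell T (inv k \<otimes> g) (inv l \<otimes> k);
      f \<in> cell T (inv k \<otimes> h) (inv l \<otimes> k)\<rbrakk>
     \<Longrightarrow> m_op T g k l (m_op T g h k a b c) d e =
         m_op T g h l a
           (m_op T h k l b d f)
           (m_op T (inv h \<otimes> g) (inv h \<otimes> k) (inv h \<otimes> l)
              c (Q_op T (inv k \<otimes> h) (inv l \<otimes> k) f) e)"
  and m_cancel:
    "\<lbrakk>g \<in> carrier G; h \<in> carrier G; k \<in> carrier G;
      f \<in> cell T g (inv h); a \<in> cell T h (inv k); b \<in> cell T (inv h \<otimes> g) (inv k \<otimes> h)\<rbrakk>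
     \<Longrightarrow> m_op T g k h (m_op T g h k f a b)
           (PPQ_op G T h (inv k) a)
           (PQ_op G T (inv h \<otimes> g) (inv k \<otimes> h) b) = f"

definition delta_iso ::
  "('g, 'n) monoid_scheme \<Rightarrow> ('g, 't) delta_ops \<Rightarrow> ('g, 'u) delta_ops
     \<Rightarrow> ('g \<Rightarrow> 'g \<Rightarrow> 't \<Rightarrow> 'u) \<Rightarrow> bool" where
  "delta_iso G T T' \<phi> \<longleftrightarrow>
     delta_group G T \<and> delta_group G T' \<and>
     (\<forall>g\<in>carrier G. \<forall>h\<in>carrier G. bij_betw (\<phi> g h) (cell T g h) (cell T' g h)) \<and>
     (\<forall>g\<in>carrier G. \<forall>h\<in>carrier G. \<forall>k\<in>carrier G.
        \<forall>a\<in>cell T g (inv\<^bsub>G\<^esub> h). \<forall>b\<in>cell T h (inv\<^bsub>G\<^esub> k).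
        \<forall>c\<in>cell T (inv\<^bsub>G\<^esub> h \<otimes>\<^bsub>G\<^esub> g) (inv\<^bsub>G\<^esub> k \<otimes>\<^bsub>G\<^esub> h).
          \<phi> g (inv\<^bsub>G\<^esub> k) (m_op T g h k a b c) =
          m_op T' g h k (\<phi> g (inv\<^bsub>G\<^esub> h) a) (\<phi> h (inv\<^bsub>G\<^esub> k) b)
            (\<phi> (inv\<^bsub>G\<^esub> h \<otimes>\<^bsub>G\<^esub> g) (inv\<^bsub>G\<^esub> k \<otimes>\<^bsub>G\<^esub> h) c)) \<and>
     (\<forall>g\<in>carrier G. \<forall>h\<in>carrier G. \<forall>x\<in>cell T g h.
        \<phi> h (inv\<^bsub>G\<^esub> g \<otimes>\<^bsub>G\<^esub> inv\<^bsub>G\<^esub> h) (P_op T g h x) = P_op T' g h (\<phi> g h x)) \<and>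
     (\<forall>g\<in>carrier G. \<forall>h\<in>carrier G. \<forall>x\<in>cell T g h.
        \<phi> (inv\<^bsub>G\<^esub> g) (h \<otimes>\<^bsub>G\<^esub> g) (Q_op T g h x) = Q_op T' g h (\<phi> g h x))"

definition delta_isomorphic ::
  "('g, 'n) monoid_scheme \<Rightarrow> ('g, 't) delta_ops \<Rightarrow> ('g, 'u) delta_ops \<Rightarrow> bool" where
  "delta_isomorphic G T T' \<longleftrightarrow> (\<exists>\<phi>. delta_iso G T T' \<phi>)"


section \<open>The Delta-group of a space\<close>

definition simplex2 :: "(real \<times> real \<times> real) set" where
  "simplex2 = {(x0, x1, x2). 0 \<le> x0 \<and> 0 \<le> x1 \<and> 0 \<le> x2 \<and> x0 + x1 + x2 = 1}"

definition simplex2_boundary :: "(real \<times> real \<times> real) set" where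
  "simplex2_boundary = {(x0, x1, x2) \<in> simplex2. x0 = 0 \<or> x1 = 0 \<or> x2 = 0}"

definition simplex3 :: "(real \<times> real \<times> real \<times> real) set" where
  "simplex3 = {(x0, x1, x2, x3).
     0 \<le> x0 \<and> 0 \<le> x1 \<and> 0 \<le> x2 \<and> 0 \<le> x3 \<and> x0 + x1 + x2 + x3 = 1}"

definition vert2 :: "nat \<Rightarrow> real \<times> real \<times> real" where
  "vert2 i = (of_bool (i = 0), of_bool (i = 1), of_bool (i = 2))"

definition vert3 :: "nat \<Rightarrow> real \<times> real \<times> real \<times> real" where
  "vert3 i = (of_bool (i = 0), of_bool (i = 1), of_bool (i = 2), of_bool (i = 3))"

definition edge :: "(real \<times> real \<times> real \<Rightarrow> 'a) \<Rightarrow> nat \<Rightarrow> nat \<Rightarrow> real \<Rightarrow> 'a" where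
  "edge a i j = a \<circ> linepath (vert2 i) (vert2 j)"

definition face ::
  "(real \<times> real \<times> real \<times> real \<Rightarrow> 'a) \<Rightarrow> nat \<Rightarrow> nat \<Rightarrow> nat \<Rightarrow> real \<times> real \<times> real \<Rightarrow> 'a" where
  "face \<omega> i j l = (\<lambda>(x0, x1, x2). \<omega> (x0 *\<^sub>R vert3 i + x1 *\<^sub>R vert3 j + x2 *\<^sub>R vert3 l))"

text \<open>Maps are total functions; \<open>homotopic_with_canon\<close> ignores their values off \<open>simplex2\<close>. Below,
  \<open>THE\<close> is justified since the class of the fourth face does not depend on the choice of \<open>\<omega>\<close>.\<close>

definition triangle_class ::
  "'a::topological_space set \<Rightarrow> (real \<times> real \<times> real \<Rightarrow> 'a) \<Rightarrow> (real \<times> real \<times> real \<Rightarrow> 'a) set" where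
  "triangle_class M a =
     {b. homotopic_with_canon (\<lambda>h. \<forall>x\<in>simplex2_boundary. h x = a x) simplex2 M a b}"

definition triangles ::
  "'a::topological_space set \<Rightarrow> 'a \<Rightarrow> ((real \<Rightarrow> 'a) set \<Rightarrow> real \<Rightarrow> 'a)
     \<Rightarrow> (real \<Rightarrow> 'a) set \<Rightarrow> (real \<Rightarrow> 'a) set \<Rightarrow> (real \<times> real \<times> real \<Rightarrow> 'a) set" where
  "triangles M m0 s \<alpha> \<beta> =
     {a. continuous_on simplex2 a \<and> a ` simplex2 \<subseteq> M \<and>
         (\<forall>t\<in>{0..1}. edge a 1 0 t = s \<alpha> t) \<and>
         (\<forall>t\<in>{0..1}. edge a 2 1 t = s \<beta> t) \<and>
         (\<forall>t\<in>{0..1}. edge a 2 0 t = s (\<beta> \<otimes>\<^bsub>pi1 M m0\<^esub> \<alpha>) t)}"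

definition Gamma_delta ::
  "'a::topological_space set \<Rightarrow> 'a \<Rightarrow> ((real \<Rightarrow> 'a) set \<Rightarrow> real \<Rightarrow> 'a)
     \<Rightarrow> ((real \<Rightarrow> 'a) set, (real \<times> real \<times> real \<Rightarrow> 'a) set) delta_ops" where
  "Gamma_delta M m0 s =
     \<lparr> cell = (\<lambda>\<alpha> \<beta>. triangle_class M ` triangles M m0 s \<alpha> \<beta>),
       m_op = (\<lambda>\<alpha> \<beta> \<gamma> A B C. THE D. \<exists>\<omega>.
         continuous_on simplex3 \<omega> \<and> \<omega> ` simplex3 \<subseteq> M \<and>
         face \<omega> 1 2 0 \<in> A \<and> face \<omega> 0 2 3 \<in> B \<and> face \<omega> 1 0 3 \<in> C \<and>
         D = triangle_class M (face \<omega> 1 2 3)),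
       P_op = (\<lambda>\<alpha> \<beta> A. \<Union>a\<in>A. triangle_class M (\<lambda>(x0, x1, x2). a (x2, x0, x1))),
       Q_op = (\<lambda>\<alpha> \<beta> A. \<Union>a\<in>A. triangle_class M (\<lambda>(x0, x1, x2). a (x1, x0, x2))) \<rparr>"


section \<open>Symmetric cohomology in degree three\<close>

text \<open>The coefficient module \<open>A\<close> is written multiplicatively; \<open>act\<close> is the action of \<open>G\<close> on it.
  Cochains are extensional functions.\<close>

definition cobound2 ::
  "('g, 'n) monoid_scheme \<Rightarrow> ('b, 'k) monoid_scheme \<Rightarrow> ('g \<Rightarrow> 'b \<Rightarrow> 'b)
     \<Rightarrow> ('g \<times> 'g \<Rightarrow> 'b) \<Rightarrow> 'g \<times> 'g \<times> 'g \<Rightarrow> 'b" where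
  "cobound2 G A act \<sigma> = (\<lambda>(x, y, z) \<in> carrier G \<times> carrier G \<times> carrier G.
     act x (\<sigma> (y, z)) \<otimes>\<^bsub>A\<^esub> inv\<^bsub>A\<^esub> (\<sigma> (x \<otimes>\<^bsub>G\<^esub> y, z)) \<otimes>\<^bsub>A\<^esub> \<sigma> (x, y \<otimes>\<^bsub>G\<^esub> z)
       \<otimes>\<^bsub>A\<^esub> inv\<^bsub>A\<^esub> (\<sigma> (x, y)))"

definition cobound3 ::
  "('g, 'n) monoid_scheme \<Rightarrow> ('b, 'k) monoid_scheme \<Rightarrow> ('g \<Rightarrow> 'b \<Rightarrow> 'b)
     \<Rightarrow> ('g \<times> 'g \<times> 'g \<Rightarrow> 'b) \<Rightarrow> 'g \<times> 'g \<times> 'g \<times> 'g \<Rightarrow> 'b" where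
  "cobound3 G A act \<alpha> = (\<lambda>(x, y, z, w) \<in> carrier G \<times> carrier G \<times> carrier G \<times> carrier G.
     act x (\<alpha> (y, z, w)) \<otimes>\<^bsub>A\<^esub> inv\<^bsub>A\<^esub> (\<alpha> (x \<otimes>\<^bsub>G\<^esub> y, z, w)) \<otimes>\<^bsub>A\<^esub> \<alpha> (x, y \<otimes>\<^bsub>G\<^esub> z, w)
       \<otimes>\<^bsub>A\<^esub> inv\<^bsub>A\<^esub> (\<alpha> (x, y, z \<otimes>\<^bsub>G\<^esub> w)) \<otimes>\<^bsub>A\<^esub> \<alpha> (x, y, z))"

definition CS2 ::
  "('g, 'n) monoid_scheme \<Rightarrow> ('b, 'k) monoid_scheme \<Rightarrow> ('g \<Rightarrow> 'b \<Rightarrow> 'b) \<Rightarrow> ('g \<times> 'g \<Rightarrow> 'b) set" where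
  "CS2 G A act =
     {\<sigma> \<in> carrier G \<times> carrier G \<rightarrow>\<^sub>E carrier A.
        \<forall>x\<in>carrier G. \<forall>y\<in>carrier G.
          \<sigma> (x, y) = inv\<^bsub>A\<^esub> (act x (\<sigma> (inv\<^bsub>G\<^esub> x, x \<otimes>\<^bsub>G\<^esub> y))) \<and>
          \<sigma> (x, y) = inv\<^bsub>A\<^esub> (\<sigma> (x \<otimes>\<^bsub>G\<^esub> y, inv\<^bsub>G\<^esub> y))}"

definition CS3 ::
  "('g, 'n) monoid_scheme \<Rightarrow> ('b, 'k) monoid_scheme \<Rightarrow> ('g \<Rightarrow> 'b \<Rightarrow> 'b)
     \<Rightarrow> ('g \<times> 'g \<times> 'g \<Rightarrow> 'b) set" where
  "CS3 G A act =
     {\<alpha> \<in> carrier G \<times> carrier G \<times> carrier G \<rightarrow>\<^sub>E carrier A.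
        \<forall>x\<in>carrier G. \<forall>y\<in>carrier G. \<forall>z\<in>carrier G.
          \<alpha> (x, y, z) = inv\<^bsub>A\<^esub> (act x (\<alpha> (inv\<^bsub>G\<^esub> x, x \<otimes>\<^bsub>G\<^esub> y, z))) \<and>
          \<alpha> (x, y, z) = inv\<^bsub>A\<^esub> (\<alpha> (x \<otimes>\<^bsub>G\<^esub> y, inv\<^bsub>G\<^esub> y, y \<otimes>\<^bsub>G\<^esub> z)) \<and>
          \<alpha> (x, y, z) = inv\<^bsub>A\<^esub> (\<alpha> (x, y \<otimes>\<^bsub>G\<^esub> z, inv\<^bsub>G\<^esub> z))}"

definition ZS3 ::
  "('g, 'n) monoid_scheme \<Rightarrow> ('b, 'k) monoid_scheme \<Rightarrow> ('g \<Rightarrow> 'b \<Rightarrow> 'b)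
     \<Rightarrow> ('g \<times> 'g \<times> 'g \<Rightarrow> 'b) monoid" where
  "ZS3 G A act =
     \<lparr> carrier = {\<alpha> \<in> CS3 G A act. cobound3 G A act \<alpha> =
         (\<lambda>_ \<in> carrier G \<times> carrier G \<times> carrier G \<times> carrier G. \<one>\<^bsub>A\<^esub>)},
       monoid.mult = (\<lambda>\<alpha> \<beta>. \<lambda>v \<in> carrier G \<times> carrier G \<times> carrier G. \<alpha> v \<otimes>\<^bsub>A\<^esub> \<beta> v),
       one = (\<lambda>_ \<in> carrier G \<times> carrier G \<times> carrier G. \<one>\<^bsub>A\<^esub>) \<rparr>"

definition BS3 ::
  "('g, 'n) monoid_scheme \<Rightarrow> ('b, 'k) monoid_scheme \<Rightarrow> ('g \<Rightarrow> 'b \<Rightarrow> 'b)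
     \<Rightarrow> ('g \<times> 'g \<times> 'g \<Rightarrow> 'b) set" where
  "BS3 G A act = cobound2 G A act ` CS2 G A act"

definition HS3 ::
  "('g, 'n) monoid_scheme \<Rightarrow> ('b, 'k) monoid_scheme \<Rightarrow> ('g \<Rightarrow> 'b \<Rightarrow> 'b)
     \<Rightarrow> ('g \<times> 'g \<times> 'g \<Rightarrow> 'b) set monoid" where
  "HS3 G A act = ZS3 G A act Mod BS3 G A act"


section \<open>The Delta-group of a module and a 3-cochain\<close>

definition T_delta ::
  "('g, 'n) monoid_scheme \<Rightarrow> ('b, 'k) monoid_scheme \<Rightarrow> ('g \<Rightarrow> 'b \<Rightarrow> 'b)
     \<Rightarrow> ('g \<times> 'g \<times> 'g \<Rightarrow> 'b) \<Rightarrow> ('g, 'b \<times> 'g \<times> 'g) delta_ops" where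
  "T_delta G A act \<alpha> =
     \<lparr> cell = (\<lambda>g h. {(a, (g, h)) | a. a \<in> carrier A}),
       m_op = (\<lambda>g h k (a, _) (b, _) (c, _).
         (a \<otimes>\<^bsub>A\<^esub> act (inv\<^bsub>G\<^esub> g \<otimes>\<^bsub>G\<^esub> h) b \<otimes>\<^bsub>A\<^esub> c
            \<otimes>\<^bsub>A\<^esub> \<alpha> (inv\<^bsub>G\<^esub> g \<otimes>\<^bsub>G\<^esub> h, inv\<^bsub>G\<^esub> h \<otimes>\<^bsub>G\<^esub> k, inv\<^bsub>G\<^esub> k),
          (g, inv\<^bsub>G\<^esub> k))),
       P_op = (\<lambda>g h (a, _). (act g a, (h, inv\<^bsub>G\<^esub> g \<otimes>\<^bsub>G\<^esub> inv\<^bsub>G\<^esub> h))),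
       Q_op = (\<lambda>g h (a, _). (inv\<^bsub>A\<^esub> (act g a), (inv\<^bsub>G\<^esub> g, h \<otimes>\<^bsub>G\<^esub> g))) \<rparr>"

end

theory Submission
  imports Defs
begin

text \<open>A map of the tetrahedron whose faces are given triangles expresses one face through the other
  three, and the fourth face is, up to homotopy, the triangle subdivided at its barycenter and
  carrying the other three. Hence every identity for \<open>m\<close> amounts to exhibiting one tetrahedron;
  axiom (4) comes from a tetrahedron subdivided at its barycenter.

  Together with the degenerate triangles the axioms make \<open>T(1,1)\<close> an abelian group with an action
  of \<open>G\<close>, and every \<open>T(g,h)\<close> a torsor under it, compatibly with \<open>m, P, Q\<close>. Here \<open>T(1,1)\<close> is
  \<open>\<pi>\<^sub>2\<close>, and the action is the geometric one because a prism is the union of three tetrahedra.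

  \<open>P\<close> and \<open>Q\<close> generate an action of the symmetric group on three letters. If \<open>G\<close> has no elements
  of order 2 and 3, this group acts freely on the pairs \<open>(g,h)\<close> except for those with \<open>g = 1\<close>,
  \<open>h = 1\<close> or \<open>hg = 1\<close>, which carry degenerate triangles. So one can choose base points of all
  \<open>T(g,h)\<close> invariant under \<open>P\<close> and \<open>Q\<close>, and the coordinates of \<open>m\<close> with respect to them form a
  symmetric cocycle.\<close>

section \<open>The calculus of labelled triangles\<close>

text \<open>Axioms (1)-(5) name no neutral element; the degenerate triangles supply it, so their
  laws \<open>Q_d\<close>, \<open>P_d\<close> and \<open>m_degenerate\<close> belong to the
  calculus. The obstacle is that a base point invariant under \<open>P\<close> and \<open>Q\<close>
  must be fixed by the stabiliser of its index pair, and a group acting on a torsor need not fix any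
  point. On a free orbit one cell is chosen and spread over the orbit; on the remaining pairs, where
  two labels coincide, the degenerate triangle is fixed by the stabiliser. Invariance of the base
  points is what makes the coordinates symmetric: permuting the vertices of a tetrahedron of base
  points changes its coordinate only by sign and by the action. \<open>P_m\<close> and
  \<open>Q_m\<close> permute the three outer vertices and \<open>m_cancel\<close> exchanges the
  inner vertex with an outer one, which together gives all relations of \<open>CS3\<close>. The two
  sides of \<open>m_assoc\<close> contain two and three coordinates, the five terms of the cocycle
  identity. Moving the base points by an element of \<open>CS2\<close> keeps them invariant and adds
  its coboundary to the cocycle, which is why a whole class in \<open>HS3\<close> is
  realised.\<close>

text \<open>Homogeneous coordinates: \<open>C u v w\<close> consists of the cells whose vertices 0, 1, 2 carry the
  labels \<open>u, v, w\<close>, so \<open>C u v w\<close> is \<open>T(v\<^sup>-\<^sup>1u, w\<^sup>-\<^sup>1v)\<close>, and \<open>T(g, h)\<close> is \<open>C g 1 h\<^sup>-\<^sup>1\<close>. The label \<open>x\<close> in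
  the rules for \<open>m\<close> is that of the vertex 0 of the tetrahedron. The cell \<open>d u w\<close> is the
  degenerate triangle on the edge from \<open>u\<close> to \<open>w\<close>.\<close>

locale triangle_calculus =
  fixes U :: "'g set" and C :: "'g \<Rightarrow> 'g \<Rightarrow> 'g \<Rightarrow> 't set"
    and m :: "'t \<Rightarrow> 't \<Rightarrow> 't \<Rightarrow> 't" and P Q :: "'t \<Rightarrow> 't" and d :: "'g \<Rightarrow> 'g \<Rightarrow> 't"
  assumes C_U: "a \<in> C u v w \<Longrightarrow> u \<in> U \<and> v \<in> U \<and> w \<in> U"
    and C_nonempty: "\<lbrakk>u \<in> U; v \<in> U; w \<in> U\<rbrakk> \<Longrightarrow> C u v w \<noteq> {}"
    and m_closed: "\<lbrakk>a \<in> C u v x; b \<in> C x v w; c \<in> C u x w\<rbrakk> \<Longrightarrow> m a b c \<in> C u v w"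
    and P_closed: "a \<in> C u v w \<Longrightarrow> P a \<in> C v w u"
    and Q_closed: "a \<in> C u v w \<Longrightarrow> Q a \<in> C v u w"
    and PPP: "a \<in> C u v w \<Longrightarrow> P (P (P a)) = a"
    and QQ: "a \<in> C u v w \<Longrightarrow> Q (Q a) = a"
    and PPQ: "a \<in> C u v w \<Longrightarrow> P (P (Q a)) = Q (P a)"
    and P_m: "\<lbrakk>a \<in> C u v x; b \<in> C x v w; c \<in> C u x w\<rbrakk> \<Longrightarrow> P (m a b c) = m (P b) (P c) (P a)"
    and Q_m: "\<lbrakk>a \<in> C u v x; b \<in> C x v w; c \<in> C u x w\<rbrakk> \<Longrightarrow> Q (m a b c) = m (Q a) (Q c) (Q b)"
    and m_assoc: "\<lbrakk>a \<in> C u v x; b \<in> C x v y; c \<in> C u x y; e \<in> C y v w; f \<in> C u y w; g \<in> C x y w\<rbrakk>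
      \<Longrightarrow> m (m a b c) e f = m a (m b e g) (m c (Q g) f)"
    and m_cancel: "\<lbrakk>f \<in> C u v x; a \<in> C x v w; b \<in> C u x w\<rbrakk>
      \<Longrightarrow> m (m f a b) (P (P (Q a))) (P (Q b)) = f"
    and d_closed: "\<lbrakk>u \<in> U; w \<in> U\<rbrakk> \<Longrightarrow> d u w \<in> C u u w"
    and Q_d: "\<lbrakk>u \<in> U; w \<in> U\<rbrakk> \<Longrightarrow> Q (d u w) = d u w"
    and P_d: "u \<in> U \<Longrightarrow> P (d u u) = d u u"
    and m_degenerate: "a \<in> C u v w \<Longrightarrow> m a (P (d w v)) (P (P (d w u))) = a"
begin

section \<open>Formal rules: mirror images, cancellation and degenerate cells\<close>

lemma PP_closed: "a \<in> C u v w \<Longrightarrow> P (P a) \<in> C w u v"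
  by (intro P_closed)

lemma Pd_closed: "\<lbrakk>u \<in> U; w \<in> U\<rbrakk> \<Longrightarrow> P (d u w) \<in> C u w u"
  by (intro P_closed d_closed)

lemma PPd_closed: "\<lbrakk>u \<in> U; w \<in> U\<rbrakk> \<Longrightarrow> P (P (d u w)) \<in> C w u u"
  by (intro PP_closed d_closed)

lemma PPP_d: "\<lbrakk>u \<in> U; w \<in> U\<rbrakk> \<Longrightarrow> P (P (P (d u w))) = d u w"
  using PPP d_closed by blast

lemma PP_m:
  assumes "a \<in> C u v x" "b \<in> C x v w" "c \<in> C u x w"
  shows "P (P (m a b c)) = m (P (P c)) (P (P a)) (P (P b))"
  using P_m[OF assms] P_m[OF P_closed[OF assms(2)] P_closed[OF assms(3)] P_closed[OF assms(1)]]
  by simp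

lemma P_inject: "\<lbrakk>a \<in> C u v w; b \<in> C u v w; P a = P b\<rbrakk> \<Longrightarrow> a = b"
  by (metis PPP)

text \<open>In the symmetric group generated by the rotation \<open>P\<close> and the transposition
  \<open>Q\<close>, the products \<open>PQ\<close> and, in the next lemma, \<open>PPQ\<close> are
  the two other transpositions, hence involutions.\<close>

lemma PQPQ: "a \<in> C u v w \<Longrightarrow> P (Q (P (Q a))) = a"
  by (metis PPQ PPP QQ Q_closed)

lemma PPQPPQ: "a \<in> C u v w \<Longrightarrow> P (P (Q (P (P (Q a))))) = a"
  by (metis PPQ QQ P_closed Q_closed PPP)

lemma m_inj1:
  assumes "f \<in> C u v x" "f' \<in> C u v x" "a \<in> C x v w" "b \<in> C u x w" "m f a b = m f' a b"
  shows "f = f'"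
  by (metis assms m_cancel)

text \<open>The preimage is \<open>h\<close> with the mirror images of \<open>a\<close> and
  \<open>b\<close> glued on. Mirroring is an involution, so \<open>m_cancel\<close> for the mirrored
  pair is the required equation.\<close>

lemma m_surj1:
  assumes "a \<in> C x v w" "b \<in> C u x w" "h \<in> C u v w"
  shows "\<exists>f \<in> C u v x. m f a b = h"
proof -
  have a': "P (P (Q a)) \<in> C w v x" and b': "P (Q b) \<in> C u w x"
    using assms by (auto intro: P_closed Q_closed)
  have "m (m h (P (P (Q a))) (P (Q b))) a b = h"
    using m_cancel[OF assms(3) a' b'] assms by (simp add: PPQPPQ PQPQ)
  then show ?thesis using m_closed[OF assms(3) a' b'] by blast
qed

text \<open>Rotating twice brings the third argument of \<open>m\<close> to the first place, where
  \<open>m_inj1\<close> applies.\<close>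

lemma m_inj3:
  assumes "a \<in> C u v x" "b \<in> C x v w" "f \<in> C u x w" "f' \<in> C u x w" "m a b f = m a b f'"
  shows "f = f'"
proof -
  have "m (P (P f)) (P (P a)) (P (P b)) = m (P (P f')) (P (P a)) (P (P b))"
    using assms PP_m by metis
  then have "P (P f) = P (P f')"
    using assms by (intro m_inj1[of "P (P f)" w u x "P (P f')" "P (P a)" v "P (P b)"]) (auto intro: P_closed)
  then show ?thesis using assms PPP by metis
qed

lemma m_surj3:
  assumes "a \<in> C u v x" "b \<in> C x v w" "h \<in> C u v w"
  shows "\<exists>f \<in> C u x w. m a b f = h"
proof -
  obtain f where f: "f \<in> C w u x" "m f (P (P a)) (P (P b)) = P (P h)"
    using m_surj1[OF PP_closed[OF assms(1)] PP_closed[OF assms(2)] PP_closed[OF assms(3)]] by blast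
  have "P (m f (P (P a)) (P (P b))) = m a b (P f)"
    using P_m[OF f(1) PP_closed[OF assms(1)] PP_closed[OF assms(2)]] assms PPP by metis
  then have "m a b (P f) = h"
    using f assms PPP by metis
  then show ?thesis using P_closed[OF f(1)] by blast
qed

text \<open>In \<open>m_degenerate\<close> the inner vertex of the tetrahedron merges with the third
  outer vertex. Rotation gives the law for merging with the second one, here, and with the first
  one, in \<open>m_degenerate1\<close>.\<close>

lemma m_degenerate2:
  assumes "a \<in> C u v w"
  shows "m (P (P (d v u))) (d v w) a = a"
proof -
  have U: "u \<in> U" "v \<in> U" "w \<in> U" using C_U assms by blast+
  have a: "P (P a) \<in> C w u v" using assms by (rule PP_closed)
  have "P (m (P (P a)) (P (d v u)) (P (P (d v w)))) = P (P (P a))"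
    by (simp add: m_degenerate[OF a])
  then show ?thesis
    using P_m[OF a Pd_closed PPd_closed] U PPP_d PPP[OF assms] by simp
qed

lemma m_degenerate1:
  assumes "a \<in> C u v w"
  shows "m (P (d u v)) a (d u w) = a"
proof -
  have U: "u \<in> U" "v \<in> U" "w \<in> U" using C_U assms by blast+
  have a: "P (P a) \<in> C w u v" using assms by (rule PP_closed)
  have "P (m (P (P (d u w))) (d u v) (P (P a))) = P (P (P a))"
    by (simp add: m_degenerate2[OF a])
  then show ?thesis
    using P_m[OF PPd_closed d_closed a] U PPP_d PPP[OF assms] by simp
qed

text \<open>A cell glued to its own mirror image collapses. Take \<open>f\<close> and
  \<open>a\<close> degenerate in \<open>m_cancel\<close> and let \<open>b\<close> be the rotated
  \<open>z\<close>: by \<open>m_degenerate2\<close> the inner gluing is just \<open>b\<close>, and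
  the equation left over is the claim up to rotation.\<close>

lemma m_fold:
  assumes "z \<in> C v w u"
  shows "m (d v w) (Q z) z = d v u"
proof -
  have U: "u \<in> U" "v \<in> U" "w \<in> U" using C_U assms by blast+
  have x: "P (P z) \<in> C u v w" using assms by (rule PP_closed)
  have "m (P (P z)) (P (P (d v w))) (P (Q (P (P z)))) = P (P (d v u))"
    using m_cancel[OF PPd_closed d_closed x] m_degenerate2[OF x] U Q_d assms by simp
  moreover have "P (Q (P (P z))) \<in> C u w v"
    by (rule P_closed[OF Q_closed[OF x]])
  ultimately have "m (P (P (P (d v w)))) (P (P (Q (P (P z))))) (P (P (P z))) = P (P (P (d v u)))"
    using P_m[OF x PPd_closed] U by metis
  moreover have "P (P (Q (P (P z)))) = Q z"
    using PPQ[OF x] PPP[OF assms] by simp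
  ultimately show ?thesis using U PPP_d PPP[OF assms] by metis
qed

subsection \<open>The abelian group of cells with a single label\<close>

text \<open>With a degenerate middle argument the two neutral laws are instances of the degenerate
  laws. By \<open>m_plus\<close> all three arguments of \<open>m\<close> contribute equally in the
  end.\<close>

definition plus :: "'g \<Rightarrow> 't \<Rightarrow> 't \<Rightarrow> 't" where
  "plus u a b = m a (d u u) b"

lemma zero_closed: "u \<in> U \<Longrightarrow> d u u \<in> C u u u"
  by (rule d_closed)

lemma plus_closed: "\<lbrakk>a \<in> C u u u; b \<in> C u u u\<rbrakk> \<Longrightarrow> plus u a b \<in> C u u u"
  unfolding plus_def using C_U d_closed m_closed by metis

context
  fixes u assumes u: "u \<in> U"
begin

private abbreviation "A \<equiv> C u u u"
private abbreviation "z \<equiv> d u u"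

lemma plus_zero_right: "a \<in> A \<Longrightarrow> plus u a z = a"
  unfolding plus_def using m_degenerate[of a u u u] P_d[OF u] by simp

lemma plus_zero_left: "a \<in> A \<Longrightarrow> plus u z a = a"
  unfolding plus_def using m_degenerate2[of a u u u] P_d[OF u] by simp

private lemma m_zbz: "b \<in> A \<Longrightarrow> m z b z = b"
  using m_degenerate1[of b u u u] P_d[OF u] by simp

private lemma z_mem: "z \<in> A" using d_closed u by blast

text \<open>Here and in \<open>step2\<close> two of the six entries of \<open>m_assoc\<close> are
  zero. What remains moves a summand from one argument of \<open>m\<close> to another, until every
  \<open>m\<close> with a single label is a sum.\<close>

private lemma step1:
  assumes "c \<in> A" "e \<in> A" "f \<in> A" "a \<in> A"
  shows "m (plus u a c) e f = m a e (plus u c f)"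
  using m_assoc[OF assms(4) z_mem assms(1) assms(2,3) z_mem] assms m_zbz Q_d u
  by (simp add: plus_def)

private lemma step2:
  assumes "a \<in> A" "b \<in> A" "e \<in> A" "f \<in> A"
  shows "m (m a b z) e f = m a (m b e z) f"
  using m_assoc[OF assms(1,2) z_mem assms(3,4) z_mem] assms plus_zero_left Q_d u
  by (simp add: plus_def)

lemma plus_assoc: "\<lbrakk>a \<in> A; b \<in> A; c \<in> A\<rbrakk> \<Longrightarrow> plus u (plus u a b) c = plus u a (plus u b c)"
  using step1[of b z c a] z_mem by (simp add: plus_def)

private lemma m_zbe: "\<lbrakk>b \<in> A; e \<in> A\<rbrakk> \<Longrightarrow> m z b e = plus u b e"
  using step2[of z b z e] z_mem m_zbz plus_zero_right by (simp add: plus_def)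

private lemma m_bez: "\<lbrakk>b \<in> A; e \<in> A\<rbrakk> \<Longrightarrow> m b e z = plus u e b"
  using step1[of b e z z] z_mem m_zbe plus_zero_left plus_zero_right by simp

private lemma m_plus': "\<lbrakk>a \<in> A; b \<in> A; c \<in> A\<rbrakk> \<Longrightarrow> m a b c = plus u (plus u b a) c"
  using step2[of z a b c] z_mem m_zbz m_bez m_zbe plus_closed by simp

text \<open>\<open>m a z b\<close> and \<open>m b a z\<close> are the same sum, but rotation turns
  them into sums of \<open>P a\<close> and \<open>P b\<close> in opposite orders. As
  \<open>P\<close> is onto, all elements commute.\<close>

lemma plus_commute:
  assumes "a \<in> A" "b \<in> A"
  shows "plus u a b = plus u b a"
proof -
  have *: "plus u (P a) (P b) = plus u (P b) (P a)" if "a \<in> A" "b \<in> A" for a b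
  proof -
    have "P (plus u a b) = plus u (P b) (P a)"
      using P_m[OF that(1) z_mem that(2)] m_zbe P_d[OF u] P_closed that by (simp add: plus_def)
    moreover have "P (m b a z) = plus u (P a) (P b)"
      using P_m[OF that(2,1) z_mem] P_d[OF u] by (simp add: plus_def)
    ultimately show ?thesis using m_bez that by simp
  qed
  show ?thesis
    using *[OF PP_closed[OF assms(1)] PP_closed[OF assms(2)]] assms PPP by simp
qed

lemma m_plus: "\<lbrakk>a \<in> A; b \<in> A; c \<in> A\<rbrakk> \<Longrightarrow> m a b c = plus u (plus u a b) c"
  using m_plus' plus_commute by simp

text \<open>The inner cell \<open>g\<close> of \<open>m_assoc\<close> occurs on the right as
  \<open>g\<close> and as \<open>Q g\<close>, and not at all on the left. With all other entries
  zero the two occurrences must cancel.\<close>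

lemma plus_Q:
  assumes "a \<in> A"
  shows "plus u a (Q a) = z"
proof -
  have "m (m z z z) z z = m z (m z z a) (m z (Q a) z)"
    by (rule m_assoc[OF z_mem z_mem z_mem z_mem z_mem assms])
  then show ?thesis
    using m_zbz[OF z_mem] m_zbz[OF Q_closed[OF assms]] m_zbe[OF z_mem assms]
      plus_zero_left[OF assms] m_zbe[OF assms Q_closed[OF assms]] by simp
qed

lemma plus_left_cancel:
  assumes "a \<in> A" "b \<in> A" "c \<in> A" "plus u a b = plus u a c"
  shows "b = c"
  by (metis (no_types, lifting) assms Q_closed plus_Q plus_assoc plus_commute plus_zero_left)

text \<open>\<open>P\<close> is additive, so it commutes with the inversion \<open>Q\<close>.
  Together with \<open>PPQ\<close> this says that \<open>P (Q c)\<close> is fixed by one more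
  rotation, so \<open>P\<close> fixes \<open>Q c\<close>, and every element has this form.\<close>

lemma P_single: assumes "a \<in> A" shows "P a = a"
proof -
  have P_plus: "P (plus u b c) = plus u (P b) (P c)" if "b \<in> A" "c \<in> A" for b c
    using P_m[OF that(1) z_mem that(2)] m_zbe P_d[OF u] P_closed that plus_commute
    by (simp add: plus_def)
  have *: "P b = b" if b: "b = Q c" "c \<in> A" for b c
  proof -
    have "plus u (P c) (P (Q c)) = z"
      using P_plus[OF that(2) Q_closed[OF that(2)]] plus_Q[OF that(2)] P_d[OF u] by simp
    moreover have "plus u (P c) (Q (P c)) = z"
      using plus_Q P_closed that(2) by blast
    ultimately have "P (Q c) = Q (P c)"
      using plus_left_cancel[of "P c" "P (Q c)" "Q (P c)"] P_closed Q_closed that(2) by simp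
    then have "P (Q c) = P (P (Q c))"
      using PPQ[OF that(2)] by simp
    then show ?thesis using P_inject[of "Q c" u u u "P (Q c)"] P_closed Q_closed that by metis
  qed
  show ?thesis using *[of a "Q a"] assms QQ Q_closed by simp
qed

end

subsection \<open>Each set of cells is a torsor\<close>

definition ins :: "'g \<Rightarrow> 'g \<Rightarrow> 't \<Rightarrow> 't" where
  "ins u w a = m a (d u w) (d u w)"

text \<open>By \<open>m_degenerate1\<close>, \<open>x\<close> itself is
  \<open>m (P (d u v)) x (d u w)\<close>. The sphere \<open>a\<close> is attached to the degenerate
  third argument, so it acts on an arbitrary cell by means of \<open>m\<close> alone.\<close>

definition st :: "'g \<Rightarrow> 'g \<Rightarrow> 'g \<Rightarrow> 't \<Rightarrow> 't \<Rightarrow> 't" where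
  "st u v w x a = m (P (d u v)) x (ins u w a)"

text \<open>\<open>st\<close> changes a cell at its vertex \<open>0\<close>; \<open>st1\<close> and \<open>st2\<close> do the same at the vertices
  \<open>1\<close> and \<open>2\<close>.\<close>

definition st1 :: "'g \<Rightarrow> 'g \<Rightarrow> 'g \<Rightarrow> 't \<Rightarrow> 't \<Rightarrow> 't" where
  "st1 u v w x b = P (P (st v w u (P x) b))"

definition st2 :: "'g \<Rightarrow> 'g \<Rightarrow> 'g \<Rightarrow> 't \<Rightarrow> 't \<Rightarrow> 't" where
  "st2 u v w x c = P (st w u v (P (P x)) c)"

lemma ins_closed: "\<lbrakk>a \<in> C u u u; w \<in> U\<rbrakk> \<Longrightarrow> ins u w a \<in> C u u w"
  unfolding ins_def using C_U d_closed m_closed by metis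

lemma st_closed: "\<lbrakk>x \<in> C u v w; a \<in> C u u u\<rbrakk> \<Longrightarrow> st u v w x a \<in> C u v w"
  unfolding st_def using m_closed Pd_closed ins_closed C_U by metis

lemma st2_closed: "\<lbrakk>x \<in> C u v w; a \<in> C w w w\<rbrakk> \<Longrightarrow> st2 u v w x a \<in> C u v w"
  unfolding st2_def by (intro P_closed st_closed)

text \<open>With inner cell \<open>z\<close>, both compound arguments on the right of
  \<open>m_assoc\<close> become a degenerate cell glued to \<open>Q z\<close> and \<open>z\<close>,
  which \<open>m_fold\<close> collapses. So the sphere passes from the edge to \<open>x\<close> over
  to the edge to \<open>w\<close>.\<close>

lemma ins_fold:
  assumes "a \<in> C u u u" "z \<in> C u x w"
  shows "m (ins u x a) (Q z) z = ins u w a"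
proof -
  have U: "u \<in> U" "x \<in> U" "w \<in> U" using C_U assms by blast+
  show ?thesis
    unfolding ins_def
    using m_assoc[OF assms(1) d_closed d_closed Q_closed[OF assms(2)] assms(2) assms(2)] U
      m_fold[OF assms(2)]
    by simp
qed

text \<open>The sphere sits in the third argument of the inner \<open>m\<close>. With inner cell
  \<open>z\<close>, \<open>m_assoc\<close> leaves \<open>m x y z\<close> intact and hands the sphere
  to \<open>ins_fold\<close>.\<close>

lemma m_st_first:
  assumes "x \<in> C u v o'" "y \<in> C o' v w" "z \<in> C u o' w" "a \<in> C u u u"
  shows "m (st u v o' x a) y z = st u v w (m x y z) a"
proof -
  have U: "u \<in> U" "v \<in> U" "o' \<in> U" using C_U assms by blast+
  show ?thesis
    unfolding st_def
    using m_assoc[OF Pd_closed assms(1) ins_closed[OF assms(4)] assms(2,3,3)] U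
      ins_fold[OF assms(4,3)]
    by simp
qed

lemma m_ins:
  assumes "a \<in> C u u u" "b \<in> C u u u" "c \<in> C u u u" "w \<in> U"
  shows "m a (ins u w b) (ins u w c) = ins u w (m a b c)"
proof -
  have U: "u \<in> U" using C_U assms by blast
  show ?thesis
    using m_assoc[OF assms(1-3) d_closed d_closed d_closed] U assms(4) Q_d
    by (simp add: ins_def)
qed

lemma Q_ins:
  assumes "a \<in> C u u u" "w \<in> U"
  shows "Q (ins u w a) = ins u w (Q a)"
  unfolding ins_def using Q_m[OF assms(1) d_closed d_closed] Q_d C_U assms by metis

lemma st_st:
  assumes "x \<in> C u v w" "a \<in> C u u u" "b \<in> C u u u"
  shows "st u v w (st u v w x a) b = st u v w x (plus u a b)"
proof -
  have U: "u \<in> U" "v \<in> U" "w \<in> U" using C_U assms by blast+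
  have ab: "plus u a b \<in> C u u u" using assms plus_closed by blast
  \<comment> \<open>Below, \<open>m_assoc\<close> has the inner cell \<open>ins u w a\<close>; its
    mirror image subtracts \<open>a\<close> on the other side, so the coefficient there has to be a
    + b to leave b.\<close>
  have "plus u (Q a) (plus u a b) = b"
    using U assms ab Q_closed plus_Q plus_assoc plus_commute plus_zero_left by metis
  then have *: "m (d u u) (Q (ins u w a)) (ins u w (plus u a b)) = ins u w b"
    using Q_ins[OF assms(2) U(3)] m_ins[OF zero_closed Q_closed[OF assms(2)] ab U(3)] U
      m_plus[OF U(1) zero_closed Q_closed[OF assms(2)] ab] plus_zero_left[OF U(1)] Q_closed assms(2)
    by simp
  have p: "m (P (d u v)) (P (d u v)) (d u u) = P (d u v)"
    using m_degenerate1[OF Pd_closed[OF U(1,2)]] .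
  show ?thesis
    unfolding st_def
    using m_assoc[OF Pd_closed Pd_closed zero_closed assms(1) ins_closed[OF ab] ins_closed[OF assms(2)]]
      U p *
    by simp
qed

lemma st_zero:
  assumes "x \<in> C u v w"
  shows "st u v w x (d u u) = x"
proof -
  have U: "u \<in> U" "v \<in> U" "w \<in> U" using C_U assms by blast+
  have "ins u w (d u u) = d u w"
    using m_degenerate1[OF d_closed[OF U(1,3)]] P_d[OF U(1)] by (simp add: ins_def)
  then show ?thesis using m_degenerate1[OF assms] by (simp add: st_def)
qed

lemma st_inj:
  assumes "x \<in> C u v w" "a \<in> C u u u" "b \<in> C u u u" "st u v w x a = st u v w x b"
  shows "a = b"
proof -
  have U: "u \<in> U" "v \<in> U" "w \<in> U" using C_U assms by blast+
  have "ins u w a = ins u w b"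
    using m_inj3[OF Pd_closed assms(1) ins_closed[OF assms(2)] ins_closed[OF assms(3)]] U assms(4)
    unfolding st_def by blast
  then show ?thesis
    using m_inj1[OF assms(2,3) d_closed d_closed] U unfolding ins_def by blast
qed

lemma st_surj:
  assumes "x \<in> C u v w" "y \<in> C u v w"
  shows "\<exists>a \<in> C u u u. st u v w x a = y"
proof -
  have U: "u \<in> U" "v \<in> U" "w \<in> U" using C_U assms by blast+
  obtain q where q: "q \<in> C u u w" "m (P (d u v)) x q = y"
    using m_surj3[OF Pd_closed assms] U by blast
  obtain a where "a \<in> C u u u" "m a (d u w) (d u w) = q"
    using m_surj1[OF d_closed d_closed q(1)] U by blast
  then show ?thesis using q unfolding st_def ins_def by blast
qed

section \<open>Compatibility of the torsor structure with Q and m\<close>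

lemma Q_st:
  assumes "x \<in> C u v w" "a \<in> C u u u"
  shows "Q (st u v w x a) = st1 v u w (Q x) (Q a)"
proof -
  have U: "u \<in> U" "v \<in> U" "w \<in> U" using C_U assms by blast+
  define b where "b = Q a"
  define y where "y = Q x"
  have b: "b \<in> C u u u" and y: "y \<in> C v u w"
    using assms Q_closed by (simp_all add: b_def y_def)
  have "Q (st u v w x a) = m (Q (P (d u v))) (ins u w b) y"
    unfolding st_def y_def b_def
    using Q_m[OF Pd_closed assms(1) ins_closed[OF assms(2)]] U Q_ins[OF assms(2)] Q_m by simp
  also have "Q (P (d u v)) = P (P (d u v))"
    using PPQ[OF d_closed] U Q_d by simp
  finally have lhs: "Q (st u v w x a) = m (P (P (d u v))) (ins u w b) y" .
  have Pins: "P (P (ins u v b)) = m (P (P (d u v))) b (P (P (d u v)))"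
    unfolding ins_def using PP_m[OF b d_closed d_closed] U P_single[OF U(1)] b by simp
  have "st u w v (P y) b = m (P (d u w)) (P y) (ins u v b)"
    by (simp add: st_def)
  then have "st1 v u w y b = m (P (P (ins u v b))) (P (P (P (d u w)))) (P (P (P y)))"
    unfolding st1_def using PP_m[OF Pd_closed P_closed[OF y] ins_closed[OF b]] U by simp
  also have "\<dots> = m (m (P (P (d u v))) b (P (P (d u v)))) (d u w) y"
    using Pins PPP_d U PPP[OF y] by simp
  \<comment> \<open>The inner cell is \<open>d u w\<close>, its own mirror image. It turns one
    compound argument into \<open>ins u w b\<close> and disappears from the other.\<close>
  also have "\<dots> = m (P (P (d u v))) (m b (d u w) (d u w)) (m (P (P (d u v))) (Q (d u w)) y)"
    by (rule m_assoc[OF PPd_closed b PPd_closed d_closed y d_closed]) (use U in auto)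
  also have "\<dots> = m (P (P (d u v))) (ins u w b) y"
    using Q_d U m_degenerate2[OF y] by (simp add: ins_def)
  finally show ?thesis using lhs by (simp add: y_def b_def)
qed

text \<open>This rule and the three after it are \<open>m_st_first\<close> conjugated by
  permutations of the vertices; each choice of argument and vertex needs its own conjugation by
  \<open>Q\<close> or by powers of \<open>P\<close>.\<close>

lemma m_st1_first:
  assumes "x \<in> C u v o'" "y \<in> C o' v w" "z \<in> C u o' w" "b \<in> C v v v"
  shows "m (st1 u v o' x b) y z = st1 u v w (m x y z) b"
proof -
  have QX: "st v u o' (Q x) (Q b) \<in> C v u o'"
    using assms by (intro st_closed Q_closed)
  have "m (st1 u v o' x b) y z = m (Q (st v u o' (Q x) (Q b))) (Q (Q y)) (Q (Q z))"
    using Q_st[OF Q_closed[OF assms(1)] Q_closed[OF assms(4)]] assms QQ by simp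
  also have "\<dots> = Q (m (st v u o' (Q x) (Q b)) (Q z) (Q y))"
    using Q_m[OF QX Q_closed[OF assms(3)] Q_closed[OF assms(2)]] by simp
  also have "\<dots> = Q (st v u w (m (Q x) (Q z) (Q y)) (Q b))"
    using m_st_first[OF Q_closed Q_closed Q_closed Q_closed] assms by simp
  also have "\<dots> = st1 u v w (Q (m (Q x) (Q z) (Q y))) (Q (Q b))"
    using Q_st[OF m_closed[OF Q_closed Q_closed Q_closed] Q_closed] assms by simp
  also have "Q (m (Q x) (Q z) (Q y)) = m x y z"
    using Q_m[OF Q_closed Q_closed Q_closed] assms QQ by simp
  finally show ?thesis using QQ assms by simp
qed

lemma m_st_third:
  assumes "x \<in> C u v o'" "y \<in> C o' v w" "z \<in> C u o' w" "a \<in> C u u u"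
  shows "m x y (st u o' w z a) = st u v w (m x y z) a"
proof -
  have z': "st u o' w z a \<in> C u o' w" using assms st_closed by blast
  have xyz: "m x y z \<in> C u v w" using assms m_closed by blast
  have "P (P (m x y (st u o' w z a))) = m (st1 w u o' (P (P z)) a) (P (P x)) (P (P y))"
    using PP_m[OF assms(1,2) z'] PPP[OF assms(3)] by (simp add: st1_def)
  also have "\<dots> = st1 w u v (m (P (P z)) (P (P x)) (P (P y))) a"
    using m_st1_first[OF PP_closed PP_closed PP_closed assms(4)] assms by blast
  also have "\<dots> = P (P (st u v w (m x y z) a))"
    using PP_m[OF assms(1-3)] PPP[OF xyz] by (metis st1_def)
  finally show ?thesis
    using P_inject P_closed m_closed[OF assms(1,2) z'] st_closed[OF xyz assms(4)] by metis
qed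

lemma m_st2_third:
  assumes "x \<in> C u v o'" "y \<in> C o' v w" "z \<in> C u o' w" "c \<in> C w w w"
  shows "m x y (st2 u o' w z c) = st2 u v w (m x y z) c"
proof -
  have z': "st w u o' (P (P z)) c \<in> C w u o'" using assms by (intro st_closed P_closed)
  have "m x y (st2 u o' w z c) = P (m (st w u o' (P (P z)) c) (P (P x)) (P (P y)))"
    using P_m[OF z' PP_closed[OF assms(1)] PP_closed[OF assms(2)]] PPP assms by (simp add: st2_def)
  also have "\<dots> = P (st w u v (m (P (P z)) (P (P x)) (P (P y))) c)"
    using m_st_first[OF PP_closed PP_closed PP_closed assms(4)] assms by simp
  finally show ?thesis using PP_m[OF assms(1-3)] by (simp add: st2_def)
qed

lemma m_st2_second:
  assumes "x \<in> C u v o'" "y \<in> C o' v w" "z \<in> C u o' w" "c \<in> C w w w"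
  shows "m x (st2 o' v w y c) z = st2 u v w (m x y z) c"
proof -
  have y': "st w o' v (P (P y)) c \<in> C w o' v" using assms by (intro st_closed P_closed)
  have "m x (st2 o' v w y c) z = P (m (P (P z)) (P (P x)) (st w o' v (P (P y)) c))"
    using P_m[OF PP_closed[OF assms(3)] PP_closed[OF assms(1)] y'] PPP assms by (simp add: st2_def)
  also have "\<dots> = P (st w u v (m (P (P z)) (P (P x)) (P (P y))) c)"
    using m_st_third[OF PP_closed PP_closed PP_closed assms(4)] assms by simp
  finally show ?thesis using PP_m[OF assms(1-3)] by (simp add: st2_def)
qed

subsection \<open>Transport between the groups at different labels\<close>

text \<open>The change of base point for the second homotopy group, from label \<open>w\<close> to
  label \<open>u\<close>: on the degenerate cell between them the action at vertex 2 is compared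
  with the simply transitive action at vertex 0.\<close>

definition tau :: "'g \<Rightarrow> 'g \<Rightarrow> 't \<Rightarrow> 't" where
  "tau u w b = (THE a. a \<in> C u u u \<and> st u u w (d u w) a = st2 u u w (d u w) b)"

lemma tau_props:
  assumes "b \<in> C w w w" "u \<in> U"
  shows tau_closed: "tau u w b \<in> C u u u"
    and st_tau_degenerate: "st u u w (d u w) (tau u w b) = st2 u u w (d u w) b"
proof -
  have w: "w \<in> U" using C_U assms by blast
  have "\<exists>!a. a \<in> C u u u \<and> st u u w (d u w) a = st2 u u w (d u w) b"
    using st_surj[OF d_closed[OF assms(2) w] st2_closed[OF d_closed[OF assms(2) w] assms(1)]]
      st_inj[OF d_closed[OF assms(2) w]] by metis
  from theI'[OF this] show "tau u w b \<in> C u u u" "st u u w (d u w) (tau u w b) = st2 u u w (d u w) b"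
    unfolding tau_def by auto
qed

text \<open>Transport does not depend on the cell used for it: \<open>m_degenerate1\<close> splits
  off the edge from \<open>u\<close> to \<open>w\<close> of \<open>x\<close> as a degenerate third
  argument, and both actions can be pushed into that argument, where \<open>tau\<close> is
  defined.\<close>

lemma st2_eq_st_tau:
  assumes "x \<in> C u v w" "b \<in> C w w w"
  shows "st2 u v w x b = st u v w x (tau u w b)"
proof -
  have U: "u \<in> U" "v \<in> U" "w \<in> U" using C_U assms by blast+
  have "st2 u v w x b = m (P (d u v)) x (st2 u u w (d u w) b)"
    using m_st2_third[OF Pd_closed assms(1) d_closed assms(2)] U m_degenerate1[OF assms(1)] by simp
  also have "\<dots> = st u v w x (tau u w b)"
    using m_st_third[OF Pd_closed assms(1) d_closed tau_closed[OF assms(2)]] U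
      st_tau_degenerate[OF assms(2)] m_degenerate1[OF assms(1)] by simp
  finally show ?thesis .
qed

lemma st_single: "a \<in> C u u u \<Longrightarrow> st u u u (d u u) a = a"
  unfolding st_def ins_def
  using C_U P_d d_closed plus_zero_right[unfolded plus_def] plus_zero_left[unfolded plus_def]
  by metis

text \<open>Rotation turns vertex 0 into vertex 2, and \<open>tau\<close> brings the action back to
  the new vertex 0.\<close>

lemma P_st: "\<lbrakk>x \<in> C u v w; a \<in> C u u u\<rbrakk> \<Longrightarrow> P (st u v w x a) = st v w u (P x) (tau v u a)"
  using st2_eq_st_tau[OF P_closed, of x u v w a] PPP[of x u v w] by (simp add: st2_def)

lemma st_eq_st1:
  assumes "x \<in> C u v w" "a \<in> C u u u"
  shows "st u v w x a = st1 u v w x (tau v u a)"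
  using P_st[OF assms] PPP[OF st_closed[OF assms]] by (simp add: st1_def)

lemma tau_same: assumes "a \<in> C u u u" shows "tau u u a = a"
proof -
  have U: "u \<in> U" using C_U assms by blast
  have "P (st u u u (d u u) a) = st u u u (d u u) (tau u u a)"
    using P_st[OF d_closed[OF U U] assms] P_d[OF U] by simp
  then show ?thesis using st_single tau_closed assms U P_single[OF U] by metis
qed

text \<open>Three rotations of some cell with labels \<open>u\<close>, \<open>v\<close>,
  \<open>w\<close> carry the element once around the triangle. As \<open>P\<close> cubed is the
  identity and the action is free, it returns unchanged.\<close>

lemma tau_cycle:
  assumes "a \<in> C u u u" "v \<in> U" "w \<in> U"
  shows "tau u w (tau w v (tau v u a)) = a"
proof -
  have U: "u \<in> U" using C_U assms by blast
  obtain x where x: "x \<in> C u v w" using C_nonempty U assms by blast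
  have b: "tau v u a \<in> C v v v" and c: "tau w v (tau v u a) \<in> C w w w"
    using assms tau_closed by auto
  have "P (P (P (st u v w x a))) = st u v w x (tau u w (tau w v (tau v u a)))"
    using P_st[OF x assms(1)] P_st[OF P_closed[OF x] b] P_st[OF PP_closed[OF x] c] PPP[OF x] by simp
  then have "st u v w x a = st u v w x (tau u w (tau w v (tau v u a)))"
    using PPP[OF st_closed[OF x assms(1)]] by simp
  then show ?thesis
    using st_inj[OF x] assms c U tau_closed by metis
qed

lemma tau_inverse: "\<lbrakk>a \<in> C u u u; v \<in> U\<rbrakk> \<Longrightarrow> tau u v (tau v u a) = a"
  using tau_cycle[of a u v u] tau_same tau_closed C_U by metis

lemma tau_tau:
  assumes "a \<in> C u u u" "v \<in> U" "w \<in> U"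
  shows "tau w v (tau v u a) = tau w u a"
  using tau_cycle[OF assms] tau_inverse[of "tau w v (tau v u a)" w u] tau_closed assms C_U by metis

text \<open>Apply \<open>P\<close> to both sides of \<open>st_st\<close>: acting twice before the
  rotation is acting twice after it with transported elements.\<close>

lemma tau_plus:
  assumes "a \<in> C u u u" "b \<in> C u u u" "v \<in> U"
  shows "tau v u (plus u a b) = plus v (tau v u a) (tau v u b)"
proof -
  have U: "u \<in> U" using C_U assms by blast
  obtain x where x: "x \<in> C u v v" using C_nonempty U assms by blast
  have "P (st u v v x (plus u a b)) = P (st u v v (st u v v x a) b)"
    using st_st[OF x assms(1,2)] by simp
  also have "\<dots> = st v v u (st v v u (P x) (tau v u a)) (tau v u b)"
    using P_st[OF st_closed[OF x assms(1)] assms(2)] P_st[OF x assms(1)] by simp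
  also have "\<dots> = st v v u (P x) (plus v (tau v u a) (tau v u b))"
    using st_st[OF P_closed[OF x] tau_closed tau_closed] assms by simp
  finally have "st v v u (P x) (tau v u (plus u a b)) = st v v u (P x) (plus v (tau v u a) (tau v u b))"
    using P_st[OF x plus_closed[OF assms(1,2)]] by simp
  then show ?thesis
    using st_inj[OF P_closed[OF x]] tau_closed plus_closed assms by metis
qed

lemma Q_st_tau:
  assumes "x \<in> C u v w" "a \<in> C u u u"
  shows "Q (st u v w x a) = st v u w (Q x) (tau v u (Q a))"
proof -
  have "v \<in> U" using C_U assms by blast
  then show ?thesis
    using Q_st[OF assms] st_eq_st1[OF Q_closed[OF assms(1)] tau_closed[OF Q_closed[OF assms(2)]]]
      tau_inverse[OF Q_closed[OF assms(2)]] by simp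
qed

text \<open>All contributions are collected at the vertex labelled \<open>u\<close>. Only that of
  the second face, based at \<open>o'\<close>, needs transport; it travels via the label
  \<open>w\<close>, a vertex that this face shares with the resulting one.\<close>

lemma m_st:
  assumes "x \<in> C u v o'" "y \<in> C o' v w" "z \<in> C u o' w" "a \<in> C u u u" "b \<in> C o' o' o'" "c \<in> C u u u"
  shows "m (st u v o' x a) (st o' v w y b) (st u o' w z c) =
    st u v w (m x y z) (plus u (plus u a (tau u o' b)) c)"
proof -
  have U: "u \<in> U" "v \<in> U" "w \<in> U" "o' \<in> U" using C_U assms by blast+
  have *: "m x (st o' v w y b) z = st u v w (m x y z) (tau u o' b)"
  proof -
    have b': "tau w o' b \<in> C w w w" using tau_closed assms U by blast
    have "st o' v w y b = st2 o' v w y (tau w o' b)"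
      using st2_eq_st_tau[OF assms(2) b'] tau_inverse[OF assms(5) U(3)] by simp
    then have "m x (st o' v w y b) z = st2 u v w (m x y z) (tau w o' b)"
      using m_st2_second[OF assms(1-3) b'] by simp
    also have "\<dots> = st u v w (m x y z) (tau u o' b)"
      using st2_eq_st_tau[OF m_closed[OF assms(1-3)] b'] tau_tau[OF assms(5) U(3,1)] by simp
    finally show ?thesis .
  qed
  have xyz: "m x y z \<in> C u v w" using assms m_closed by blast
  have tb: "tau u o' b \<in> C u u u" using tau_closed assms U by blast
  have y': "st o' v w y b \<in> C o' v w" and z': "st u o' w z c \<in> C u o' w"
    using assms st_closed by blast+
  have "m (st u v o' x a) (st o' v w y b) (st u o' w z c) =
      st u v w (st u v w (st u v w (m x y z) (tau u o' b)) c) a"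
    using m_st_first[OF assms(1) y' z' assms(4)] m_st_third[OF assms(1) y' assms(3,6)] * by simp
  also have "\<dots> = st u v w (m x y z) (plus u (plus u (tau u o' b) c) a)"
    using st_st[OF xyz tb assms(6)] st_st[OF xyz plus_closed[OF tb assms(6)] assms(4)] by simp
  also have "plus u (plus u (tau u o' b) c) a = plus u (plus u a (tau u o' b)) c"
    using plus_commute[OF U(1)] plus_assoc[OF U(1)] plus_closed tb assms by simp
  finally show ?thesis .
qed

end

section \<open>Delta-groups and their isomorphisms\<close>

text \<open>A bijection onto a Delta-group that respects the operations pulls back all axioms, since
  equations can be tested after the injective map \<open>X\<close>. Thus the axioms of
  \<open>T(G,A,\<alpha>)\<close> require no cocycle computation. The map points from
  \<open>T'\<close> to \<open>T\<close> because in that direction an explicit formula is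
  available.\<close>

lemma (in group) delta_iso_inverse:
  fixes T :: "('a, 't) delta_ops" and T' :: "('a, 'u) delta_ops"
  assumes "delta_group G T"
    and m_closed: "\<And>g h k a b c. \<lbrakk>g \<in> carrier G; h \<in> carrier G; k \<in> carrier G;
      a \<in> cell T' g (inv h); b \<in> cell T' h (inv k);
      c \<in> cell T' (inv h \<otimes> g) (inv k \<otimes> h)\<rbrakk>
     \<Longrightarrow> m_op T' g h k a b c \<in> cell T' g (inv k)"
    and P_closed: "\<And>g h x. \<lbrakk>g \<in> carrier G; h \<in> carrier G; x \<in> cell T' g h\<rbrakk>
     \<Longrightarrow> P_op T' g h x \<in> cell T' h (inv g \<otimes> inv h)"
    and Q_closed: "\<And>g h x. \<lbrakk>g \<in> carrier G; h \<in> carrier G; x \<in> cell T' g h\<rbrakk>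
     \<Longrightarrow> Q_op T' g h x \<in> cell T' (inv g) (h \<otimes> g)"
    and bij: "\<And>g h. \<lbrakk>g \<in> carrier G; h \<in> carrier G\<rbrakk> \<Longrightarrow> bij_betw X (cell T' g h) (cell T g h)"
    and m: "\<And>g h k a b c. \<lbrakk>g \<in> carrier G; h \<in> carrier G; k \<in> carrier G;
      a \<in> cell T' g (inv h); b \<in> cell T' h (inv k);
      c \<in> cell T' (inv h \<otimes> g) (inv k \<otimes> h)\<rbrakk>
     \<Longrightarrow> X (m_op T' g h k a b c) = m_op T g h k (X a) (X b) (X c)"
    and P: "\<And>g h x. \<lbrakk>g \<in> carrier G; h \<in> carrier G; x \<in> cell T' g h\<rbrakk>
     \<Longrightarrow> X (P_op T' g h x) = P_op T g h (X x)"
    and Q: "\<And>g h x. \<lbrakk>g \<in> carrier G; h \<in> carrier G; x \<in> cell T' g h\<rbrakk>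
     \<Longrightarrow> X (Q_op T' g h x) = Q_op T g h (X x)"
  shows "delta_iso G T T' (\<lambda>g h. inv_into (cell T' g h) X)"
proof -
  interpret T: delta_group G T by fact
  note [simp] = inv_mult_group m_assoc
  have cancel [simp]: "inv x \<otimes> (x \<otimes> y) = y" "x \<otimes> (inv x \<otimes> y) = y"
    if "x \<in> carrier G" "y \<in> carrier G" for x y
    using that by (simp_all flip: m_assoc)
  have inj: "x = y" if "g \<in> carrier G" "h \<in> carrier G" "x \<in> cell T' g h" "y \<in> cell T' g h" "X x = X y"
    for g h x y
    using bij that by (meson bij_betw_def inj_onD)
  have mem: "X x \<in> cell T g h" if "g \<in> carrier G" "h \<in> carrier G" "x \<in> cell T' g h" for g h x
    using bij that by (meson bij_betwE)
  have PP_closed: "PP_op G T' g h x \<in> cell T' (inv g \<otimes> inv h) g"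
    and PP: "X (PP_op G T' g h x) = PP_op G T g h (X x)"
    if "g \<in> carrier G" "h \<in> carrier G" "x \<in> cell T' g h" for g h x
    using P_closed[of h "inv g \<otimes> inv h", OF _ _ P_closed[of g h x]] that
      P[of h "inv g \<otimes> inv h" "P_op T' g h x"] P_closed[of g h x] P[of g h x]
    by (simp_all add: PP_op_def)
  have PQ_closed: "PQ_op G T' g h x \<in> cell T' (h \<otimes> g) (inv h)"
    and PQ: "X (PQ_op G T' g h x) = PQ_op G T g h (X x)"
    if "g \<in> carrier G" "h \<in> carrier G" "x \<in> cell T' g h" for g h x
    using P_closed[of "inv g" "h \<otimes> g", OF _ _ Q_closed[of g h x]] that
      P[of "inv g" "h \<otimes> g" "Q_op T' g h x"] Q_closed[of g h x] Q[of g h x]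
    by (simp_all add: PQ_op_def)
  have PPQ_closed: "PPQ_op G T' g h x \<in> cell T' (inv h) (inv g)"
    and PPQ: "X (PPQ_op G T' g h x) = PPQ_op G T g h (X x)"
    if "g \<in> carrier G" "h \<in> carrier G" "x \<in> cell T' g h" for g h x
    using PP_closed[of "inv g" "h \<otimes> g", OF _ _ Q_closed[of g h x]] that
      PP[of "inv g" "h \<otimes> g" "Q_op T' g h x"] Q_closed[of g h x] Q[of g h x]
    by (simp_all add: PPQ_op_def)
  have T': "delta_group G T'"
  proof (unfold_locales, goal_cases)
    case (1 g h k a b c) then show ?case by (rule m_closed)
  next
    case (2 g h x) then show ?case by (rule P_closed)
  next
    case (3 g h x) then show ?case by (rule Q_closed)
  next
    case (4 g h x)
    show ?case
    proof (rule inj[of g h])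
      show "P_op T' (inv g \<otimes> inv h) g (PP_op G T' g h x) \<in> cell T' g h"
        using P_closed[OF _ _ PP_closed[OF 4]] 4 by simp
      show "X (P_op T' (inv g \<otimes> inv h) g (PP_op G T' g h x)) = X x"
        using P[OF _ _ PP_closed[OF 4]] PP[OF 4] T.P_cubed[OF 4(1,2) mem[OF 4]] 4 by simp
    qed (use 4 in auto)
  next
    case (5 g h x)
    show ?case
    proof (rule inj[of g h])
      show "Q_op T' (inv g) (h \<otimes> g) (Q_op T' g h x) \<in> cell T' g h"
        using Q_closed[OF _ _ Q_closed[OF 5]] 5 by simp
      show "X (Q_op T' (inv g) (h \<otimes> g) (Q_op T' g h x)) = X x"
        using Q[OF _ _ Q_closed[OF 5]] Q[OF 5] T.Q_squared[OF 5(1,2) mem[OF 5]] 5 by simp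
    qed (use 5 in auto)
  next
    case (6 g h x)
    show ?case
    proof (rule inj[of "inv h" "inv g"])
      show "PPQ_op G T' g h x \<in> cell T' (inv h) (inv g)" using PPQ_closed[OF 6] .
      show "Q_op T' h (inv g \<otimes> inv h) (P_op T' g h x) \<in> cell T' (inv h) (inv g)"
        using Q_closed[OF _ _ P_closed[OF 6]] 6 by simp
      show "X (PPQ_op G T' g h x) = X (Q_op T' h (inv g \<otimes> inv h) (P_op T' g h x))"
        using Q[OF _ _ P_closed[OF 6]] P[OF 6] PPQ[OF 6] T.PPQ_eq_QP[OF 6(1,2) mem[OF 6]] 6 by simp
    qed (use 6 in auto)
  next
    case (7 g h k a b c)
    note G = 7(1-3)
    have ia: "P_op T' g (inv h) a \<in> cell T' (inv h) (inv g \<otimes> h)"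
      using P_closed[OF _ _ 7(4)] G by simp
    have ib: "P_op T' h (inv k) b \<in> cell T' (inv k) (inv h \<otimes> k)"
      using P_closed[OF _ _ 7(5)] G by simp
    have ic: "P_op T' (inv h \<otimes> g) (inv k \<otimes> h) c \<in> cell T' (inv k \<otimes> h) (inv g \<otimes> k)"
      using P_closed[OF _ _ 7(6)] G by simp
    show ?case
    proof (rule inj[of "inv k" "inv g \<otimes> k"])
      show "P_op T' g (inv k) (m_op T' g h k a b c) \<in> cell T' (inv k) (inv g \<otimes> k)"
        using P_closed[OF _ _ m_closed[OF 7]] G by simp
      show "m_op T' (inv k) (inv k \<otimes> h) (inv k \<otimes> g) (P_op T' h (inv k) b)
         (P_op T' (inv h \<otimes> g) (inv k \<otimes> h) c) (P_op T' g (inv h) a)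
         \<in> cell T' (inv k) (inv g \<otimes> k)"
        using m_closed[of "inv k" "inv k \<otimes> h" "inv k \<otimes> g"] ia ib ic G by simp
      show "X (P_op T' g (inv k) (m_op T' g h k a b c)) =
        X (m_op T' (inv k) (inv k \<otimes> h) (inv k \<otimes> g) (P_op T' h (inv k) b)
         (P_op T' (inv h \<otimes> g) (inv k \<otimes> h) c) (P_op T' g (inv h) a))"
        using m[of "inv k" "inv k \<otimes> h" "inv k \<otimes> g" "P_op T' h (inv k) b"
            "P_op T' (inv h \<otimes> g) (inv k \<otimes> h) c" "P_op T' g (inv h) a"] ia ib ic G
          P[OF _ _ m_closed[OF 7]] m[OF 7] P[OF _ _ 7(4)] P[OF _ _ 7(5)] P[OF _ _ 7(6)]
          T.P_m[OF G mem[OF _ _ 7(4)] mem[OF _ _ 7(5)] mem[OF _ _ 7(6)]]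
        by simp
    qed (use G in auto)
  next
    case (8 g h k a b c)
    note G = 8(1-3)
    have ia: "Q_op T' g (inv h) a \<in> cell T' (inv g) (inv h \<otimes> g)"
      using Q_closed[OF _ _ 8(4)] G by simp
    have ib: "Q_op T' h (inv k) b \<in> cell T' (inv h) (inv k \<otimes> h)"
      using Q_closed[OF _ _ 8(5)] G by simp
    have ic: "Q_op T' (inv h \<otimes> g) (inv k \<otimes> h) c \<in> cell T' (inv g \<otimes> h) (inv k \<otimes> g)"
      using Q_closed[OF _ _ 8(6)] G by simp
    show ?case
    proof (rule inj[of "inv g" "inv k \<otimes> g"])
      show "Q_op T' g (inv k) (m_op T' g h k a b c) \<in> cell T' (inv g) (inv k \<otimes> g)"
        using Q_closed[OF _ _ m_closed[OF 8]] G by simp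
      show "m_op T' (inv g) (inv g \<otimes> h) (inv g \<otimes> k) (Q_op T' g (inv h) a)
         (Q_op T' (inv h \<otimes> g) (inv k \<otimes> h) c) (Q_op T' h (inv k) b)
         \<in> cell T' (inv g) (inv k \<otimes> g)"
        using m_closed[of "inv g" "inv g \<otimes> h" "inv g \<otimes> k"] ia ib ic G by simp
      show "X (Q_op T' g (inv k) (m_op T' g h k a b c)) =
        X (m_op T' (inv g) (inv g \<otimes> h) (inv g \<otimes> k) (Q_op T' g (inv h) a)
         (Q_op T' (inv h \<otimes> g) (inv k \<otimes> h) c) (Q_op T' h (inv k) b))"
        using m[of "inv g" "inv g \<otimes> h" "inv g \<otimes> k" "Q_op T' g (inv h) a"
            "Q_op T' (inv h \<otimes> g) (inv k \<otimes> h) c" "Q_op T' h (inv k) b"] ia ib ic G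
          Q[OF _ _ m_closed[OF 8]] m[OF 8] Q[OF _ _ 8(4)] Q[OF _ _ 8(5)] Q[OF _ _ 8(6)]
          T.Q_m[OF G mem[OF _ _ 8(4)] mem[OF _ _ 8(5)] mem[OF _ _ 8(6)]]
        by simp
    qed (use G in auto)
  next
    case (9 g h k l a b c e f q)
    note G = 9(1-4)
    have iq: "Q_op T' (inv k \<otimes> h) (inv l \<otimes> k) q \<in> cell T' (inv h \<otimes> k) (inv l \<otimes> h)"
      using Q_closed[OF _ _ 9(10)] G by simp
    have i1: "m_op T' g h k a b c \<in> cell T' g (inv k)"
      using m_closed[OF G(1-3) 9(5-7)] .
    have i2: "m_op T' h k l b e q \<in> cell T' h (inv l)"
      using m_closed[OF G(2-4) 9(6,8,10)] .
    have c': "c \<in> cell T' (inv h \<otimes> g) (inv (inv h \<otimes> k))"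
      using 9(7) G by simp
    have q': "Q_op T' (inv k \<otimes> h) (inv l \<otimes> k) q \<in> cell T' (inv h \<otimes> k) (inv (inv h \<otimes> l))"
      using iq G by simp
    have f': "f \<in> cell T' (inv (inv h \<otimes> k) \<otimes> (inv h \<otimes> g)) (inv (inv h \<otimes> l) \<otimes> (inv h \<otimes> k))"
      using 9(9) G by simp
    have K: "inv k \<otimes> h \<in> carrier G" "inv l \<otimes> k \<in> carrier G"
      using G by auto
    have H: "inv h \<otimes> g \<in> carrier G" "inv h \<otimes> k \<in> carrier G" "inv h \<otimes> l \<in> carrier G"
      using G by auto
    have i3: "m_op T' (inv h \<otimes> g) (inv h \<otimes> k) (inv h \<otimes> l)
        c (Q_op T' (inv k \<otimes> h) (inv l \<otimes> k) q) f \<in> cell T' (inv h \<otimes> g) (inv l \<otimes> h)"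
      using m_closed[OF H c' q' f'] G by simp
    show ?case
    proof (rule inj[of g "inv l"])
      show "m_op T' g k l (m_op T' g h k a b c) e f \<in> cell T' g (inv l)"
        by (rule m_closed[OF G(1,3,4) i1 9(8,9)])
      show "m_op T' g h l a (m_op T' h k l b e q) (m_op T' (inv h \<otimes> g) (inv h \<otimes> k) (inv h \<otimes> l)
        c (Q_op T' (inv k \<otimes> h) (inv l \<otimes> k) q) f) \<in> cell T' g (inv l)"
        by (rule m_closed[OF G(1,2,4) 9(5) i2 i3])
      show "X (m_op T' g k l (m_op T' g h k a b c) e f) =
        X (m_op T' g h l a (m_op T' h k l b e q) (m_op T' (inv h \<otimes> g) (inv h \<otimes> k) (inv h \<otimes> l)
        c (Q_op T' (inv k \<otimes> h) (inv l \<otimes> k) q) f))"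
        unfolding m[OF G(1,3,4) i1 9(8,9)] m[OF G(1-3) 9(5-7)] m[OF G(1,2,4) 9(5) i2 i3]
          m[OF G(2-4) 9(6,8,10)] m[OF H c' q' f']
          Q[OF K 9(10)]
        by (rule T.m_assoc') (use 9 mem in auto)
    qed (use G 9 in auto)
  next
    case (10 g h k f a b)
    note G = 10(1-3)
    have ia: "PPQ_op G T' h (inv k) a \<in> cell T' k (inv h)"
      using PPQ_closed[OF _ _ 10(5)] G by simp
    have ib: "PQ_op G T' (inv h \<otimes> g) (inv k \<otimes> h) b \<in> cell T' (inv k \<otimes> g) (inv h \<otimes> k)"
      using PQ_closed[OF _ _ 10(6)] G by simp
    show ?case
    proof (rule inj[of g "inv h"])
      show "m_op T' g k h (m_op T' g h k f a b) (PPQ_op G T' h (inv k) a)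
          (PQ_op G T' (inv h \<otimes> g) (inv k \<otimes> h) b) \<in> cell T' g (inv h)"
        by (rule m_closed[OF G(1,3,2) m_closed[OF 10] ia ib])
      show "X (m_op T' g k h (m_op T' g h k f a b) (PPQ_op G T' h (inv k) a)
          (PQ_op G T' (inv h \<otimes> g) (inv k \<otimes> h) b)) = X f"
        using m[OF G(1,3,2) m_closed[OF 10] ia ib] m[OF 10] PPQ[OF _ _ 10(5)] PQ[OF _ _ 10(6)] G
          T.m_cancel[OF G mem[OF _ _ 10(4)] mem[OF _ _ 10(5)] mem[OF _ _ 10(6)]]
        by simp
    qed (use G 10 in auto)
  qed
  define \<phi> where "\<phi> g h = inv_into (cell T' g h) X" for g h
  have \<phi>_mem: "\<phi> g h x \<in> cell T' g h" and X\<phi>: "X (\<phi> g h x) = x"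
    if "g \<in> carrier G" "h \<in> carrier G" "x \<in> cell T g h" for g h x
    using bij[OF that(1,2)] that unfolding \<phi>_def
    by (auto simp: bij_betw_def inv_into_into f_inv_into_f)
  show ?thesis
    unfolding delta_iso_def \<phi>_def[symmetric]
  proof (intro conjI ballI)
    show "delta_group G T" "delta_group G T'" by fact+
  next
    fix g h assume "g \<in> carrier G" "h \<in> carrier G"
    then show "bij_betw (\<phi> g h) (cell T g h) (cell T' g h)"
      unfolding \<phi>_def by (intro bij_betw_inv_into bij)
  next
    fix g h k a b c
    assume G: "g \<in> carrier G" "h \<in> carrier G" "k \<in> carrier G"
      and abc: "a \<in> cell T g (inv h)" "b \<in> cell T h (inv k)"
        "c \<in> cell T (inv h \<otimes> g) (inv k \<otimes> h)"
    have i: "\<phi> g (inv h) a \<in> cell T' g (inv h)" "\<phi> h (inv k) b \<in> cell T' h (inv k)"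
       "\<phi> (inv h \<otimes> g) (inv k \<otimes> h) c \<in> cell T' (inv h \<otimes> g) (inv k \<otimes> h)"
      using G abc \<phi>_mem by auto
    show "\<phi> g (inv k) (m_op T g h k a b c) = m_op T' g h k (\<phi> g (inv h) a) (\<phi> h (inv k) b)
       (\<phi> (inv h \<otimes> g) (inv k \<otimes> h) c)"
      by (rule inj[of g "inv k"])
        (use G abc \<phi>_mem[OF _ _ T.m_closed[OF G abc]] X\<phi>[OF _ _ T.m_closed[OF G abc]] X\<phi> m[OF G i] m_closed[OF G i] in auto)
  next
    fix g h x assume G: "g \<in> carrier G" "h \<in> carrier G" and x: "x \<in> cell T g h"
    note y = \<phi>_mem[OF G x]
    show "\<phi> h (inv g \<otimes> inv h) (P_op T g h x) = P_op T' g h (\<phi> g h x)"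
      by (rule inj[of h "inv g \<otimes> inv h"])
        (use G x \<phi>_mem[OF _ _ T.P_closed[OF G x]] X\<phi>[OF _ _ T.P_closed[OF G x]] X\<phi>[OF G x] P[OF G y] P_closed[OF G y] in auto)
    show "\<phi> (inv g) (h \<otimes> g) (Q_op T g h x) = Q_op T' g h (\<phi> g h x)"
      by (rule inj[of "inv g" "h \<otimes> g"])
        (use G x \<phi>_mem[OF _ _ T.Q_closed[OF G x]] X\<phi>[OF _ _ T.Q_closed[OF G x]] X\<phi>[OF G x] Q[OF G y] Q_closed[OF G y] in auto)
  qed
qed

section \<open>Symmetric cocycles\<close>

text \<open>The translation rules express that the sets \<open>T(g,h)\<close> see only quotients of
  labels. About \<open>act\<close> only closure and agreement with transport along edges are
  assumed; the laws of a module then follow from those of \<open>tau\<close>.\<close>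

locale delta_classification =
  T: triangle_calculus "carrier G" C m P Q d + group G + A: comm_group A
  for G :: "('g, 'n) monoid_scheme" (structure) and A :: "('b, 'k) monoid_scheme"
    and C :: "'g \<Rightarrow> 'g \<Rightarrow> 'g \<Rightarrow> 't set" and m P Q d +
  fixes act :: "'g \<Rightarrow> 'b \<Rightarrow> 'b" and Psi :: "'b \<Rightarrow> 't" and D :: "('g, 't) delta_ops"
  assumes C_translate: "\<lbrakk>k \<in> carrier G; u \<in> carrier G; v \<in> carrier G; w \<in> carrier G\<rbrakk>
      \<Longrightarrow> C (k \<otimes> u) (k \<otimes> v) (k \<otimes> w) = C u v w"
    and d_translate: "\<lbrakk>k \<in> carrier G; u \<in> carrier G; w \<in> carrier G\<rbrakk>
      \<Longrightarrow> d (k \<otimes> u) (k \<otimes> w) = d u w"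
    and Psi_bij: "bij_betw Psi (carrier A) (C \<one> \<one> \<one>)"
    and Psi_mult: "\<lbrakk>a \<in> carrier A; b \<in> carrier A\<rbrakk> \<Longrightarrow> Psi (a \<otimes>\<^bsub>A\<^esub> b) = T.plus \<one> (Psi a) (Psi b)"
    and act_closed: "\<lbrakk>g \<in> carrier G; a \<in> carrier A\<rbrakk> \<Longrightarrow> act g a \<in> carrier A"
    and Psi_act: "\<lbrakk>g \<in> carrier G; a \<in> carrier A\<rbrakk> \<Longrightarrow> Psi (act g a) = T.tau \<one> g (Psi a)"
    and cell_D: "\<lbrakk>g \<in> carrier G; h \<in> carrier G\<rbrakk> \<Longrightarrow> cell D g h = C g \<one> (inv h)"
    and m_D: "m_op D g h k = m"
    and P_D: "P_op D g h = P"
    and Q_D: "Q_op D g h = Q"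
begin

section \<open>The module structure and the coefficients acting on cells\<close>

lemma cancel_left:
  "\<lbrakk>x \<in> carrier G; y \<in> carrier G\<rbrakk> \<Longrightarrow> inv x \<otimes> (x \<otimes> y) = y"
  "\<lbrakk>x \<in> carrier G; y \<in> carrier G\<rbrakk> \<Longrightarrow> x \<otimes> (inv x \<otimes> y) = y"
  by (simp_all flip: m_assoc)

lemmas group_simps = cancel_left m_assoc inv_mult_group

lemma C_label:
  assumes "u \<in> carrier G" "v \<in> carrier G" "w \<in> carrier G"
  shows "C (inv v \<otimes> u) \<one> (inv v \<otimes> w) = C u v w"
  using C_translate[of v "inv v \<otimes> u" \<one> "inv v \<otimes> w"] assms by (simp add: group_simps)

lemma cell_label:
  assumes "u \<in> carrier G" "v \<in> carrier G" "w \<in> carrier G"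
  shows "cell D (inv v \<otimes> u) (inv w \<otimes> v) = C u v w"
  using C_label[OF assms] assms by (simp add: cell_D group_simps)

lemma C_single: "u \<in> carrier G \<Longrightarrow> C u u u = C \<one> \<one> \<one>"
  using C_label[of u u u] by simp

lemma plus_label: "u \<in> carrier G \<Longrightarrow> T.plus u = T.plus \<one>"
  using d_translate[of u \<one> \<one>] by (simp add: T.plus_def fun_eq_iff)

lemma st_translate:
  assumes "k \<in> carrier G" "u \<in> carrier G" "v \<in> carrier G" "w \<in> carrier G"
  shows "T.st (k \<otimes> u) (k \<otimes> v) (k \<otimes> w) = T.st u v w"
  using assms by (simp add: T.st_def T.ins_def d_translate fun_eq_iff)

lemma tau_translate:
  assumes "k \<in> carrier G" "u \<in> carrier G" "w \<in> carrier G"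
  shows "T.tau (k \<otimes> u) (k \<otimes> w) = T.tau u w"
  using assms by (simp add: T.tau_def T.st2_def st_translate d_translate C_translate fun_eq_iff)

lemma Psi_closed: "\<lbrakk>a \<in> carrier A; u \<in> carrier G\<rbrakk> \<Longrightarrow> Psi a \<in> C u u u"
  using Psi_bij C_single by (metis bij_betwE)

lemma Psi_inj: "\<lbrakk>a \<in> carrier A; b \<in> carrier A; Psi a = Psi b\<rbrakk> \<Longrightarrow> a = b"
  using Psi_bij by (meson bij_betw_def inj_onD)

lemma tau_Psi:
  assumes "a \<in> carrier A" "u \<in> carrier G" "w \<in> carrier G"
  shows "T.tau u w (Psi a) = Psi (act (inv u \<otimes> w) a)"
  using tau_translate[of u \<one> "inv u \<otimes> w"] assms by (simp add: Psi_act group_simps)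

lemma act_mult:
  assumes "g \<in> carrier G" "a \<in> carrier A" "b \<in> carrier A"
  shows "act g (a \<otimes>\<^bsub>A\<^esub> b) = act g a \<otimes>\<^bsub>A\<^esub> act g b"
proof (rule Psi_inj)
  show "Psi (act g (a \<otimes>\<^bsub>A\<^esub> b)) = Psi (act g a \<otimes>\<^bsub>A\<^esub> act g b)"
    using T.tau_plus[of "Psi a" g "Psi b" \<one>] assms
    by (simp add: Psi_act Psi_mult act_closed Psi_closed plus_label[OF assms(1)])
qed (use assms act_closed in auto)

text \<open>Translation by \<open>g\<close> turns the transport from \<open>h\<close> to
  \<open>\<one>\<close> into one from \<open>g \<otimes> h\<close> to \<open>g\<close>; the two
  transports then compose by \<open>tau_tau\<close>.\<close>

lemma act_act:
  assumes "g \<in> carrier G" "h \<in> carrier G" "a \<in> carrier A"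
  shows "act g (act h a) = act (g \<otimes> h) a"
proof (rule Psi_inj)
  have "Psi (act g (act h a)) = T.tau \<one> g (T.tau \<one> h (Psi a))"
    using assms by (simp add: Psi_act act_closed)
  also have "T.tau \<one> h = T.tau g (g \<otimes> h)"
    using tau_translate[of g \<one> h] assms by simp
  also have "T.tau \<one> g (T.tau g (g \<otimes> h) (Psi a)) = T.tau \<one> (g \<otimes> h) (Psi a)"
    using assms by (intro T.tau_tau Psi_closed) auto
  finally show "Psi (act g (act h a)) = Psi (act (g \<otimes> h) a)"
    using assms by (simp add: Psi_act)
qed (use assms act_closed in auto)

lemma act_one: "a \<in> carrier A \<Longrightarrow> act \<one> a = a"
  using Psi_act[of \<one> a] T.tau_same[OF Psi_closed] by (simp add: Psi_inj act_closed)

lemma act_unit: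
  assumes "g \<in> carrier G"
  shows "act g \<one>\<^bsub>A\<^esub> = \<one>\<^bsub>A\<^esub>"
  using act_mult[OF assms A.one_closed A.one_closed] act_closed[OF assms A.one_closed]
  by (metis A.l_cancel_one A.l_one A.one_closed)

lemma act_inv:
  assumes "g \<in> carrier G" "a \<in> carrier A"
  shows "act g (inv\<^bsub>A\<^esub> a) = inv\<^bsub>A\<^esub> (act g a)"
  using act_mult[OF assms(1) A.inv_closed[OF assms(2)] assms(2)] act_closed assms act_unit
  by (simp add: A.inv_equality)

lemma Psi_one: "Psi \<one>\<^bsub>A\<^esub> = d \<one> \<one>"
proof (rule T.plus_left_cancel[of \<one> "Psi \<one>\<^bsub>A\<^esub>"])
  show "T.plus \<one> (Psi \<one>\<^bsub>A\<^esub>) (Psi \<one>\<^bsub>A\<^esub>) = T.plus \<one> (Psi \<one>\<^bsub>A\<^esub>) (d \<one> \<one>)"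
    using Psi_mult[of "\<one>\<^bsub>A\<^esub>" "\<one>\<^bsub>A\<^esub>"] T.plus_zero_right[OF one_closed] Psi_closed by simp
qed (auto intro: Psi_closed T.d_closed)

lemma Q_Psi:
  assumes "a \<in> carrier A"
  shows "Q (Psi a) = Psi (inv\<^bsub>A\<^esub> a)"
proof (rule T.plus_left_cancel[of \<one> "Psi a"])
  show "T.plus \<one> (Psi a) (Q (Psi a)) = T.plus \<one> (Psi a) (Psi (inv\<^bsub>A\<^esub> a))"
    using assms Psi_mult[of a "inv\<^bsub>A\<^esub> a"] T.plus_Q[OF one_closed Psi_closed] Psi_one by simp
qed (use assms Psi_closed T.Q_closed in auto)

text \<open>The groups \<open>C u u u\<close> are the same set for all labels, so a single module
  acts on all cells. The price is that transport from \<open>w\<close> to \<open>u\<close> becomes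
  the action of \<open>inv u \<otimes> w\<close>, by \<open>tau_Psi\<close>.\<close>

definition star :: "'g \<Rightarrow> 'g \<Rightarrow> 'g \<Rightarrow> 't \<Rightarrow> 'b \<Rightarrow> 't" where
  "star u v w x a = T.st u v w x (Psi a)"

lemma star_closed: "\<lbrakk>x \<in> C u v w; a \<in> carrier A\<rbrakk> \<Longrightarrow> star u v w x a \<in> C u v w"
  unfolding star_def using T.C_U by (intro T.st_closed Psi_closed) blast+

lemma star_star:
  assumes "x \<in> C u v w" "a \<in> carrier A" "b \<in> carrier A"
  shows "star u v w (star u v w x a) b = star u v w x (a \<otimes>\<^bsub>A\<^esub> b)"
proof -
  have "u \<in> carrier G" using T.C_U assms by blast
  then show ?thesis unfolding star_def
    using T.st_st[OF assms(1) Psi_closed Psi_closed] assms Psi_mult plus_label by metis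
qed

lemma star_one: "x \<in> C u v w \<Longrightarrow> star u v w x \<one>\<^bsub>A\<^esub> = x"
  using T.st_zero[of x u v w] T.C_U[of x u v w] d_translate[of u \<one> \<one>] by (simp add: star_def Psi_one)

lemma star_inj: "\<lbrakk>x \<in> C u v w; a \<in> carrier A; b \<in> carrier A; star u v w x a = star u v w x b\<rbrakk> \<Longrightarrow> a = b"
  unfolding star_def using T.st_inj Psi_closed Psi_inj T.C_U by metis

lemma star_surj:
  assumes "x \<in> C u v w" "y \<in> C u v w"
  shows "\<exists>a \<in> carrier A. star u v w x a = y"
proof -
  obtain b where "b \<in> C u u u" "T.st u v w x b = y"
    using T.st_surj[OF assms] by blast
  moreover have "C u u u = Psi ` carrier A"
    using C_single[of u] T.C_U[OF assms(1)] bij_betw_imp_surj_on[OF Psi_bij] by simp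
  ultimately show ?thesis unfolding star_def by auto
qed

lemma star_translate:
  "\<lbrakk>k \<in> carrier G; u \<in> carrier G; v \<in> carrier G; w \<in> carrier G\<rbrakk>
    \<Longrightarrow> star (k \<otimes> u) (k \<otimes> v) (k \<otimes> w) = star u v w"
  by (simp add: star_def st_translate fun_eq_iff)

lemma P_star:
  assumes "x \<in> C u v w" "a \<in> carrier A"
  shows "P (star u v w x a) = star v w u (P x) (act (inv v \<otimes> u) a)"
  using T.P_st[OF assms(1) Psi_closed[OF assms(2)]] T.C_U[OF assms(1)] assms
  by (simp add: star_def tau_Psi)

lemma Q_star:
  assumes "x \<in> C u v w" "a \<in> carrier A"
  shows "Q (star u v w x a) = star v u w (Q x) (inv\<^bsub>A\<^esub> (act (inv v \<otimes> u) a))"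
  using T.Q_st_tau[OF assms(1) Psi_closed[OF assms(2)]] T.C_U[OF assms(1)] assms
  by (simp add: star_def tau_Psi Q_Psi act_inv)

lemma m_star:
  assumes "x \<in> C u v o'" "y \<in> C o' v w" "z \<in> C u o' w"
    and "a \<in> carrier A" "b \<in> carrier A" "c \<in> carrier A"
  shows "m (star u v o' x a) (star o' v w y b) (star u o' w z c) =
    star u v w (m x y z) (a \<otimes>\<^bsub>A\<^esub> act (inv u \<otimes> o') b \<otimes>\<^bsub>A\<^esub> c)"
  using T.m_st[OF assms(1-3) Psi_closed Psi_closed Psi_closed] assms(4-6)
    T.C_U[OF assms(1)] T.C_U[OF assms(2)]
  by (simp add: star_def tau_Psi Psi_mult act_closed plus_label[of u])

text \<open>If the vertices carry the labels \<open>g\<close>, \<open>\<one>\<close>,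
  \<open>h\<close>, \<open>k\<close>, \<open>l\<close>, every index in the axioms is a quotient of
  two labels, and each axiom is the one of the calculus in homogeneous form.\<close>

lemma delta_group_D: "delta_group G D"
proof -
  have cell3: "cell D g h = C u v w"
    if "u \<in> carrier G" "v \<in> carrier G" "w \<in> carrier G" "g = inv v \<otimes> u" "h = inv w \<otimes> v" for g h u v w
    using cell_label[OF that(1-3)] that by simp
  show ?thesis
  proof (unfold_locales, goal_cases)
    case (1 g h k a b c)
    then show ?case
      using T.m_closed[of a g \<one> h b k c] by (simp add: m_D cell3[of g \<one> h] cell3[of h \<one> k]
          cell3[of g \<one> k] cell3[of g h k])
  next
    case (2 g h x)
    then show ?case
      using T.P_closed[of x g \<one> "inv h"]
      by (simp add: P_D cell3[of g \<one> "inv h"] cell3[of \<one> "inv h" g])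
  next
    case (3 g h x)
    then show ?case
      using T.Q_closed[of x g \<one> "inv h"]
      by (simp add: Q_D cell3[of g \<one> "inv h"] cell3[of \<one> g "inv h"])
  next
    case (4 g h x)
    then show ?case
      using T.PPP[of x g \<one> "inv h"] by (simp add: PP_op_def P_D cell_D)
  next
    case (5 g h x)
    then show ?case
      using T.QQ[of x g \<one> "inv h"] by (simp add: Q_D cell_D)
  next
    case (6 g h x)
    then show ?case
      using T.PPQ[of x g \<one> "inv h"] by (simp add: PPQ_op_def PP_op_def P_D Q_D cell_D)
  next
    case (7 g h k a b c)
    then show ?case
      using T.P_m[of a g \<one> h b k c]
      by (simp add: m_D P_D cell3[of g \<one> h] cell3[of h \<one> k] cell3[of g h k])
  next
    case (8 g h k a b c)
    then show ?case
      using T.Q_m[of a g \<one> h b k c]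
      by (simp add: m_D Q_D cell3[of g \<one> h] cell3[of h \<one> k] cell3[of g h k])
  next
    case (9 g h k l a b c e f q)
    then show ?case
      using T.m_assoc[of a g \<one> h b k c e l f q]
      by (simp add: m_D Q_D cell3[of g \<one> h] cell3[of h \<one> k] cell3[of g h k] cell3[of k \<one> l]
          cell3[of g k l] cell3[of h k l])
  next
    case (10 g h k f a b)
    then show ?case
      using T.m_cancel[of f g \<one> h a k b]
      by (simp add: m_D P_D Q_D PPQ_op_def PP_op_def PQ_op_def
          cell3[of g \<one> h] cell3[of h \<one> k] cell3[of g h k])
  qed
qed

subsection \<open>The cocycle of a symmetric section\<close>

definition symmetric_section :: "('g \<Rightarrow> 'g \<Rightarrow> 'g \<Rightarrow> 't) \<Rightarrow> bool" where
  "symmetric_section E \<longleftrightarrow> (\<forall>u\<in>carrier G. \<forall>v\<in>carrier G. \<forall>w\<in>carrier G.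
     E u v w \<in> C u v w \<and> P (E u v w) = E v w u \<and> Q (E u v w) = E v u w \<and>
     (\<forall>k\<in>carrier G. E (k \<otimes> u) (k \<otimes> v) (k \<otimes> w) = E u v w))"

text \<open>The coordinate of \<open>m\<close> at base points. The labels 1, x, xy, xyz of the bar
  resolution sit at the vertices 1, 0, 3, 2 of the tetrahedron; this is the order in which
  \<open>m\<close> of \<open>T(G,A,\<alpha>)\<close> feeds \<open>\<alpha>\<close>.\<close>

definition cochain :: "('g \<Rightarrow> 'g \<Rightarrow> 'g \<Rightarrow> 't) \<Rightarrow> 'g \<times> 'g \<times> 'g \<Rightarrow> 'b" where
  "cochain E = (\<lambda>(x, y, z) \<in> carrier G \<times> carrier G \<times> carrier G.
     THE a. a \<in> carrier A \<and> star \<one> (x \<otimes> y \<otimes> z) (x \<otimes> y) (E \<one> (x \<otimes> y \<otimes> z) (x \<otimes> y)) a =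
       m (E \<one> (x \<otimes> y \<otimes> z) x) (E x (x \<otimes> y \<otimes> z) (x \<otimes> y)) (E \<one> x (x \<otimes> y)))"

definition hcochain :: "('g \<Rightarrow> 'g \<Rightarrow> 'g \<Rightarrow> 't) \<Rightarrow> 'g \<Rightarrow> 'g \<Rightarrow> 'g \<Rightarrow> 'g \<Rightarrow> 'b" where
  "hcochain E u q w v = cochain E (inv u \<otimes> q, inv q \<otimes> w, inv w \<otimes> v)"

context
  fixes E assumes E: "symmetric_section E"
begin

lemma E_closed: "\<lbrakk>u \<in> carrier G; v \<in> carrier G; w \<in> carrier G\<rbrakk> \<Longrightarrow> E u v w \<in> C u v w"
  and P_E: "\<lbrakk>u \<in> carrier G; v \<in> carrier G; w \<in> carrier G\<rbrakk> \<Longrightarrow> P (E u v w) = E v w u"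
  and Q_E: "\<lbrakk>u \<in> carrier G; v \<in> carrier G; w \<in> carrier G\<rbrakk> \<Longrightarrow> Q (E u v w) = E v u w"
  and E_translate: "\<lbrakk>k \<in> carrier G; u \<in> carrier G; v \<in> carrier G; w \<in> carrier G\<rbrakk>
    \<Longrightarrow> E (k \<otimes> u) (k \<otimes> v) (k \<otimes> w) = E u v w"
  using E unfolding symmetric_section_def by blast+

lemma cochain_props:
  assumes "x \<in> carrier G" "y \<in> carrier G" "z \<in> carrier G"
  shows cochain_closed: "cochain E (x, y, z) \<in> carrier A"
    and cochain_eq: "star \<one> (x \<otimes> y \<otimes> z) (x \<otimes> y) (E \<one> (x \<otimes> y \<otimes> z) (x \<otimes> y)) (cochain E (x, y, z)) =
       m (E \<one> (x \<otimes> y \<otimes> z) x) (E x (x \<otimes> y \<otimes> z) (x \<otimes> y)) (E \<one> x (x \<otimes> y))"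
proof -
  let ?v = "x \<otimes> y \<otimes> z" and ?w = "x \<otimes> y"
  have "m (E \<one> ?v x) (E x ?v ?w) (E \<one> x ?w) \<in> C \<one> ?v ?w"
    using T.m_closed[OF E_closed E_closed E_closed] assms by simp
  then have "\<exists>!a. a \<in> carrier A \<and> star \<one> ?v ?w (E \<one> ?v ?w) a = m (E \<one> ?v x) (E x ?v ?w) (E \<one> x ?w)"
    using star_surj[OF E_closed[of \<one> ?v ?w]] star_inj[OF E_closed[of \<one> ?v ?w]] assms
    by (metis m_closed one_closed)
  from theI'[OF this] show "cochain E (x, y, z) \<in> carrier A"
    "star \<one> ?v ?w (E \<one> ?v ?w) (cochain E (x, y, z)) = m (E \<one> ?v x) (E x ?v ?w) (E \<one> x ?w)"
    using assms by (auto simp: cochain_def)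
qed

lemma hcochain_closed:
  "\<lbrakk>u \<in> carrier G; q \<in> carrier G; w \<in> carrier G; v \<in> carrier G\<rbrakk> \<Longrightarrow> hcochain E u q w v \<in> carrier A"
  unfolding hcochain_def by (intro cochain_closed) auto

lemma m_E:
  assumes "u \<in> carrier G" "q \<in> carrier G" "w \<in> carrier G" "v \<in> carrier G"
  shows "m (E u v q) (E q v w) (E u q w) = star u v w (E u v w) (hcochain E u q w v)"
proof -
  have t: "E (inv u \<otimes> a) (inv u \<otimes> b) (inv u \<otimes> c) = E a b c"
    "star (inv u \<otimes> a) (inv u \<otimes> b) (inv u \<otimes> c) = star a b c"
    if "a \<in> carrier G" "b \<in> carrier G" "c \<in> carrier G" for a b c
    using E_translate[of "inv u" a b c] star_translate[of "inv u" a b c] assms that by auto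
  show ?thesis
    using cochain_eq[of "inv u \<otimes> q" "inv q \<otimes> w" "inv w \<otimes> v"] assms
      t[of u v w] t[of u v q] t[of q v w] t[of u q w]
    by (simp add: group_simps hcochain_def)
qed

lemma hcochain_eqI:
  assumes "u \<in> carrier G" "q \<in> carrier G" "w \<in> carrier G" "v \<in> carrier G" "a \<in> carrier A"
    and "m (E u v q) (E q v w) (E u q w) = star u v w (E u v w) a"
  shows "hcochain E u q w v = a"
  using star_inj[OF E_closed[of u v w] hcochain_closed assms(5)] m_E assms by simp

text \<open>\<open>PQ\<close> is the reflection that exchanges the outer vertices with labels
  \<open>v\<close> and \<open>w\<close>. The action produced by \<open>Q\<close> is undone by that
  of \<open>P\<close>, and only the sign of \<open>Q\<close> stays.\<close>

lemma hcochain_swap_last: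
  assumes G: "u \<in> carrier G" "q \<in> carrier G" "w \<in> carrier G" "v \<in> carrier G"
  shows "hcochain E u q v w = inv\<^bsub>A\<^esub> (hcochain E u q w v)"
proof (rule hcochain_eqI)
  let ?h = "hcochain E u q w v"
  have h: "?h \<in> carrier A" using hcochain_closed G by blast
  have "P (Q (m (E u v q) (E q v w) (E u q w))) = P (m (E v u q) (E q u w) (E v q w))"
    using T.Q_m[OF E_closed E_closed E_closed] G by (simp add: Q_E)
  also have "\<dots> = m (E u w q) (E q w v) (E u q v)"
    using T.P_m[OF E_closed E_closed E_closed] G by (simp add: P_E)
  finally have "m (E u w q) (E q w v) (E u q v) = P (Q (star u v w (E u v w) ?h))"
    using m_E G by simp
  also have "\<dots> = P (star v u w (E v u w) (inv\<^bsub>A\<^esub> (act (inv v \<otimes> u) ?h)))"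
    using Q_star[OF E_closed h] G by (simp add: Q_E)
  also have "\<dots> = star u w v (E u w v) (act (inv u \<otimes> v) (inv\<^bsub>A\<^esub> (act (inv v \<otimes> u) ?h)))"
    using P_star[OF E_closed] G h by (simp add: P_E act_closed)
  also have "act (inv u \<otimes> v) (inv\<^bsub>A\<^esub> (act (inv v \<otimes> u) ?h)) = inv\<^bsub>A\<^esub> ?h"
    using G h by (simp add: act_inv act_closed act_act act_one group_simps)
  finally show "m (E u w q) (E q w v) (E u q v) = star u w v (E u w v) (inv\<^bsub>A\<^esub> ?h)" .
qed (use G hcochain_closed in auto)

text \<open>The labels exchanged belong to the inner vertex and an outer one, so permuting the
  resulting face cannot help. Instead \<open>m_cancel\<close> solves the relation of the tetrahedron
  for another of its faces.\<close>

lemma hcochain_swap_middle: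
  assumes G: "u \<in> carrier G" "q \<in> carrier G" "w \<in> carrier G" "v \<in> carrier G"
  shows "hcochain E u w q v = inv\<^bsub>A\<^esub> (hcochain E u q w v)"
proof (rule hcochain_eqI)
  let ?h = "hcochain E u q w v"
  have h: "?h \<in> carrier A" using hcochain_closed G by blast
  have c: "m (star u v w (E u v w) ?h) (E w v q) (E u w q) = E u v q"
    using T.m_cancel[OF E_closed E_closed E_closed, of u v q w] G m_E by (simp add: P_E Q_E)
  have "m (star u v w (E u v w) ?h) (star w v q (E w v q) \<one>\<^bsub>A\<^esub>) (star u w q (E u w q) \<one>\<^bsub>A\<^esub>) =
      star u v q (m (E u v w) (E w v q) (E u w q)) ?h"
    using m_star[OF E_closed E_closed E_closed h A.one_closed A.one_closed] G h by (simp add: act_unit)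
  then have "star u v q (m (E u v w) (E w v q) (E u w q)) ?h = E u v q"
    using c star_one E_closed G by simp
  then have "star u v q (star u v q (m (E u v w) (E w v q) (E u w q)) ?h) (inv\<^bsub>A\<^esub> ?h) = star u v q (E u v q) (inv\<^bsub>A\<^esub> ?h)"
    by simp
  then show "m (E u v w) (E w v q) (E u w q) = star u v q (E u v q) (inv\<^bsub>A\<^esub> ?h)"
    using star_star[OF T.m_closed[OF E_closed E_closed E_closed] h A.inv_closed[OF h]] G h
      star_one[OF T.m_closed[OF E_closed E_closed E_closed]] by simp
qed (use G hcochain_closed in auto)

lemma hcochain_cycle:
  assumes G: "u \<in> carrier G" "q \<in> carrier G" "w \<in> carrier G" "v \<in> carrier G"
  shows "hcochain E v q u w = act (inv v \<otimes> u) (hcochain E u q w v)"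
proof (rule hcochain_eqI)
  have "m (E v w q) (E q w u) (E v q u) = P (m (E u v q) (E q v w) (E u q w))"
    using T.P_m[OF E_closed E_closed E_closed] G by (simp add: P_E)
  then show "m (E v w q) (E q w u) (E v q u) = star v w u (E v w u) (act (inv v \<otimes> u) (hcochain E u q w v))"
    using P_star[OF E_closed hcochain_closed] G m_E by (simp add: P_E)
qed (use G hcochain_closed act_closed in auto)

text \<open>Coefficients are based at the first label, so moving that label must bring in the
  action. \<open>hcochain_cycle\<close> does this, and permutations of the last three labels turn
  the cycle into the transposition.\<close>

lemma hcochain_swap_first:
  assumes G: "u \<in> carrier G" "q \<in> carrier G" "w \<in> carrier G" "v \<in> carrier G"
  shows "act (inv u \<otimes> q) (hcochain E q u w v) = inv\<^bsub>A\<^esub> (hcochain E u q w v)"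
proof -
  have 1: "hcochain E u v w q = inv\<^bsub>A\<^esub> (hcochain E u q w v)"
    using hcochain_swap_last[OF G(1,4,2,3)] hcochain_swap_middle[OF G(1,2,4,3)]
      hcochain_swap_last[OF G] hcochain_closed G by simp
  have 2: "hcochain E q v u w = act (inv q \<otimes> u) (hcochain E u v w q)"
    using hcochain_cycle[OF G(1,4,3,2)] .
  have 3: "hcochain E q u w v = hcochain E q v u w"
    using hcochain_swap_middle[OF G(2,4,1,3)] hcochain_swap_last[OF G(2,1,4,3)] hcochain_closed G by simp
  show ?thesis
    using 1 2 3 G hcochain_closed by (simp add: act_inv act_closed act_act act_one group_simps)
qed

text \<open>The two sides of \<open>m_assoc\<close> at base points are one cell, computed with two
  and with three tetrahedra; freeness of the action lets the coefficients be compared.\<close>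

lemma hcochain_cocycle:
  assumes G: "u \<in> carrier G" "p \<in> carrier G" "q \<in> carrier G" "w \<in> carrier G" "v \<in> carrier G"
  shows "hcochain E u p q v \<otimes>\<^bsub>A\<^esub> hcochain E u q w v =
    hcochain E u p w v \<otimes>\<^bsub>A\<^esub> act (inv u \<otimes> p) (hcochain E p q w v) \<otimes>\<^bsub>A\<^esub> hcochain E u p q w"
proof -
  note h = hcochain_closed
  have "m (m (E u v p) (E p v q) (E u p q)) (E q v w) (E u q w)
      = m (star u v q (E u v q) (hcochain E u p q v)) (star q v w (E q v w) \<one>\<^bsub>A\<^esub>) (star u q w (E u q w) \<one>\<^bsub>A\<^esub>)"
    using m_E G star_one E_closed by simp
  also have "\<dots> = star u v w (m (E u v q) (E q v w) (E u q w)) (hcochain E u p q v)"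
    using m_star[OF E_closed E_closed E_closed h A.one_closed A.one_closed] G h by (simp add: act_unit)
  also have "\<dots> = star u v w (E u v w) (hcochain E u q w v \<otimes>\<^bsub>A\<^esub> hcochain E u p q v)"
    using star_star[OF E_closed h h] m_E G by simp
  finally have lhs: "m (m (E u v p) (E p v q) (E u p q)) (E q v w) (E u q w) =
    star u v w (E u v w) (hcochain E u q w v \<otimes>\<^bsub>A\<^esub> hcochain E u p q v)" .
  \<comment> \<open>In \<open>m_assoc\<close> this tetrahedron appears with \<open>q\<close>,
    \<open>w\<close>, \<open>p\<close> in cyclically shifted places, an even permutation, so the
    sign does not change.\<close>
  have perm: "hcochain E u q w p = hcochain E u p q w"
    using hcochain_swap_last[of u q p w] hcochain_swap_middle[of u p q w] h G by simp
  have "m (E u v p) (m (E p v q) (E q v w) (E p q w)) (m (E u p q) (Q (E p q w)) (E u q w))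
     = m (star u v p (E u v p) \<one>\<^bsub>A\<^esub>) (star p v w (E p v w) (hcochain E p q w v))
         (star u p w (E u p w) (hcochain E u q w p))"
    using m_E G star_one E_closed Q_E by simp
  also have "\<dots> = star u v w (m (E u v p) (E p v w) (E u p w))
     (act (inv u \<otimes> p) (hcochain E p q w v) \<otimes>\<^bsub>A\<^esub> hcochain E u p q w)"
    using m_star[OF E_closed E_closed E_closed A.one_closed h h] G h perm by (simp add: act_closed)
  also have "\<dots> = star u v w (E u v w) (hcochain E u p w v \<otimes>\<^bsub>A\<^esub>
     (act (inv u \<otimes> p) (hcochain E p q w v) \<otimes>\<^bsub>A\<^esub> hcochain E u p q w))"
    using star_star[OF E_closed h] m_E G h act_closed by simp
  finally have rhs: "m (E u v p) (m (E p v q) (E q v w) (E p q w)) (m (E u p q) (Q (E p q w)) (E u q w)) = \<dots>" .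
  have "m (m (E u v p) (E p v q) (E u p q)) (E q v w) (E u q w) =
    m (E u v p) (m (E p v q) (E q v w) (E p q w)) (m (E u p q) (Q (E p q w)) (E u q w))"
    using T.m_assoc[OF E_closed E_closed E_closed E_closed E_closed E_closed] G by blast
  then have "hcochain E u q w v \<otimes>\<^bsub>A\<^esub> hcochain E u p q v = hcochain E u p w v \<otimes>\<^bsub>A\<^esub>
     (act (inv u \<otimes> p) (hcochain E p q w v) \<otimes>\<^bsub>A\<^esub> hcochain E u p q w)"
    using lhs rhs star_inj[OF E_closed[OF G(1,5,4)]] G h act_closed
    by (metis A.m_closed inv_closed m_closed)
  then show ?thesis
    using G h act_closed by (simp add: A.m_ac)
qed

lemma cochain_hcochain:
  "\<lbrakk>x \<in> carrier G; y \<in> carrier G; z \<in> carrier G\<rbrakk>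
    \<Longrightarrow> cochain E (x, y, z) = hcochain E \<one> x (x \<otimes> y) (x \<otimes> (y \<otimes> z))"
  by (simp add: hcochain_def group_simps)

text \<open>The three relations are the transpositions of neighbours in the sequence of labels 1, x,
  xy, xyz.\<close>

lemma cochain_CS3: "cochain E \<in> CS3 G A act"
  unfolding CS3_def
proof (intro CollectI conjI ballI)
  show "cochain E \<in> carrier G \<times> carrier G \<times> carrier G \<rightarrow>\<^sub>E carrier A"
  proof (rule PiE_I, goal_cases)
    case (1 t) then show ?case using cochain_closed by auto
  next
    case (2 t) then show ?case unfolding cochain_def restrict_def by simp
  qed
next
  fix x y z assume G: "x \<in> carrier G" "y \<in> carrier G" "z \<in> carrier G"
  let ?h = "hcochain E"
  have 1: "cochain E (inv x, x \<otimes> y, z) = ?h x \<one> (x \<otimes> y) (x \<otimes> (y \<otimes> z))"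
    using G by (simp add: hcochain_def group_simps)
  have 2: "cochain E (x \<otimes> y, inv y, y \<otimes> z) = ?h \<one> (x \<otimes> y) x (x \<otimes> (y \<otimes> z))"
    using G by (simp add: hcochain_def group_simps)
  have 3: "cochain E (x, y \<otimes> z, inv z) = ?h \<one> x (x \<otimes> (y \<otimes> z)) (x \<otimes> y)"
    using G by (simp add: hcochain_def group_simps)
  show "cochain E (x, y, z) = inv\<^bsub>A\<^esub> (act x (cochain E (inv x, x \<otimes> y, z)))"
    unfolding 1 using hcochain_swap_first[of \<one> x "x \<otimes> y" "x \<otimes> (y \<otimes> z)"] G
    by (simp add: cochain_hcochain hcochain_closed)
  show "cochain E (x, y, z) = inv\<^bsub>A\<^esub> (cochain E (x \<otimes> y, inv y, y \<otimes> z))"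
    unfolding 2 using hcochain_swap_middle[of \<one> x "x \<otimes> y" "x \<otimes> (y \<otimes> z)"] G
    by (simp add: cochain_hcochain hcochain_closed)
  show "cochain E (x, y, z) = inv\<^bsub>A\<^esub> (cochain E (x, y \<otimes> z, inv z))"
    unfolding 3 using hcochain_swap_last[of \<one> x "x \<otimes> y" "x \<otimes> (y \<otimes> z)"] G
    by (simp add: cochain_hcochain hcochain_closed)
qed

lemma cochain_cocycle:
  assumes G: "x \<in> carrier G" "y \<in> carrier G" "z \<in> carrier G" "w \<in> carrier G"
  shows "cobound3 G A act (cochain E) (x, y, z, w) = \<one>\<^bsub>A\<^esub>"
proof -
  let ?h = "hcochain E"
  let ?q = "x \<otimes> y" and ?w = "x \<otimes> (y \<otimes> z)" and ?v = "x \<otimes> (y \<otimes> (z \<otimes> w))"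
  have e: "cochain E (y, z, w) = ?h x ?q ?w ?v" "cochain E (x \<otimes> y, z, w) = ?h \<one> ?q ?w ?v"
    "cochain E (x, y \<otimes> z, w) = ?h \<one> x ?w ?v" "cochain E (x, y, z \<otimes> w) = ?h \<one> x ?q ?v"
    "cochain E (x, y, z) = ?h \<one> x ?q ?w"
    using G by (simp_all add: hcochain_def group_simps)
  define a b c e f where "a = act x (?h x ?q ?w ?v)" and "b = ?h \<one> ?q ?w ?v" and "c = ?h \<one> x ?w ?v"
    and "e = ?h \<one> x ?q ?v" and "f = ?h \<one> x ?q ?w"
  have mem: "a \<in> carrier A" "b \<in> carrier A" "c \<in> carrier A" "e \<in> carrier A" "f \<in> carrier A"
    unfolding a_def b_def c_def e_def f_def using G by (auto intro!: act_closed hcochain_closed)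
  have "e \<otimes>\<^bsub>A\<^esub> b = c \<otimes>\<^bsub>A\<^esub> a \<otimes>\<^bsub>A\<^esub> f"
    using hcochain_cocycle[of \<one> x ?q ?w ?v] G by (simp add: a_def b_def c_def e_def f_def)
  then have "a \<otimes>\<^bsub>A\<^esub> c \<otimes>\<^bsub>A\<^esub> f = b \<otimes>\<^bsub>A\<^esub> e"
    using mem by (simp add: A.m_ac)
  then have "a \<otimes>\<^bsub>A\<^esub> c \<otimes>\<^bsub>A\<^esub> f \<otimes>\<^bsub>A\<^esub> inv\<^bsub>A\<^esub> (b \<otimes>\<^bsub>A\<^esub> e) = \<one>\<^bsub>A\<^esub>"
    using mem by simp
  then have "a \<otimes>\<^bsub>A\<^esub> inv\<^bsub>A\<^esub> b \<otimes>\<^bsub>A\<^esub> c \<otimes>\<^bsub>A\<^esub> inv\<^bsub>A\<^esub> e \<otimes>\<^bsub>A\<^esub> f = \<one>\<^bsub>A\<^esub>"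
    using mem by (simp add: A.m_ac A.inv_mult)
  then show ?thesis
    using G by (simp add: cobound3_def e a_def b_def c_def e_def f_def)
qed

lemma cochain_ZS3: "cochain E \<in> carrier (ZS3 G A act)"
proof -
  have "cobound3 G A act (cochain E) = (\<lambda>_ \<in> carrier G \<times> carrier G \<times> carrier G \<times> carrier G. \<one>\<^bsub>A\<^esub>)"
  proof
    fix t :: "'g \<times> 'g \<times> 'g \<times> 'g"
    obtain x y z w where t: "t = (x, y, z, w)" by (metis prod_cases4)
    show "cobound3 G A act (cochain E) t = (\<lambda>_ \<in> carrier G \<times> carrier G \<times> carrier G \<times> carrier G. \<one>\<^bsub>A\<^esub>) t"
    proof (cases "t \<in> carrier G \<times> carrier G \<times> carrier G \<times> carrier G")
      case True
      then show ?thesis using cochain_cocycle[of x y z w] t by simp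
    next
      case False
      then show ?thesis unfolding cobound3_def restrict_def by simp
    qed
  qed
  then show ?thesis using cochain_CS3 by (simp add: ZS3_def)
qed

text \<open>The isomorphism is the inverse of the coordinates with respect to \<open>E\<close>, up
  to direction. \<open>P\<close> and \<open>Q\<close> involve no correction because \<open>E\<close>
  is invariant; the correction in \<open>m\<close> is the cochain by its definition.\<close>

lemma delta_isomorphic_T:
  "delta_isomorphic G D (T_delta G A act (cochain E))"
proof -
  let ?T = "T_delta G A act (cochain E)"
  define X where "X = (\<lambda>(a, (g, h)). star g \<one> (inv h) (E g \<one> (inv h)) a)"
  have X: "X (a, (inv v \<otimes> u, inv w \<otimes> v)) = star u v w (E u v w) a"
    if "u \<in> carrier G" "v \<in> carrier G" "w \<in> carrier G" for u v w a
    using E_translate[of "inv v" u v w] star_translate[of "inv v" u v w] that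
    by (simp add: X_def group_simps)
  have X': "X (a, (g, h)) = star u v w (E u v w) a"
    if "u \<in> carrier G" "v \<in> carrier G" "w \<in> carrier G" "g = inv v \<otimes> u" "h = inv w \<otimes> v" for u v w a g h
    using X[OF that(1-3)] that(4,5) by simp
  have "delta_iso G D ?T (\<lambda>g h. inv_into (cell ?T g h) X)"
  proof (rule delta_iso_inverse[OF delta_group_D])
    fix g h k x y z
    assume G: "g \<in> carrier G" "h \<in> carrier G" "k \<in> carrier G"
      and "x \<in> cell ?T g (inv h)" "y \<in> cell ?T h (inv k)" "z \<in> cell ?T (inv h \<otimes> g) (inv k \<otimes> h)"
    then obtain a b c where xyz: "x = (a, (g, inv h))" "y = (b, (h, inv k))" "z = (c, (inv h \<otimes> g, inv k \<otimes> h))"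
      and abc: "a \<in> carrier A" "b \<in> carrier A" "c \<in> carrier A"
      by (auto simp: T_delta_def)
    let ?\<alpha> = "cochain E (inv g \<otimes> h, inv h \<otimes> k, inv k)"
    have \<alpha>: "?\<alpha> = hcochain E g h k \<one>" "?\<alpha> \<in> carrier A"
      using G by (auto simp: hcochain_def intro!: cochain_closed)
    have b': "act (inv g \<otimes> h) b \<in> carrier A" using G abc act_closed by simp
    have mT: "m_op ?T g h k x y z = (a \<otimes>\<^bsub>A\<^esub> act (inv g \<otimes> h) b \<otimes>\<^bsub>A\<^esub> c \<otimes>\<^bsub>A\<^esub> ?\<alpha>, (g, inv k))"
      by (simp add: T_delta_def xyz)
    then show "m_op ?T g h k x y z \<in> cell ?T g (inv k)"
      using \<alpha> b' abc by (simp add: T_delta_def)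
    have "X (m_op ?T g h k x y z) = star g \<one> k (E g \<one> k) (?\<alpha> \<otimes>\<^bsub>A\<^esub> (a \<otimes>\<^bsub>A\<^esub> act (inv g \<otimes> h) b \<otimes>\<^bsub>A\<^esub> c))"
      unfolding mT using X'[of g \<one> k g "inv k"] G abc b' \<alpha> by (simp add: A.m_comm)
    also have "\<dots> = star g \<one> k (m (E g \<one> h) (E h \<one> k) (E g h k)) (a \<otimes>\<^bsub>A\<^esub> act (inv g \<otimes> h) b \<otimes>\<^bsub>A\<^esub> c)"
      using star_star[OF E_closed[of g \<one> k] \<alpha>(2)] m_E[of g h k \<one>] \<alpha>(1) G abc b' by simp
    also have "\<dots> = m (star g \<one> h (E g \<one> h) a) (star h \<one> k (E h \<one> k) b) (star g h k (E g h k) c)"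
      using m_star[OF E_closed E_closed E_closed abc] G by simp
    also have "\<dots> = m (X x) (X y) (X z)"
      unfolding xyz using X'[of g \<one> h g "inv h"] X'[of h \<one> k h "inv k"] X[of g h k] G by simp
    finally show "X (m_op ?T g h k x y z) = m_op D g h k (X x) (X y) (X z)"
      by (simp add: m_D)
  next
    fix g h x assume G: "g \<in> carrier G" "h \<in> carrier G" and "x \<in> cell ?T g h"
    then obtain a where x: "x = (a, (g, h))" and a: "a \<in> carrier A"
      by (auto simp: T_delta_def)
    show "P_op ?T g h x \<in> cell ?T h (inv g \<otimes> inv h)" "Q_op ?T g h x \<in> cell ?T (inv g) (h \<otimes> g)"
      using a G act_closed by (auto simp: T_delta_def x)
    have Xx: "X x = star g \<one> (inv h) (E g \<one> (inv h)) a"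
      by (simp add: x X_def)
    have "X (P_op ?T g h x) = star \<one> (inv h) g (E \<one> (inv h) g) (act g a)"
      using X'[of \<one> "inv h" g h "inv g \<otimes> inv h"] G by (simp add: T_delta_def x)
    then show "X (P_op ?T g h x) = P_op D g h (X x)"
      using P_star[OF E_closed a, of g \<one> "inv h"] G P_E by (simp add: Xx P_D)
    have "X (Q_op ?T g h x) = star \<one> g (inv h) (E \<one> g (inv h)) (inv\<^bsub>A\<^esub> (act g a))"
      using X'[of \<one> g "inv h" "inv g" "h \<otimes> g"] G by (simp add: T_delta_def x)
    then show "X (Q_op ?T g h x) = Q_op D g h (X x)"
      using Q_star[OF E_closed a, of g \<one> "inv h"] G Q_E by (simp add: Xx Q_D)
  next
    fix g h assume G: "g \<in> carrier G" "h \<in> carrier G"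
    have e: "E g \<one> (inv h) \<in> C g \<one> (inv h)" using G E_closed by simp
    have "inj_on X (cell ?T g h)"
      using star_inj[OF e] by (auto simp: inj_on_def T_delta_def X_def)
    moreover have "X ` cell ?T g h = C g \<one> (inv h)"
    proof -
      have "cell ?T g h = (\<lambda>a. (a, (g, h))) ` carrier A"
        by (auto simp: T_delta_def)
      then have "X ` cell ?T g h = star g \<one> (inv h) (E g \<one> (inv h)) ` carrier A"
        by (simp add: image_image X_def)
      also have "\<dots> = C g \<one> (inv h)"
        using star_closed[OF e] star_surj[OF e] by blast
      finally show ?thesis .
    qed
    ultimately show "bij_betw X (cell ?T g h) (cell D g h)"
      using G by (simp add: bij_betw_def cell_D)
  qed
  then show ?thesis unfolding delta_isomorphic_def by blast
qed

end

section \<open>Changing a symmetric section by a symmetric 2-cochain\<close>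

definition sigma_twist :: "('g \<Rightarrow> 'g \<Rightarrow> 'g \<Rightarrow> 't) \<Rightarrow> ('g \<times> 'g \<Rightarrow> 'b) \<Rightarrow> 'g \<Rightarrow> 'g \<Rightarrow> 'g \<Rightarrow> 't" where
  "sigma_twist E \<sigma> u v w = star u v w (E u v w) (\<sigma> (inv u \<otimes> w, inv w \<otimes> v))"

context
  fixes E \<sigma> assumes E: "symmetric_section E" and \<sigma>: "\<sigma> \<in> CS2 G A act"
begin

private lemma \<sigma>_closed: "\<lbrakk>x \<in> carrier G; y \<in> carrier G\<rbrakk> \<Longrightarrow> \<sigma> (x, y) \<in> carrier A"
  and \<sigma>_1: "\<lbrakk>x \<in> carrier G; y \<in> carrier G\<rbrakk> \<Longrightarrow> \<sigma> (x, y) = inv\<^bsub>A\<^esub> (act x (\<sigma> (inv x, x \<otimes> y)))"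
  and \<sigma>_2: "\<lbrakk>x \<in> carrier G; y \<in> carrier G\<rbrakk> \<Longrightarrow> \<sigma> (x, y) = inv\<^bsub>A\<^esub> (\<sigma> (x \<otimes> y, inv y))"
proof -
  show "\<sigma> (x, y) \<in> carrier A" if "x \<in> carrier G" "y \<in> carrier G"
    using \<sigma> that PiE_mem[of \<sigma> "carrier G \<times> carrier G" "\<lambda>_. carrier A" "(x, y)"]
    unfolding CS2_def by blast
  show "\<sigma> (x, y) = inv\<^bsub>A\<^esub> (act x (\<sigma> (inv x, x \<otimes> y)))" "\<sigma> (x, y) = inv\<^bsub>A\<^esub> (\<sigma> (x \<otimes> y, inv y))"
    if "x \<in> carrier G" "y \<in> carrier G"
    using \<sigma> that unfolding CS2_def by blast+
qed

private definition "s u p q = \<sigma> (inv u \<otimes> p, inv p \<otimes> q)"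

private lemma s_closed: "\<lbrakk>u \<in> carrier G; p \<in> carrier G; q \<in> carrier G\<rbrakk> \<Longrightarrow> s u p q \<in> carrier A"
  by (simp add: s_def \<sigma>_closed)

private lemma s_swap: "\<lbrakk>u \<in> carrier G; p \<in> carrier G; q \<in> carrier G\<rbrakk> \<Longrightarrow> s u q p = inv\<^bsub>A\<^esub> (s u p q)"
  using \<sigma>_2[of "inv u \<otimes> q" "inv q \<otimes> p"] by (simp add: s_def group_simps)

private lemma s_swap_first:
  "\<lbrakk>u \<in> carrier G; p \<in> carrier G; q \<in> carrier G\<rbrakk> \<Longrightarrow> s p u q = inv\<^bsub>A\<^esub> (act (inv p \<otimes> u) (s u p q))"
  using \<sigma>_1[of "inv p \<otimes> u" "inv u \<otimes> q"] by (simp add: s_def group_simps)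

private lemma twist: "sigma_twist E \<sigma> u v w = star u v w (E u v w) (s u w v)"
  by (simp add: sigma_twist_def s_def)

text \<open>The two relations of \<open>CS2\<close> are the transpositions of neighbours in the
  sequence \<open>u\<close>, \<open>w\<close>, \<open>v\<close>; they make the displacement of the
  base points compatible with \<open>P\<close> and \<open>Q\<close>.\<close>

lemma symmetric_section_twist: "symmetric_section (sigma_twist E \<sigma>)"
  unfolding symmetric_section_def
proof (intro ballI conjI)
  fix u v w assume G: "u \<in> carrier G" "v \<in> carrier G" "w \<in> carrier G"
  show "sigma_twist E \<sigma> u v w \<in> C u v w"
    unfolding twist using G by (intro star_closed E_closed[OF E] s_closed)
  have "act (inv v \<otimes> u) (s u w v) = s v u w"
    using s_swap_first[of u v w] s_swap[of u v w] G s_closed by (simp add: act_inv)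
  then show "P (sigma_twist E \<sigma> u v w) = sigma_twist E \<sigma> v w u"
    unfolding twist using P_star[OF E_closed[OF E] s_closed] P_E[OF E] G by simp
  show "Q (sigma_twist E \<sigma> u v w) = sigma_twist E \<sigma> v u w"
    unfolding twist
    using Q_star[OF E_closed[OF E] s_closed] Q_E[OF E] G \<open>act (inv v \<otimes> u) (s u w v) = s v u w\<close>
      s_swap[of v u w] by simp
  fix k assume k: "k \<in> carrier G"
  show "sigma_twist E \<sigma> (k \<otimes> u) (k \<otimes> v) (k \<otimes> w) = sigma_twist E \<sigma> u v w"
    unfolding twist s_def using k G E_translate[OF E] star_translate by (simp add: group_simps)
qed

text \<open>Each of the four faces of the tetrahedron contributes one displacement, the second after
  transport. The order \<open>u\<close>, \<open>w\<close>, \<open>v\<close> inside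
  \<open>sigma_twist\<close> fixes the sign: with the last two exchanged, the inverse coboundary
  would appear.\<close>

lemma cochain_twist:
  assumes "x \<in> carrier G" "y \<in> carrier G" "z \<in> carrier G"
  shows "cochain (sigma_twist E \<sigma>) (x, y, z) = cobound2 G A act \<sigma> (x, y, z) \<otimes>\<^bsub>A\<^esub> cochain E (x, y, z)"
proof -
  let ?w = "x \<otimes> y" and ?v = "x \<otimes> (y \<otimes> z)"
  have G: "\<one> \<in> carrier G" "x \<in> carrier G" "?w \<in> carrier G" "?v \<in> carrier G" using assms by auto
  define c1 c2 c3 c4 a where "c1 = s \<one> x ?v" and "c2 = act x (s x ?w ?v)" and "c3 = s \<one> x ?w"
    and "c4 = s \<one> ?w ?v" and "a = cochain E (x, y, z)"
  have mem: "c1 \<in> carrier A" "c2 \<in> carrier A" "c3 \<in> carrier A" "c4 \<in> carrier A" "a \<in> carrier A"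
    unfolding c1_def c2_def c3_def c4_def a_def using assms G
    by (auto intro!: s_closed act_closed cochain_closed[OF E])
  have cb: "cobound2 G A act \<sigma> (x, y, z) = c2 \<otimes>\<^bsub>A\<^esub> inv\<^bsub>A\<^esub> c4 \<otimes>\<^bsub>A\<^esub> c1 \<otimes>\<^bsub>A\<^esub> inv\<^bsub>A\<^esub> c3"
    using assms by (simp add: cobound2_def c1_def c2_def c3_def c4_def s_def group_simps)
  have "m (sigma_twist E \<sigma> \<one> ?v x) (sigma_twist E \<sigma> x ?v ?w) (sigma_twist E \<sigma> \<one> x ?w)
    = star \<one> ?v ?w (m (E \<one> ?v x) (E x ?v ?w) (E \<one> x ?w)) (c1 \<otimes>\<^bsub>A\<^esub> c2 \<otimes>\<^bsub>A\<^esub> inv\<^bsub>A\<^esub> c3)"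
    unfolding twist
    using m_star[OF E_closed[OF E] E_closed[OF E] E_closed[OF E]
        s_closed[of \<one> x ?v] s_closed[of x ?w ?v] s_closed[of \<one> ?w x]] G s_swap[of \<one> x ?w]
    by (simp add: c1_def c2_def c3_def)
  also have "\<dots> = star \<one> ?v ?w (E \<one> ?v ?w) (a \<otimes>\<^bsub>A\<^esub> (c1 \<otimes>\<^bsub>A\<^esub> c2 \<otimes>\<^bsub>A\<^esub> inv\<^bsub>A\<^esub> c3))"
    using cochain_eq[OF E assms, symmetric] star_star[OF E_closed[OF E]] G mem assms
    by (simp add: a_def m_assoc)
  also have "a \<otimes>\<^bsub>A\<^esub> (c1 \<otimes>\<^bsub>A\<^esub> c2 \<otimes>\<^bsub>A\<^esub> inv\<^bsub>A\<^esub> c3) = c4 \<otimes>\<^bsub>A\<^esub> (c2 \<otimes>\<^bsub>A\<^esub> inv\<^bsub>A\<^esub> c4 \<otimes>\<^bsub>A\<^esub> c1 \<otimes>\<^bsub>A\<^esub> inv\<^bsub>A\<^esub> c3 \<otimes>\<^bsub>A\<^esub> a)"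
  proof -
    have "c4 \<otimes>\<^bsub>A\<^esub> (c2 \<otimes>\<^bsub>A\<^esub> i \<otimes>\<^bsub>A\<^esub> c1 \<otimes>\<^bsub>A\<^esub> j \<otimes>\<^bsub>A\<^esub> a) = (c4 \<otimes>\<^bsub>A\<^esub> i) \<otimes>\<^bsub>A\<^esub> (a \<otimes>\<^bsub>A\<^esub> (c1 \<otimes>\<^bsub>A\<^esub> c2 \<otimes>\<^bsub>A\<^esub> j))"
      if "i \<in> carrier A" "j \<in> carrier A" for i j
      using mem that by (simp add: A.m_ac)
    from this[of "inv\<^bsub>A\<^esub> c4" "inv\<^bsub>A\<^esub> c3"] show ?thesis using mem by simp
  qed
  also have "star \<one> ?v ?w (E \<one> ?v ?w) \<dots> = star \<one> ?v ?w (sigma_twist E \<sigma> \<one> ?v ?w) (cobound2 G A act \<sigma> (x, y, z) \<otimes>\<^bsub>A\<^esub> a)"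
    unfolding twist using star_star[OF E_closed[OF E]] G mem by (simp add: cb c4_def)
  finally have "hcochain (sigma_twist E \<sigma>) \<one> x ?w ?v = cobound2 G A act \<sigma> (x, y, z) \<otimes>\<^bsub>A\<^esub> a"
    using mem G by (intro hcochain_eqI[OF symmetric_section_twist]) (auto simp: cb)
  then show ?thesis
    using cochain_hcochain[OF symmetric_section_twist assms] by (simp add: a_def)
qed

end

text \<open>The twists of one symmetric section realise all cocycles in its cohomology class.\<close>

theorem classification:
  assumes E: "symmetric_section E"
  shows "\<exists>\<alpha>\<in>carrier (ZS3 G A act). delta_isomorphic G D (T_delta G A act \<alpha>) \<and>
    (\<exists>\<xi>\<in>carrier (HS3 G A act). \<alpha> \<in> \<xi> \<and>
      (\<forall>\<alpha>'\<in>\<xi>. delta_isomorphic G D (T_delta G A act \<alpha>')))"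
proof (intro bexI[of _ "cochain E"] conjI)
  let ?Z = "ZS3 G A act" and ?S = "carrier G \<times> carrier G \<times> carrier G"
  show "delta_isomorphic G D (T_delta G A act (cochain E))" by (rule delta_isomorphic_T[OF E])
  show Z: "cochain E \<in> carrier ?Z" by (rule cochain_ZS3[OF E])
  let ?\<xi> = "BS3 G A act #>\<^bsub>?Z\<^esub> cochain E"
  have mult: "cobound2 G A act \<sigma> \<otimes>\<^bsub>?Z\<^esub> cochain E = cochain (sigma_twist E \<sigma>)" if "\<sigma> \<in> CS2 G A act" for \<sigma>
  proof
    fix t :: "'g \<times> 'g \<times> 'g"
    obtain x y z where t: "t = (x, y, z)" by (metis prod_cases3)
    show "(cobound2 G A act \<sigma> \<otimes>\<^bsub>?Z\<^esub> cochain E) t = cochain (sigma_twist E \<sigma>) t"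
    proof (cases "t \<in> ?S")
      case True
      then show ?thesis using cochain_twist[OF E that, of x y z] by (simp add: t ZS3_def)
    next
      case False
      then show ?thesis unfolding ZS3_def cochain_def restrict_def by simp
    qed
  qed
  show "\<exists>\<xi>\<in>carrier (HS3 G A act). cochain E \<in> \<xi> \<and>
      (\<forall>\<alpha>'\<in>\<xi>. delta_isomorphic G D (T_delta G A act \<alpha>'))"
  proof (intro bexI[of _ ?\<xi>] conjI ballI)
    show "?\<xi> \<in> carrier (HS3 G A act)"
      using Z by (auto simp: HS3_def FactGroup_def RCOSETS_def)
  next
    fix \<alpha>' assume "\<alpha>' \<in> ?\<xi>"
    then obtain \<sigma> where \<sigma>: "\<sigma> \<in> CS2 G A act" "\<alpha>' = cobound2 G A act \<sigma> \<otimes>\<^bsub>?Z\<^esub> cochain E"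
      by (auto simp: r_coset_def BS3_def)
    then show "delta_isomorphic G D (T_delta G A act \<alpha>')"
      using delta_isomorphic_T[OF symmetric_section_twist[OF E \<sigma>(1)]] mult by simp
  next
    \<comment> \<open>The trivial 2-cochain has trivial coboundary and so exhibits
      \<open>cochain E\<close> as a member of its coset, without an appeal to subgroup properties of
      \<open>BS3\<close>.\<close>
    define \<sigma> where "\<sigma> = (\<lambda>_ \<in> carrier G \<times> carrier G. \<one>\<^bsub>A\<^esub>)"
    have \<sigma>: "\<sigma> \<in> CS2 G A act"
      by (auto simp: CS2_def \<sigma>_def act_unit)
    have "cobound2 G A act \<sigma> \<otimes>\<^bsub>?Z\<^esub> cochain E = cochain E"
    proof
      fix t :: "'g \<times> 'g \<times> 'g"
      obtain x y z where t: "t = (x, y, z)" by (metis prod_cases3)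
      show "(cobound2 G A act \<sigma> \<otimes>\<^bsub>?Z\<^esub> cochain E) t = cochain E t"
      proof (cases "t \<in> ?S")
        case True
        then have "cobound2 G A act \<sigma> (x, y, z) = \<one>\<^bsub>A\<^esub>"
          by (simp add: t cobound2_def \<sigma>_def act_unit)
        then show ?thesis using True cochain_closed[OF E, of x y z] by (simp add: t ZS3_def)
      next
        case False
        then show ?thesis unfolding ZS3_def cochain_def restrict_def by simp
      qed
    qed
    then show "cochain E \<in> ?\<xi>"
      using \<sigma> by (force simp: r_coset_def BS3_def)
  qed
qed

end

section \<open>Homotopy classes of triangles\<close>

lemma simplex2_boundary_subset: "simplex2_boundary \<subseteq> simplex2"
  by (auto simp: simplex2_boundary_def)

lemma mem_triangle_class:
  "b \<in> triangle_class M a \<longleftrightarrow>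
     (\<exists>h. continuous_on ({0..1::real} \<times> simplex2) h \<and> h ` ({0..1} \<times> simplex2) \<subseteq> M \<and>
        (\<forall>x\<in>simplex2. h (0, x) = a x) \<and> (\<forall>x\<in>simplex2. h (1, x) = b x) \<and>
        (\<forall>t\<in>{0..1}. \<forall>x\<in>simplex2_boundary. h (t, x) = a x))"
  unfolding triangle_class_def mem_Collect_eq
proof (subst homotopic_with, goal_cases)
  case (1 h k)
  then have "h x = k x" if "x \<in> simplex2_boundary" for x
    using that simplex2_boundary_subset by (metis subsetD topspace_euclidean_subtopology)
  then show ?case by auto
next
  case 2
  show ?case by (auto simp: image_subset_iff)
qed

lemma triangle_class_I:
  assumes "continuous_on ({0..1::real} \<times> simplex2) h" "h ` ({0..1} \<times> simplex2) \<subseteq> M"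
    "\<And>x. x \<in> simplex2 \<Longrightarrow> h (0, x) = a x" "\<And>x. x \<in> simplex2 \<Longrightarrow> h (1, x) = b x"
    "\<And>t x. \<lbrakk>0 \<le> t; t \<le> 1; x \<in> simplex2_boundary\<rbrakk> \<Longrightarrow> h (t, x) = a x"
  shows "b \<in> triangle_class M a"
  unfolding mem_triangle_class using assms by (intro exI[of _ h]) auto

lemma triangle_class_E:
  assumes "b \<in> triangle_class M a"
  obtains h where "continuous_on ({0..1} \<times> simplex2) h" "h ` ({0..1} \<times> simplex2) \<subseteq> M"
    "\<And>x. x \<in> simplex2 \<Longrightarrow> h (0::real, x) = a x" "\<And>x. x \<in> simplex2 \<Longrightarrow> h (1, x) = b x"
    "\<And>t x. \<lbrakk>t \<in> {0..1}; x \<in> simplex2_boundary\<rbrakk> \<Longrightarrow> h (t, x) = a x"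
proof -
  obtain h where h: "continuous_on ({0..1} \<times> simplex2) h" "h ` ({0..1} \<times> simplex2) \<subseteq> M"
    "\<forall>x\<in>simplex2. h (0::real, x) = a x" "\<forall>x\<in>simplex2. h (1, x) = b x"
    "\<forall>t\<in>{0..1}. \<forall>x\<in>simplex2_boundary. h (t, x) = a x"
    using assms unfolding mem_triangle_class by (elim exE conjE) (rule that)
  show thesis
    by (rule that[OF h(1,2) bspec[OF h(3)] bspec[OF h(4)] bspec[OF bspec[OF h(5)]]])
qed

lemma triangle_class_imp_continuous:
  assumes "b \<in> triangle_class M a"
  shows "continuous_on simplex2 a" "continuous_on simplex2 b" "a ` simplex2 \<subseteq> M" "b ` simplex2 \<subseteq> M"
proof -
  have h: "homotopic_with_canon (\<lambda>h. \<forall>x\<in>simplex2_boundary. h x = a x) simplex2 M a b"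
    using assms unfolding triangle_class_def by simp
  show "continuous_on simplex2 a" "continuous_on simplex2 b"
    using homotopic_with_imp_continuous[OF h] by auto
  show "a ` simplex2 \<subseteq> M" "b ` simplex2 \<subseteq> M"
    using homotopic_with_imp_subset1[OF h] homotopic_with_imp_subset2[OF h] by auto
qed

lemma triangle_class_boundary:
  assumes "b \<in> triangle_class M a" "x \<in> simplex2_boundary"
  shows "b x = a x"
proof -
  obtain h where h: "\<And>x. x \<in> simplex2 \<Longrightarrow> h (1, x) = b x"
      "\<And>t x. \<lbrakk>t \<in> {0..1::real}; x \<in> simplex2_boundary\<rbrakk> \<Longrightarrow> h (t, x) = a x"
    using triangle_class_E[OF assms(1)] by metis
  have "x \<in> simplex2" using assms(2) simplex2_boundary_subset by blast
  from h(1)[OF this] h(2)[OF _ assms(2), of 1] show ?thesis by simp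
qed

lemma triangle_class_cong:
  assumes "continuous_on simplex2 a" "a ` simplex2 \<subseteq> M" "\<And>x. x \<in> simplex2 \<Longrightarrow> a x = b x"
  shows "b \<in> triangle_class M a"
  by (rule triangle_class_I[where h = "\<lambda>(t, x). a x"])
    (use assms simplex2_boundary_subset in
      \<open>auto simp: case_prod_beta intro!: continuous_on_compose2[OF assms(1)] continuous_intros\<close>)

lemma triangle_class_refl:
  "\<lbrakk>continuous_on simplex2 a; a ` simplex2 \<subseteq> M\<rbrakk> \<Longrightarrow> a \<in> triangle_class M a"
  by (rule triangle_class_cong) auto

text \<open>The boundary condition in \<open>triangle_class\<close> refers to the representative.
  Equivalent triangles agree on the boundary, so they impose the same condition, and homotopy with a
  fixed condition is an equivalence.\<close>

lemma triangle_class_eq: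
  assumes "b \<in> triangle_class M a"
  shows "triangle_class M b = triangle_class M a"
proof -
  have *: "(\<lambda>h. \<forall>x\<in>simplex2_boundary. h x = b x) = (\<lambda>h. \<forall>x\<in>simplex2_boundary. h x = a x)"
    using triangle_class_boundary[OF assms] by (intro ext) auto
  show ?thesis
    using assms unfolding triangle_class_def mem_Collect_eq *
    by (auto intro: homotopic_with_trans homotopic_with_symD)
qed

text \<open>The values along the straight line from \<open>f x\<close> to \<open>g x\<close> only have to stay constant under \<open>\<omega>\<close>,
  so this also applies when \<open>f\<close> and \<open>g\<close> differ on the boundary.\<close>

lemma triangle_class_linear:
  fixes \<omega> :: "'e::real_normed_vector \<Rightarrow> 'a::topological_space"
  assumes \<omega>: "continuous_on K \<omega>" "\<omega> ` K \<subseteq> M" "convex K"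
    and f: "continuous_on simplex2 f" "f ` simplex2 \<subseteq> K"
    and g: "continuous_on simplex2 g" "g ` simplex2 \<subseteq> K"
    and bd: "\<And>t x. \<lbrakk>0 \<le> t; t \<le> 1; x \<in> simplex2_boundary\<rbrakk>
      \<Longrightarrow> \<omega> ((1 - t) *\<^sub>R f x + t *\<^sub>R g x) = \<omega> (f x)"
  shows "(\<lambda>x. \<omega> (g x)) \<in> triangle_class M (\<lambda>x. \<omega> (f x))"
proof (rule triangle_class_I[where h = "\<lambda>p. \<omega> ((1 - fst p) *\<^sub>R f (snd p) + fst p *\<^sub>R g (snd p))"])
  have K: "(1 - t) *\<^sub>R f x + t *\<^sub>R g x \<in> K" if "0 \<le> t" "t \<le> 1" "x \<in> simplex2" for t x
    using that f g by (intro convexD_alt[OF \<omega>(3)]) auto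
  show "continuous_on ({0..1} \<times> simplex2) (\<lambda>p. \<omega> ((1 - fst p) *\<^sub>R f (snd p) + fst p *\<^sub>R g (snd p)))"
    by (intro continuous_on_compose2[OF \<omega>(1)] continuous_intros
        continuous_on_compose2[OF f(1)] continuous_on_compose2[OF g(1)]) (auto intro: K)
  show "(\<lambda>p. \<omega> ((1 - fst p) *\<^sub>R f (snd p) + fst p *\<^sub>R g (snd p))) ` ({0..1} \<times> simplex2) \<subseteq> M"
    using \<omega>(2) K by (auto simp: image_subset_iff)
qed (use bd in auto)

lemma convex_simplex2: "convex simplex2"
proof (rule convexI)
  fix x y :: "real \<times> real \<times> real" and u v :: real
  assume *: "x \<in> simplex2" "y \<in> simplex2" "0 \<le> u" "0 \<le> v" "u + v = 1"
  obtain x0 x1 x2 y0 y1 y2 where xy: "x = (x0, x1, x2)" "y = (y0, y1, y2)" by (metis prod_cases3)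
  have "(u * x0 + v * y0) + (u * x1 + v * y1) + (u * x2 + v * y2) = u * (x0 + x1 + x2) + v * (y0 + y1 + y2)"
    by (simp add: algebra_simps)
  then show "u *\<^sub>R x + v *\<^sub>R y \<in> simplex2"
    using * by (simp add: xy simplex2_def)
qed

lemma convex_simplex3: "convex simplex3"
proof (rule convexI)
  fix x y :: "real \<times> real \<times> real \<times> real" and u v :: real
  assume *: "x \<in> simplex3" "y \<in> simplex3" "0 \<le> u" "0 \<le> v" "u + v = 1"
  obtain x0 x1 x2 x3 y0 y1 y2 y3 where xy: "x = (x0, x1, x2, x3)" "y = (y0, y1, y2, y3)" by (metis prod_cases4)
  have "(u * x0 + v * y0) + (u * x1 + v * y1) + (u * x2 + v * y2) + (u * x3 + v * y3)
      = u * (x0 + x1 + x2 + x3) + v * (y0 + y1 + y2 + y3)"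
    by (simp add: algebra_simps)
  then show "u *\<^sub>R x + v *\<^sub>R y \<in> simplex3"
    using * by (simp add: xy simplex3_def)
qed

section \<open>Filling a horn of three triangles\<close>

lemma face_eq:
  "face \<omega> 1 2 0 = (\<lambda>(x0, x1, x2). \<omega> (x2, x0, x1, 0))"
  "face \<omega> (Suc 0) 2 0 = (\<lambda>(x0, x1, x2). \<omega> (x2, x0, x1, 0))"
  "face \<omega> 0 2 3 = (\<lambda>(x0, x1, x2). \<omega> (x0, 0, x1, x2))"
  "face \<omega> 1 0 3 = (\<lambda>(x0, x1, x2). \<omega> (x1, x0, 0, x2))"
  "face \<omega> (Suc 0) 0 3 = (\<lambda>(x0, x1, x2). \<omega> (x1, x0, 0, x2))"
  "face \<omega> 1 2 3 = (\<lambda>(x0, x1, x2). \<omega> (0, x0, x1, x2))"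
  "face \<omega> (Suc 0) 2 3 = (\<lambda>(x0, x1, x2). \<omega> (0, x0, x1, x2))"
  by (simp_all add: face_def vert3_def)

lemma face_simps [simp]:
  "face \<omega> 1 2 0 (x0, x1, x2) = \<omega> (x2, x0, x1, 0)"
  "face \<omega> (Suc 0) 2 0 (x0, x1, x2) = \<omega> (x2, x0, x1, 0)"
  "face \<omega> 0 2 3 (x0, x1, x2) = \<omega> (x0, 0, x1, x2)"
  "face \<omega> 1 0 3 (x0, x1, x2) = \<omega> (x1, x0, 0, x2)"
  "face \<omega> (Suc 0) 0 3 (x0, x1, x2) = \<omega> (x1, x0, 0, x2)"
  "face \<omega> 1 2 3 (x0, x1, x2) = \<omega> (0, x0, x1, x2)"
  "face \<omega> (Suc 0) 2 3 (x0, x1, x2) = \<omega> (0, x0, x1, x2)"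
  by (simp_all add: face_eq)

lemma continuous_on_face:
  assumes "continuous_on simplex3 \<omega>"
  shows "continuous_on simplex2 (face \<omega> 1 2 0)" "continuous_on simplex2 (face \<omega> 0 2 3)"
    "continuous_on simplex2 (face \<omega> 1 0 3)" "continuous_on simplex2 (face \<omega> 1 2 3)"
  unfolding face_eq case_prod_beta
  by (intro continuous_on_compose2[OF assms] continuous_intros; auto simp: simplex2_def simplex3_def)+

lemma face_image:
  assumes "\<omega> ` simplex3 \<subseteq> M"
  shows "face \<omega> 1 2 0 ` simplex2 \<subseteq> M" "face \<omega> 0 2 3 ` simplex2 \<subseteq> M"
    "face \<omega> 1 0 3 ` simplex2 \<subseteq> M" "face \<omega> 1 2 3 ` simplex2 \<subseteq> M"
  using assms by (force simp: face_eq simplex2_def simplex3_def image_subset_iff)+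

text \<open>The three other faces of the tetrahedron form a horn; \<open>fill\<close> is the composite with the
  retraction onto it along the direction \<open>(3, -1, -1, -1)\<close>.\<close>

definition fill ::
  "(real \<times> real \<times> real \<Rightarrow> 'a) \<Rightarrow> (real \<times> real \<times> real \<Rightarrow> 'a) \<Rightarrow> (real \<times> real \<times> real \<Rightarrow> 'a)
    \<Rightarrow> real \<times> real \<times> real \<times> real \<Rightarrow> 'a" where
  "fill a b c = (\<lambda>(y0, y1, y2, y3).
     if y3 \<le> min y1 y2 then a (y1 - y3, y2 - y3, y0 + 3 * y3)
     else if y1 \<le> y2 then b (y0 + 3 * y1, y2 - y1, y3 - y1)
     else c (y1 - y2, y0 + 3 * y2, y3 - y2))"

definition glue ::
  "(real \<times> real \<times> real \<Rightarrow> 'a) \<Rightarrow> (real \<times> real \<times> real \<Rightarrow> 'a) \<Rightarrow> (real \<times> real \<times> real \<Rightarrow> 'a)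
    \<Rightarrow> real \<times> real \<times> real \<Rightarrow> 'a" where
  "glue a b c = face (fill a b c) 1 2 3"

text \<open>Agreement along the three edges from the vertex 0 of the tetrahedron, where the faces of
  the horn meet in pairs.\<close>

definition matching ::
  "(real \<times> real \<times> real \<Rightarrow> 'a) \<Rightarrow> (real \<times> real \<times> real \<Rightarrow> 'a) \<Rightarrow> (real \<times> real \<times> real \<Rightarrow> 'a) \<Rightarrow> bool" where
  "matching a b c \<longleftrightarrow> (\<forall>p q. 0 \<le> p \<and> 0 \<le> q \<and> p + q = 1 \<longrightarrow>
     a (p, 0, q) = c (p, q, 0) \<and> a (0, p, q) = b (q, p, 0) \<and> b (q, 0, p) = c (0, q, p))"

lemma matchingD:
  assumes "matching a b c" "0 \<le> p" "0 \<le> q" "p + q = 1"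
  shows "c (p, q, 0) = a (p, 0, q)" "b (q, p, 0) = a (0, p, q)" "c (0, q, p) = b (q, 0, p)"
  using assms unfolding matching_def by auto

lemma fill_faces:
  assumes "matching a b c" "x \<in> simplex2"
  shows "face (fill a b c) 1 2 0 x = a x" "face (fill a b c) 0 2 3 x = b x"
    "face (fill a b c) 1 0 3 x = c x"
proof -
  obtain x0 x1 x2 where x: "x = (x0, x1, x2)" by (metis prod_cases3)
  have s: "0 \<le> x0" "0 \<le> x1" "0 \<le> x2" "x0 + x1 + x2 = 1"
    using assms(2) by (auto simp: x simplex2_def)
  show "face (fill a b c) 1 2 0 x = a x"
    using s(1-3) by (simp add: x fill_def)
  show "face (fill a b c) 0 2 3 x = b x"
  proof (cases "x2 = 0")
    case True
    then show ?thesis using s(2) matchingD(2)[OF assms(1) s(2,1)] s(4) by (simp add: x fill_def)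
  next
    case False
    then show ?thesis using s(2,3) by (simp add: x fill_def)
  qed
  show "face (fill a b c) 1 0 3 x = c x"
  proof (cases "x2 = 0")
    case True
    then show ?thesis using s(1) matchingD(1)[OF assms(1) s(1,2)] s(4) by (simp add: x fill_def)
  next
    case False
    then have F: "fill a b c (x1, x0, 0, x2) = (if x0 \<le> 0 then b (x1 + 3 * x0, 0 - x0, x2 - x0) else c (x0, x1, x2))"
      using s(1,3) by (simp add: fill_def)
    show ?thesis
    proof (cases "x0 = 0")
      case True
      then show ?thesis using F matchingD(3)[OF assms(1) s(3,2)] s(4) by (simp add: x)
    next
      case False
      then show ?thesis using F s(1) by (simp add: x)
    qed
  qed
qed

text \<open>The first coordinate is the time of a homotopy. Homotopies relative to the boundary keep
  the faces matched at every time, so \<open>glue_class\<close> can fill three of them at once;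
  constant families give \<open>fill_continuous\<close>.\<close>

lemma continuous_fill:
  fixes a b c :: "real \<Rightarrow> real \<times> real \<times> real \<Rightarrow> 'a::topological_space"
  assumes a: "continuous_on ({0..1} \<times> simplex2) (\<lambda>p. a (fst p) (snd p))"
    and b: "continuous_on ({0..1} \<times> simplex2) (\<lambda>p. b (fst p) (snd p))"
    and c: "continuous_on ({0..1} \<times> simplex2) (\<lambda>p. c (fst p) (snd p))"
    and m: "\<And>t. t \<in> {0..1} \<Longrightarrow> matching (a t) (b t) (c t)"
  shows "continuous_on ({0..1} \<times> simplex3) (\<lambda>p. fill (a (fst p)) (b (fst p)) (c (fst p)) (snd p))"
proof -
  let ?S = "{0..1::real} \<times> simplex3"
  let ?y0 = "\<lambda>p::real \<times> real \<times> real \<times> real \<times> real. fst (snd p)"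
  let ?y1 = "\<lambda>p::real \<times> real \<times> real \<times> real \<times> real. fst (snd (snd p))"
  let ?y2 = "\<lambda>p::real \<times> real \<times> real \<times> real \<times> real. fst (snd (snd (snd p)))"
  let ?y3 = "\<lambda>p::real \<times> real \<times> real \<times> real \<times> real. snd (snd (snd (snd p)))"
  let ?fa = "\<lambda>p. a (fst p) (?y1 p - ?y3 p, ?y2 p - ?y3 p, ?y0 p + 3 * ?y3 p)"
  let ?fb = "\<lambda>p. b (fst p) (?y0 p + 3 * ?y1 p, ?y2 p - ?y1 p, ?y3 p - ?y1 p)"
  let ?fc = "\<lambda>p. c (fst p) (?y1 p - ?y2 p, ?y0 p + 3 * ?y2 p, ?y3 p - ?y2 p)"
  have "continuous_on ?S (\<lambda>p. if ?y3 p - min (?y1 p) (?y2 p) \<le> 0 then ?fa p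
      else if ?y1 p - ?y2 p \<le> 0 then ?fb p else ?fc p)"
  proof (rule continuous_on_cases_le)
    show "continuous_on {p \<in> ?S. ?y3 p - min (?y1 p) (?y2 p) \<le> 0} ?fa"
      by (rule continuous_on_compose2[OF a, where f = "\<lambda>p. (fst p, (?y1 p - ?y3 p, ?y2 p - ?y3 p, ?y0 p + 3 * ?y3 p))", simplified])
        (auto intro!: continuous_intros simp: simplex3_def simplex2_def)
    show "continuous_on {p \<in> ?S. 0 \<le> ?y3 p - min (?y1 p) (?y2 p)}
        (\<lambda>p. if ?y1 p - ?y2 p \<le> 0 then ?fb p else ?fc p)"
    proof (rule continuous_on_cases_le)
      show "continuous_on {p \<in> {p \<in> ?S. 0 \<le> ?y3 p - min (?y1 p) (?y2 p)}. ?y1 p - ?y2 p \<le> 0} ?fb"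
        by (rule continuous_on_compose2[OF b, where f = "\<lambda>p. (fst p, (?y0 p + 3 * ?y1 p, ?y2 p - ?y1 p, ?y3 p - ?y1 p))", simplified])
          (auto intro!: continuous_intros simp: simplex3_def simplex2_def)
      show "continuous_on {p \<in> {p \<in> ?S. 0 \<le> ?y3 p - min (?y1 p) (?y2 p)}. 0 \<le> ?y1 p - ?y2 p} ?fc"
        by (rule continuous_on_compose2[OF c, where f = "\<lambda>p. (fst p, (?y1 p - ?y2 p, ?y0 p + 3 * ?y2 p, ?y3 p - ?y2 p))", simplified])
          (auto intro!: continuous_intros simp: simplex3_def simplex2_def)
      fix p assume p: "p \<in> {p \<in> ?S. 0 \<le> ?y3 p - min (?y1 p) (?y2 p)}" "?y1 p - ?y2 p = 0"
      obtain t y0 y1 y2 y3 where q: "p = (t, y0, y1, y2, y3)" by (metis prod_cases5)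
      show "?fb p = ?fc p"
        using p matchingD(3)[OF m[of t], of "y3 - y1" "y0 + 3 * y1"] by (auto simp: q simplex3_def)
    qed (auto intro!: continuous_intros)
    fix p assume p: "p \<in> ?S" "?y3 p - min (?y1 p) (?y2 p) = 0"
    obtain t y0 y1 y2 y3 where q: "p = (t, y0, y1, y2, y3)" by (metis prod_cases5)
    show "?fa p = (if ?y1 p - ?y2 p \<le> 0 then ?fb p else ?fc p)"
      using p matchingD(2)[OF m[of t], of "y2 - y1" "y0 + 3 * y1"]
        matchingD(1)[OF m[of t], of "y1 - y2" "y0 + 3 * y2"]
      by (auto simp: q simplex3_def min_def split: if_splits)
  qed (auto intro!: continuous_intros)
  then have 1: "continuous_on ?S (\<lambda>p. if ?y3 p - min (?y1 p) (?y2 p) \<le> 0 then ?fa p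
      else if ?y1 p - ?y2 p \<le> 0 then ?fb p else ?fc p)" .
  have 2: "(\<lambda>p. fill (a (fst p)) (b (fst p)) (c (fst p)) (snd p)) =
      (\<lambda>p. if ?y3 p - min (?y1 p) (?y2 p) \<le> 0 then ?fa p
      else if ?y1 p - ?y2 p \<le> 0 then ?fb p else ?fc p)"
    by (rule ext) (auto simp: fill_def case_prod_beta)
  show ?thesis unfolding 2 by (rule 1)
qed

lemma fill_image:
  assumes "a ` simplex2 \<subseteq> M" "b ` simplex2 \<subseteq> M" "c ` simplex2 \<subseteq> M" "y \<in> simplex3"
  shows "fill a b c y \<in> M"
proof -
  obtain y0 y1 y2 y3 where y: "y = (y0, y1, y2, y3)" by (metis prod_cases4)
  show ?thesis
    using assms by (auto simp: y fill_def simplex3_def simplex2_def image_subset_iff min_def)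
qed

lemma fill_continuous:
  fixes a b c :: "real \<times> real \<times> real \<Rightarrow> 'a::topological_space"
  assumes "continuous_on simplex2 a" "continuous_on simplex2 b" "continuous_on simplex2 c" "matching a b c"
  shows "continuous_on simplex3 (fill a b c)"
proof -
  have "continuous_on ({0..1::real} \<times> simplex3) (\<lambda>p. fill a b c (snd p))"
    by (rule continuous_fill[of "\<lambda>_. a" "\<lambda>_. b" "\<lambda>_. c"]) (auto intro!: continuous_on_compose2[OF assms(1)] continuous_on_compose2[OF assms(2)]
        continuous_on_compose2[OF assms(3)] continuous_intros assms(4))
  then have "continuous_on simplex3 (\<lambda>y. fill a b c (snd (0::real, y)))"
    by (rule continuous_on_compose2) (auto intro!: continuous_intros)
  then show ?thesis by simp
qed

lemma glue_class:
  assumes "a' \<in> triangle_class M a" "b' \<in> triangle_class M b" "c' \<in> triangle_class M c" "matching a b c"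
  shows "glue a' b' c' \<in> triangle_class M (glue a b c)"
proof -
  obtain ha where ha: "continuous_on ({0..1} \<times> simplex2) ha" "ha ` ({0..1} \<times> simplex2) \<subseteq> M"
    "\<And>x. x \<in> simplex2 \<Longrightarrow> ha (0::real, x) = a x" "\<And>x. x \<in> simplex2 \<Longrightarrow> ha (1, x) = a' x"
    "\<And>t x. \<lbrakk>t \<in> {0..1}; x \<in> simplex2_boundary\<rbrakk> \<Longrightarrow> ha (t, x) = a x"
    by (rule triangle_class_E[OF assms(1)]) (rule that)
  obtain hb where hb: "continuous_on ({0..1} \<times> simplex2) hb" "hb ` ({0..1} \<times> simplex2) \<subseteq> M"
    "\<And>x. x \<in> simplex2 \<Longrightarrow> hb (0::real, x) = b x" "\<And>x. x \<in> simplex2 \<Longrightarrow> hb (1, x) = b' x"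
    "\<And>t x. \<lbrakk>t \<in> {0..1}; x \<in> simplex2_boundary\<rbrakk> \<Longrightarrow> hb (t, x) = b x"
    by (rule triangle_class_E[OF assms(2)]) (rule that)
  obtain hc where hc: "continuous_on ({0..1} \<times> simplex2) hc" "hc ` ({0..1} \<times> simplex2) \<subseteq> M"
    "\<And>x. x \<in> simplex2 \<Longrightarrow> hc (0::real, x) = c x" "\<And>x. x \<in> simplex2 \<Longrightarrow> hc (1, x) = c' x"
    "\<And>t x. \<lbrakk>t \<in> {0..1}; x \<in> simplex2_boundary\<rbrakk> \<Longrightarrow> hc (t, x) = c x"
    by (rule triangle_class_E[OF assms(3)]) (rule that)
  let ?F = "\<lambda>p. fill (\<lambda>x. ha (fst p, x)) (\<lambda>x. hb (fst p, x)) (\<lambda>x. hc (fst p, x)) (snd p)"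
  have mt: "matching (\<lambda>x. ha (t, x)) (\<lambda>x. hb (t, x)) (\<lambda>x. hc (t, x))" if "t \<in> {0..1}" for t
    using assms(4) ha(5) hb(5) hc(5) that by (auto simp: matching_def simplex2_boundary_def simplex2_def)
  have F: "continuous_on ({0..1} \<times> simplex3) ?F"
    by (rule continuous_fill) (use ha(1) hb(1) hc(1) mt in auto)
  have FM: "?F (t, y) \<in> M" if "t \<in> {0..1}" "y \<in> simplex3" for t y
    using that ha(2) hb(2) hc(2) unfolding fst_conv snd_conv by (intro fill_image) auto
  have cong: "fill f g h y = fill f' g' h' y"
    if "y \<in> simplex3" "\<And>x. x \<in> simplex2 \<Longrightarrow> f x = f' x" "\<And>x. x \<in> simplex2 \<Longrightarrow> g x = g' x" "\<And>x. x \<in> simplex2 \<Longrightarrow> h x = h' x"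
    for f g h f' g' h' y
    using that by (cases y) (auto simp: fill_def simplex3_def simplex2_def min_def)
  have in3: "(0, x) \<in> simplex3" if "x \<in> simplex2" for x
    using that by (cases x) (auto simp: simplex2_def simplex3_def)
  have glue: "glue f g h x = fill f g h (0, x)" for f g h x
    by (cases x) (simp add: glue_def)
  show ?thesis
  proof (rule triangle_class_I[where h = "\<lambda>p. ?F (fst p, (0, snd p))"])
    show "continuous_on ({0..1} \<times> simplex2) (\<lambda>p. ?F (fst p, (0, snd p)))"
      by (rule continuous_on_compose2[OF F]) (auto intro!: continuous_intros in3)
    show "(\<lambda>p. ?F (fst p, (0, snd p))) ` ({0..1} \<times> simplex2) \<subseteq> M"
      using FM in3 by auto
    fix x assume x: "x \<in> simplex2"
    show "?F (fst (0, x), (0, snd (0, x))) = glue a b c x" "?F (fst (1, x), (0, snd (1, x))) = glue a' b' c' x"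
      using ha hb hc in3[OF x] by (auto simp: glue intro!: cong)
  next
    fix t :: real and x assume t: "0 \<le> t" "t \<le> 1" and x: "x \<in> simplex2_boundary"
    obtain x0 x1 x2 where xx: "x = (x0, x1, x2)" by (metis prod_cases3)
    show "?F (fst (t, x), (0, snd (t, x))) = glue a b c x"
      using x t ha(5) hb(5) hc(5)
      by (auto simp: xx glue fill_def simplex2_boundary_def simplex2_def min_def)
  qed
qed

text \<open>The fourth face is pushed along straight lines inside the tetrahedron onto the other
  three. Its boundary does not move, as there one of the coordinates is 0 already.\<close>

lemma face_glue:
  assumes "continuous_on simplex3 \<omega>" "\<omega> ` simplex3 \<subseteq> M"
  shows "glue (face \<omega> 1 2 0) (face \<omega> 0 2 3) (face \<omega> 1 0 3) \<in> triangle_class M (face \<omega> 1 2 3)"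
proof -
  let ?\<mu> = "\<lambda>x. min (fst x) (min (fst (snd x)) (snd (snd x)))"
  let ?f = "\<lambda>x::real \<times> real \<times> real. (0, fst x, fst (snd x), snd (snd x))"
  \<comment> \<open>The point of the horn reached from \<open>?f x\<close> in direction (3, -1, -1,
    -1): the step length is the smallest coordinate, which becomes 0.\<close>
  let ?g = "\<lambda>x::real \<times> real \<times> real. (3 * ?\<mu> x, fst x - ?\<mu> x, fst (snd x) - ?\<mu> x, snd (snd x) - ?\<mu> x)"
  have "(\<lambda>x. \<omega> (?g x)) \<in> triangle_class M (\<lambda>x. \<omega> (?f x))"
  proof (rule triangle_class_linear[OF assms convex_simplex3])
    show "continuous_on simplex2 ?f" "continuous_on simplex2 ?g"
      by (intro continuous_intros)+
    show "?f ` simplex2 \<subseteq> simplex3" "?g ` simplex2 \<subseteq> simplex3"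
      by (auto simp: simplex2_def simplex3_def)
    fix t :: real and x assume "x \<in> simplex2_boundary"
    then have "?\<mu> x = 0"
      by (cases x) (auto simp: simplex2_boundary_def simplex2_def min_def)
    then show "\<omega> ((1 - t) *\<^sub>R ?f x + t *\<^sub>R ?g x) = \<omega> (?f x)"
      by (simp add: algebra_simps)
  qed
  moreover have "(\<lambda>x. \<omega> (?f x)) = face \<omega> 1 2 3"
    by (auto simp: face_eq)
  moreover have "(\<lambda>x. \<omega> (?g x)) = glue (face \<omega> 1 2 0) (face \<omega> 0 2 3) (face \<omega> 1 0 3)"
    by (auto simp: glue_def fill_def min_def fun_eq_iff intro!: arg_cong[where f = \<omega>])
  ultimately show ?thesis by simp
qed

section \<open>The operations on classes of triangles\<close>

definition m_class :: "'a::topological_space set \<Rightarrow> (real \<times> real \<times> real \<Rightarrow> 'a) set \<Rightarrow>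
    (real \<times> real \<times> real \<Rightarrow> 'a) set \<Rightarrow> (real \<times> real \<times> real \<Rightarrow> 'a) set \<Rightarrow> (real \<times> real \<times> real \<Rightarrow> 'a) set" where
  "m_class M A B C = (THE D. \<exists>\<omega>. continuous_on simplex3 \<omega> \<and> \<omega> ` simplex3 \<subseteq> M \<and>
         face \<omega> 1 2 0 \<in> A \<and> face \<omega> 0 2 3 \<in> B \<and> face \<omega> 1 0 3 \<in> C \<and>
         D = triangle_class M (face \<omega> 1 2 3))"

definition rotate :: "(real \<times> real \<times> real \<Rightarrow> 'a) \<Rightarrow> real \<times> real \<times> real \<Rightarrow> 'a" where
  "rotate a = (\<lambda>(x0, x1, x2). a (x2, x0, x1))"

definition swap :: "(real \<times> real \<times> real \<Rightarrow> 'a) \<Rightarrow> real \<times> real \<times> real \<Rightarrow> 'a" where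
  "swap a = (\<lambda>(x0, x1, x2). a (x1, x0, x2))"

definition P_class :: "'a::topological_space set \<Rightarrow> (real \<times> real \<times> real \<Rightarrow> 'a) set \<Rightarrow> (real \<times> real \<times> real \<Rightarrow> 'a) set" where
  "P_class M A = (\<Union>a\<in>A. triangle_class M (rotate a))"

definition Q_class :: "'a::topological_space set \<Rightarrow> (real \<times> real \<times> real \<Rightarrow> 'a) set \<Rightarrow> (real \<times> real \<times> real \<Rightarrow> 'a) set" where
  "Q_class M A = (\<Union>a\<in>A. triangle_class M (swap a))"

lemma rotate_simps [simp]: "rotate a (x0, x1, x2) = a (x2, x0, x1)"
  and swap_simps [simp]: "swap a (x0, x1, x2) = a (x1, x0, x2)"
  by (simp_all add: rotate_def swap_def)

lemma triangle_class_permute: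
  assumes "b \<in> triangle_class M a"
    and p: "continuous_on simplex2 p" "p ` simplex2 \<subseteq> simplex2" "p ` simplex2_boundary \<subseteq> simplex2_boundary"
  shows "(\<lambda>x. b (p x)) \<in> triangle_class M (\<lambda>x. a (p x))"
proof -
  obtain h where h: "continuous_on ({0..1} \<times> simplex2) h" "h ` ({0..1} \<times> simplex2) \<subseteq> M"
    "\<And>x. x \<in> simplex2 \<Longrightarrow> h (0::real, x) = a x" "\<And>x. x \<in> simplex2 \<Longrightarrow> h (1, x) = b x"
    "\<And>t x. \<lbrakk>t \<in> {0..1}; x \<in> simplex2_boundary\<rbrakk> \<Longrightarrow> h (t, x) = a x"
    by (rule triangle_class_E[OF assms(1)]) (rule that)
  show ?thesis
  proof (rule triangle_class_I[where h = "\<lambda>q. h (fst q, p (snd q))"])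
    show "continuous_on ({0..1} \<times> simplex2) (\<lambda>q. h (fst q, p (snd q)))"
      by (rule continuous_on_compose2[OF h(1)]) 
        (use p(2) in \<open>auto intro!: continuous_intros continuous_on_compose2[OF p(1)]\<close>)
  qed (use h(2-5) p(2,3) in \<open>auto simp: image_subset_iff\<close>)
qed

lemma rotate_class: "b \<in> triangle_class M a \<Longrightarrow> rotate b \<in> triangle_class M (rotate a)"
  unfolding rotate_def case_prod_beta
  by (rule triangle_class_permute) (auto intro!: continuous_intros simp: simplex2_def simplex2_boundary_def)

lemma swap_class: "b \<in> triangle_class M a \<Longrightarrow> swap b \<in> triangle_class M (swap a)"
  unfolding swap_def case_prod_beta
  by (rule triangle_class_permute) (auto intro!: continuous_intros simp: simplex2_def simplex2_boundary_def)

lemma P_class_eq: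
  assumes "continuous_on simplex2 a" "a ` simplex2 \<subseteq> M"
  shows "P_class M (triangle_class M a) = triangle_class M (rotate a)"
  unfolding P_class_def using triangle_class_eq[OF rotate_class] triangle_class_refl[OF assms] by blast

lemma Q_class_eq:
  assumes "continuous_on simplex2 a" "a ` simplex2 \<subseteq> M"
  shows "Q_class M (triangle_class M a) = triangle_class M (swap a)"
  unfolding Q_class_def using triangle_class_eq[OF swap_class] triangle_class_refl[OF assms] by blast

text \<open>All vertices of a triangle go to \<open>m0\<close>; the labels only record which path
  belongs to an edge, \<open>L u v\<close> running from the vertex labelled \<open>u\<close> to the
  one labelled \<open>v\<close>. The geometry thus stays free of computations in the fundamental
  group.\<close>

locale triangle_space =
  fixes M :: "'a::topological_space set" and m0 :: 'a and U :: "'g set" and L :: "'g \<Rightarrow> 'g \<Rightarrow> real \<Rightarrow> 'a"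
  assumes L_cont: "\<lbrakk>u \<in> U; v \<in> U\<rbrakk> \<Longrightarrow> continuous_on {0..1} (L u v)"
    and L_image: "\<lbrakk>u \<in> U; v \<in> U\<rbrakk> \<Longrightarrow> L u v ` {0..1} \<subseteq> M"
    and L_reverse: "\<lbrakk>u \<in> U; v \<in> U; 0 \<le> t; t \<le> 1\<rbrakk> \<Longrightarrow> L u v (1 - t) = L v u t"
    and L_end: "\<lbrakk>u \<in> U; v \<in> U\<rbrakk> \<Longrightarrow> L u v 1 = m0"
    and L_same: "\<lbrakk>u \<in> U; 0 \<le> t; t \<le> 1\<rbrakk> \<Longrightarrow> L u u t = m0"
begin

definition Tri :: "'g \<Rightarrow> 'g \<Rightarrow> 'g \<Rightarrow> (real \<times> real \<times> real \<Rightarrow> 'a) set" where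
  "Tri u v w = {a. u \<in> U \<and> v \<in> U \<and> w \<in> U \<and> continuous_on simplex2 a \<and> a ` simplex2 \<subseteq> M \<and>
     (\<forall>p q. 0 \<le> p \<and> 0 \<le> q \<and> p + q = 1 \<longrightarrow>
        a (p, q, 0) = L v u p \<and> a (0, p, q) = L w v p \<and> a (p, 0, q) = L w u p)}"

definition Cell :: "'g \<Rightarrow> 'g \<Rightarrow> 'g \<Rightarrow> (real \<times> real \<times> real \<Rightarrow> 'a) set set" where
  "Cell u v w = triangle_class M ` Tri u v w"

definition degenerate :: "'g \<Rightarrow> 'g \<Rightarrow> real \<times> real \<times> real \<Rightarrow> 'a" where
  "degenerate u w = (\<lambda>(x0, x1, x2). L w u (1 - x2))"

lemma degenerate_simps [simp]: "degenerate u w (x0, x1, x2) = L w u (1 - x2)"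
  by (simp add: degenerate_def)

lemma TriD:
  assumes "a \<in> Tri u v w"
  shows "u \<in> U" "v \<in> U" "w \<in> U" "continuous_on simplex2 a" "a ` simplex2 \<subseteq> M"
    and "\<lbrakk>0 \<le> p; 0 \<le> q; p + q = 1\<rbrakk> \<Longrightarrow> a (p, q, 0) = L v u p"
    and "\<lbrakk>0 \<le> p; 0 \<le> q; p + q = 1\<rbrakk> \<Longrightarrow> a (0, p, q) = L w v p"
    and "\<lbrakk>0 \<le> p; 0 \<le> q; p + q = 1\<rbrakk> \<Longrightarrow> a (p, 0, q) = L w u p"
  using assms unfolding Tri_def by blast+

lemma TriI:
  assumes "u \<in> U" "v \<in> U" "w \<in> U" "continuous_on simplex2 a" "a ` simplex2 \<subseteq> M"
    and "\<And>p q. \<lbrakk>0 \<le> p; 0 \<le> q; p + q = 1\<rbrakk> \<Longrightarrow> a (p, q, 0) = L v u p"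
    and "\<And>p q. \<lbrakk>0 \<le> p; 0 \<le> q; p + q = 1\<rbrakk> \<Longrightarrow> a (0, p, q) = L w v p"
    and "\<And>p q. \<lbrakk>0 \<le> p; 0 \<le> q; p + q = 1\<rbrakk> \<Longrightarrow> a (p, 0, q) = L w u p"
  shows "a \<in> Tri u v w"
  unfolding Tri_def using assms by blast

lemma Tri_reverse: "\<lbrakk>u \<in> U; v \<in> U; 0 \<le> p; 0 \<le> q; p + q = 1\<rbrakk> \<Longrightarrow> L u v p = L v u q"
  using L_reverse[of u v q] by (metis add_diff_cancel_right' le_add_same_cancel2)

lemma Tri_class_refl: "a \<in> Tri u v w \<Longrightarrow> a \<in> triangle_class M a"
  by (rule triangle_class_refl) (rule TriD(4,5), assumption)+

lemma Tri_class:
  assumes "a \<in> Tri u v w" "b \<in> triangle_class M a"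
  shows "b \<in> Tri u v w"
proof -
  have bd: "(p, q, 0) \<in> simplex2_boundary" "(0, p, q) \<in> simplex2_boundary" "(p, 0, q) \<in> simplex2_boundary"
    if "0 \<le> p" "0 \<le> q" "p + q = 1" for p q :: real
    using that by (auto simp: simplex2_boundary_def simplex2_def)
  note e = triangle_class_boundary[OF assms(2)]
  show ?thesis
  proof (rule TriI)
    fix p q :: real assume pq: "0 \<le> p" "0 \<le> q" "p + q = 1"
    show "b (p, q, 0) = L v u p" "b (0, p, q) = L w v p" "b (p, 0, q) = L w u p"
      using TriD(6-8)[OF assms(1) pq] e[OF bd(1)[OF pq]] e[OF bd(2)[OF pq]] e[OF bd(3)[OF pq]] by simp_all
  qed (rule TriD[OF assms(1)] triangle_class_imp_continuous[OF assms(2)])+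
qed

lemma Tri_matching:
  assumes "a \<in> Tri u v x" "b \<in> Tri x v w" "c \<in> Tri u x w"
  shows "matching a b c"
  unfolding matching_def
proof (intro allI impI)
  fix p q :: real assume pq: "0 \<le> p \<and> 0 \<le> q \<and> p + q = 1"
  then have qp: "0 \<le> q" "0 \<le> p" "q + p = 1" by auto
  show "a (p, 0, q) = c (p, q, 0) \<and> a (0, p, q) = b (q, p, 0) \<and> b (q, 0, p) = c (0, q, p)"
    using pq TriD(8)[OF assms(1), of p q] TriD(6)[OF assms(3), of p q] TriD(7)[OF assms(1), of p q]
      TriD(6)[OF assms(2) qp] TriD(8)[OF assms(2) qp] TriD(7)[OF assms(3) qp]
      Tri_reverse[OF TriD(1,2)[OF assms(2)], of p q] by simp
qed

lemma Tri_fill: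
  assumes "a \<in> Tri u v x" "b \<in> Tri x v w" "c \<in> Tri u x w"
  shows "continuous_on simplex3 (fill a b c)" "fill a b c ` simplex3 \<subseteq> M"
  using fill_continuous[OF TriD(4)[OF assms(1)] TriD(4)[OF assms(2)] TriD(4)[OF assms(3)] Tri_matching[OF assms]]
    fill_image[OF TriD(5)[OF assms(1)] TriD(5)[OF assms(2)] TriD(5)[OF assms(3)]] by auto

lemma Tri_face:
  assumes "continuous_on simplex3 \<omega>" "\<omega> ` simplex3 \<subseteq> M"
    and "face \<omega> 1 2 0 \<in> Tri u v x" "face \<omega> 0 2 3 \<in> Tri x v w" "face \<omega> 1 0 3 \<in> Tri u x w"
  shows "face \<omega> 1 2 3 \<in> Tri u v w"
proof (rule TriI)
  fix p q :: real assume pq: "0 \<le> p" "0 \<le> q" "p + q = 1"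
  show "face \<omega> 1 2 3 (p, q, 0) = L v u p" "face \<omega> 1 2 3 (0, p, q) = L w v p" "face \<omega> 1 2 3 (p, 0, q) = L w u p"
    using TriD(6)[OF assms(3) pq] TriD(7)[OF assms(4) pq] TriD(8)[OF assms(5) pq] by simp_all
qed (use TriD(1,2,3)[OF assms(3)] TriD(3)[OF assms(4)] continuous_on_face(4)[OF assms(1)] face_image(4)[OF assms(2)] in auto)

lemma Tri_cong:
  assumes "a \<in> Tri u v w" "\<And>x. x \<in> simplex2 \<Longrightarrow> a x = b x"
  shows "b \<in> Tri u v w" "triangle_class M b = triangle_class M a"
proof -
  have *: "b \<in> triangle_class M a"
    by (rule triangle_class_cong[OF TriD(4,5)[OF assms(1)] assms(2)])
  show "b \<in> Tri u v w" "triangle_class M b = triangle_class M a"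
    using Tri_class[OF assms(1) *] triangle_class_eq[OF *] by auto
qed

lemma fill_faces_Tri:
  assumes "a \<in> Tri u v x" "b \<in> Tri x v w" "c \<in> Tri u x w"
  shows "face (fill a b c) 1 2 0 \<in> Tri u v x" "face (fill a b c) 0 2 3 \<in> Tri x v w"
    "face (fill a b c) 1 0 3 \<in> Tri u x w"
    "triangle_class M (face (fill a b c) 1 2 0) = triangle_class M a"
    "triangle_class M (face (fill a b c) 0 2 3) = triangle_class M b"
    "triangle_class M (face (fill a b c) 1 0 3) = triangle_class M c"
  using Tri_cong[OF assms(1), of "face (fill a b c) 1 2 0"] Tri_cong[OF assms(2), of "face (fill a b c) 0 2 3"]
    Tri_cong[OF assms(3), of "face (fill a b c) 1 0 3"] fill_faces[OF Tri_matching[OF assms]] by auto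

lemma glue_Tri:
  assumes "a \<in> Tri u v x" "b \<in> Tri x v w" "c \<in> Tri u x w"
  shows "glue a b c \<in> Tri u v w"
  unfolding glue_def using Tri_face[OF Tri_fill[OF assms]] fill_faces_Tri[OF assms] by blast

text \<open>\<open>fill\<close> provides one tetrahedron for the description. For any other,
  \<open>face_glue\<close> replaces the fourth face by the gluing of its three other faces, whose
  class depends on their classes only.\<close>

lemma m_class_eq:
  assumes "a \<in> Tri u v x" "b \<in> Tri x v w" "c \<in> Tri u x w"
  shows "m_class M (triangle_class M a) (triangle_class M b) (triangle_class M c) = triangle_class M (glue a b c)"
  unfolding m_class_def
proof (rule the_equality)
  show "\<exists>\<omega>. continuous_on simplex3 \<omega> \<and> \<omega> ` simplex3 \<subseteq> M \<and>
         face \<omega> 1 2 0 \<in> triangle_class M a \<and> face \<omega> 0 2 3 \<in> triangle_class M b \<and>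
         face \<omega> 1 0 3 \<in> triangle_class M c \<and> triangle_class M (glue a b c) = triangle_class M (face \<omega> 1 2 3)"
    using Tri_fill[OF assms] fill_faces_Tri[OF assms] Tri_class_refl
    by (intro exI[of _ "fill a b c"]) (auto simp: glue_def)
next
  fix D assume "\<exists>\<omega>. continuous_on simplex3 \<omega> \<and> \<omega> ` simplex3 \<subseteq> M \<and>
         face \<omega> 1 2 0 \<in> triangle_class M a \<and> face \<omega> 0 2 3 \<in> triangle_class M b \<and>
         face \<omega> 1 0 3 \<in> triangle_class M c \<and> D = triangle_class M (face \<omega> 1 2 3)"
  then obtain \<omega> where \<omega>: "continuous_on simplex3 \<omega>" "\<omega> ` simplex3 \<subseteq> M"
    "face \<omega> 1 2 0 \<in> triangle_class M a" "face \<omega> 0 2 3 \<in> triangle_class M b"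
    "face \<omega> 1 0 3 \<in> triangle_class M c" "D = triangle_class M (face \<omega> 1 2 3)" by (elim exE conjE) (rule that)
  have "triangle_class M (glue (face \<omega> 1 2 0) (face \<omega> 0 2 3) (face \<omega> 1 0 3)) = triangle_class M (glue a b c)"
    by (rule triangle_class_eq[OF glue_class[OF \<omega>(3-5) Tri_matching[OF assms]]])
  then show "D = triangle_class M (glue a b c)"
    using triangle_class_eq[OF face_glue[OF \<omega>(1,2)]] \<omega>(6) by simp
qed

text \<open>A singular tetrahedron is exactly an instance of \<open>m\<close>, so each identity for \<open>m\<close> is
  obtained by exhibiting one tetrahedron.\<close>

lemma m_class_face:
  assumes \<omega>: "continuous_on simplex3 \<omega>" "\<omega> ` simplex3 \<subseteq> M"
    and abc: "a \<in> Tri u v x" "b \<in> Tri x v w" "c \<in> Tri u x w"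
    and "\<And>x0 x1 x2. \<lbrakk>0 \<le> x0; 0 \<le> x1; 0 \<le> x2; x0 + x1 + x2 = 1\<rbrakk> \<Longrightarrow> \<omega> (x2, x0, x1, 0) = a (x0, x1, x2)"
    and "\<And>x0 x1 x2. \<lbrakk>0 \<le> x0; 0 \<le> x1; 0 \<le> x2; x0 + x1 + x2 = 1\<rbrakk> \<Longrightarrow> \<omega> (x0, 0, x1, x2) = b (x0, x1, x2)"
    and "\<And>x0 x1 x2. \<lbrakk>0 \<le> x0; 0 \<le> x1; 0 \<le> x2; x0 + x1 + x2 = 1\<rbrakk> \<Longrightarrow> \<omega> (x1, x0, 0, x2) = c (x0, x1, x2)"
    and f: "\<And>x0 x1 x2. \<lbrakk>0 \<le> x0; 0 \<le> x1; 0 \<le> x2; x0 + x1 + x2 = 1\<rbrakk> \<Longrightarrow> \<omega> (0, x0, x1, x2) = f (x0, x1, x2)"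
  shows "m_class M (triangle_class M a) (triangle_class M b) (triangle_class M c) = triangle_class M f"
proof -
  have A: "a x = face \<omega> 1 2 0 x" and B: "b x = face \<omega> 0 2 3 x" and C: "c x = face \<omega> 1 0 3 x"
    and F: "face \<omega> 1 2 3 x = f x" if "x \<in> simplex2" for x
    using assms(6-9)[of "fst x" "fst (snd x)" "snd (snd x)"] that by (cases x; simp add: simplex2_def)+
  note A' = Tri_cong[OF abc(1) A] and B' = Tri_cong[OF abc(2) B] and C' = Tri_cong[OF abc(3) C]
  have "m_class M (triangle_class M a) (triangle_class M b) (triangle_class M c) =
     triangle_class M (glue (face \<omega> 1 2 0) (face \<omega> 0 2 3) (face \<omega> 1 0 3))"
    using m_class_eq[OF A'(1) B'(1) C'(1)] A'(2) B'(2) C'(2) by simp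
  also have "\<dots> = triangle_class M (face \<omega> 1 2 3)"
    by (rule triangle_class_eq[OF face_glue[OF \<omega>]])
  also have "\<dots> = triangle_class M f"
    by (rule Tri_cong(2)[OF Tri_face[OF \<omega> A'(1) B'(1) C'(1)] F, symmetric])
  finally show ?thesis .
qed

section \<open>Tetrahedra realising the laws of the calculus\<close>

lemma rotate_Tri: assumes "a \<in> Tri u v w" shows "rotate a \<in> Tri v w u"
proof (rule TriI)
  show "continuous_on simplex2 (rotate a)"
    unfolding rotate_def case_prod_beta
    by (rule continuous_on_compose2[OF TriD(4)[OF assms]]) (auto intro!: continuous_intros simp: simplex2_def)
  show "rotate a ` simplex2 \<subseteq> M"
    using TriD(5)[OF assms] by (auto simp: simplex2_def image_subset_iff)
  fix p q :: real assume pq: "0 \<le> p" "0 \<le> q" "p + q = 1"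
  then have qp: "0 \<le> q" "0 \<le> p" "q + p = 1" by auto
  note U = TriD(1-3)[OF assms]
  show "rotate a (p, q, 0) = L w v p" "rotate a (0, p, q) = L u w p" "rotate a (p, 0, q) = L u v p"
    using TriD(7)[OF assms pq] TriD(8)[OF assms qp] TriD(6)[OF assms qp] U
      Tri_reverse[OF U(1,3) pq] Tri_reverse[OF U(1,2) pq] by simp_all
qed (use TriD(1-3)[OF assms] in auto)

lemma swap_Tri: assumes "a \<in> Tri u v w" shows "swap a \<in> Tri v u w"
proof (rule TriI)
  show "continuous_on simplex2 (swap a)"
    unfolding swap_def case_prod_beta
    by (rule continuous_on_compose2[OF TriD(4)[OF assms]]) (auto intro!: continuous_intros simp: simplex2_def)
  show "swap a ` simplex2 \<subseteq> M"
    using TriD(5)[OF assms] by (auto simp: simplex2_def image_subset_iff)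
  fix p q :: real assume pq: "0 \<le> p" "0 \<le> q" "p + q = 1"
  then have qp: "0 \<le> q" "0 \<le> p" "q + p = 1" by auto
  note U = TriD(1-3)[OF assms]
  show "swap a (p, q, 0) = L u v p" "swap a (0, p, q) = L w u p" "swap a (p, 0, q) = L w v p"
    using TriD(6)[OF assms qp] TriD(8)[OF assms pq] TriD(7)[OF assms pq] U
      Tri_reverse[OF U(1,2) pq] by simp_all
qed (use TriD(1-3)[OF assms] in auto)

lemma P_class_Tri: "a \<in> Tri u v w \<Longrightarrow> P_class M (triangle_class M a) = triangle_class M (rotate a)"
  by (rule P_class_eq) (rule TriD(4,5), assumption)+

lemma Q_class_Tri: "a \<in> Tri u v w \<Longrightarrow> Q_class M (triangle_class M a) = triangle_class M (swap a)"
  by (rule Q_class_eq) (rule TriD(4,5), assumption)+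

lemma degenerate_Tri:
  assumes "u \<in> U" "w \<in> U"
  shows "degenerate u w \<in> Tri u u w"
proof (rule TriI)
  show "continuous_on simplex2 (degenerate u w)"
    unfolding degenerate_def case_prod_beta
    by (rule continuous_on_compose2[OF L_cont[OF assms(2,1)]]) (auto intro!: continuous_intros simp: simplex2_def)
  show "degenerate u w ` simplex2 \<subseteq> M"
    using L_image[OF assms(2,1)] by (auto simp: simplex2_def image_subset_iff)
  fix p q :: real assume pq: "0 \<le> p" "0 \<le> q" "p + q = 1"
  then have "1 - q = p" "p \<le> 1" by auto
  then show "degenerate u w (p, q, 0) = L u u p" "degenerate u w (0, p, q) = L w u p" "degenerate u w (p, 0, q) = L w u p"
    using L_end[OF assms(2,1)] L_same[OF assms(1) pq(1)] by simp_all
qed (use assms in auto)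

text \<open>The same tetrahedron serves both sides. Rotating its vertices 1, 2, 3 permutes the three
  faces at the vertex 0 and rotates the fourth; in \<open>Tri_m_swap\<close> the vertices 1 and 2
  are exchanged instead.\<close>

lemma Tri_m_rotate:
  assumes "a \<in> Tri u v x" "b \<in> Tri x v w" "c \<in> Tri u x w"
  shows "m_class M (triangle_class M (rotate b)) (triangle_class M (rotate c)) (triangle_class M (rotate a)) =
    triangle_class M (rotate (glue a b c))"
proof -
  let ?\<omega> = "\<lambda>y. fill a b c (fst y, snd (snd (snd y)), fst (snd y), fst (snd (snd y)))"
  show ?thesis
  proof (rule m_class_face[where \<omega> = ?\<omega>])
    show "continuous_on simplex3 ?\<omega>"
      by (rule continuous_on_compose2[OF Tri_fill(1)[OF assms]]) (auto intro!: continuous_intros simp: simplex3_def)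
    show "?\<omega> ` simplex3 \<subseteq> M"
      using Tri_fill(2)[OF assms] by (auto simp: simplex3_def image_subset_iff)
    show "rotate b \<in> Tri v w x" "rotate c \<in> Tri x w u" "rotate a \<in> Tri v x u"
      using assms rotate_Tri by blast+
    fix x0 x1 x2 :: real assume x: "0 \<le> x0" "0 \<le> x1" "0 \<le> x2" "x0 + x1 + x2 = 1"
    have in2: "(x2, x0, x1) \<in> simplex2" using x by (simp add: simplex2_def)
    note F = fill_faces[OF Tri_matching[OF assms] in2, simplified]
    show "?\<omega> (x2, x0, x1, 0) = rotate b (x0, x1, x2)"
      using F(2) by simp
    show "?\<omega> (x0, 0, x1, x2) = rotate c (x0, x1, x2)"
      using F(3) by simp
    show "?\<omega> (x1, x0, 0, x2) = rotate a (x0, x1, x2)"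
      using F(1) by simp
  qed (simp add: glue_def)
qed

lemma Tri_m_swap:
  assumes "a \<in> Tri u v x" "b \<in> Tri x v w" "c \<in> Tri u x w"
  shows "m_class M (triangle_class M (swap a)) (triangle_class M (swap c)) (triangle_class M (swap b)) =
    triangle_class M (swap (glue a b c))"
proof -
  let ?\<omega> = "\<lambda>y. fill a b c (fst y, fst (snd (snd y)), fst (snd y), snd (snd (snd y)))"
  show ?thesis
  proof (rule m_class_face[where \<omega> = ?\<omega>])
    show "continuous_on simplex3 ?\<omega>"
      by (rule continuous_on_compose2[OF Tri_fill(1)[OF assms]]) (auto intro!: continuous_intros simp: simplex3_def)
    show "?\<omega> ` simplex3 \<subseteq> M"
      using Tri_fill(2)[OF assms] by (auto simp: simplex3_def image_subset_iff)
    show "swap a \<in> Tri v u x" "swap c \<in> Tri x u w" "swap b \<in> Tri v x w"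
      using assms swap_Tri by blast+
    fix x0 x1 x2 :: real assume x: "0 \<le> x0" "0 \<le> x1" "0 \<le> x2" "x0 + x1 + x2 = 1"
    have in2: "(x1, x0, x2) \<in> simplex2" using x by (simp add: simplex2_def)
    note F = fill_faces[OF Tri_matching[OF assms] in2, simplified]
    show "?\<omega> (x2, x0, x1, 0) = swap a (x0, x1, x2)"
      using F(1) by simp
    show "?\<omega> (x0, 0, x1, x2) = swap c (x0, x1, x2)"
      using F(3) by simp
    show "?\<omega> (x1, x0, 0, x2) = swap b (x0, x1, x2)"
      using F(2) by simp
  qed (simp add: glue_def)
qed

text \<open>Exchanging the vertices 0 and 3 of the filled tetrahedron makes the glued face one of
  the three given ones and \<open>f\<close> the face opposite to the vertex 0; the faces of
  \<open>a\<close> and \<open>b\<close> are reflected.\<close>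

lemma Tri_m_cancel:
  assumes "f \<in> Tri u v x" "a \<in> Tri x v w" "b \<in> Tri u x w"
  shows "m_class M (triangle_class M (glue f a b)) (triangle_class M (rotate (rotate (swap a))))
    (triangle_class M (rotate (swap b))) = triangle_class M f"
proof -
  let ?\<omega> = "\<lambda>y. fill f a b (snd (snd (snd y)), fst (snd y), fst (snd (snd y)), fst y)"
  show ?thesis
  proof (rule m_class_face[where \<omega> = ?\<omega>])
    show "continuous_on simplex3 ?\<omega>"
      by (rule continuous_on_compose2[OF Tri_fill(1)[OF assms]]) (auto intro!: continuous_intros simp: simplex3_def)
    show "?\<omega> ` simplex3 \<subseteq> M"
      using Tri_fill(2)[OF assms] by (auto simp: simplex3_def image_subset_iff)
    show "glue f a b \<in> Tri u v w" "rotate (rotate (swap a)) \<in> Tri w v x" "rotate (swap b) \<in> Tri u w x"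
      by (rule glue_Tri[OF assms] rotate_Tri[OF rotate_Tri[OF swap_Tri[OF assms(2)]]] rotate_Tri[OF swap_Tri[OF assms(3)]])+
    fix x0 x1 x2 :: real assume x: "0 \<le> x0" "0 \<le> x1" "0 \<le> x2" "x0 + x1 + x2 = 1"
    have in2: "(x2, x1, x0) \<in> simplex2" "(x0, x2, x1) \<in> simplex2" "(x0, x1, x2) \<in> simplex2"
      using x by (simp_all add: simplex2_def)
    note F = fill_faces[OF Tri_matching[OF assms], simplified]
    show "?\<omega> (x2, x0, x1, 0) = glue f a b (x0, x1, x2)"
      by (simp add: glue_def)
    show "?\<omega> (x0, 0, x1, x2) = rotate (rotate (swap a)) (x0, x1, x2)"
      using F(2)[OF in2(1)] by simp
    show "?\<omega> (x1, x0, 0, x2) = rotate (swap b) (x0, x1, x2)"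
      using F(3)[OF in2(2)] by simp
    show "?\<omega> (0, x0, x1, x2) = f (x0, x1, x2)"
      using F(1)[OF in2(3)] by simp
  qed
qed

text \<open>The tetrahedron is \<open>a\<close> after the simplicial map that sends the vertices 1
  and 2 to 0 and 1, and both 0 and 3 to the vertex 2.\<close>

lemma Tri_m_degenerate:
  assumes "a \<in> Tri u v w"
  shows "m_class M (triangle_class M a) (triangle_class M (rotate (degenerate w v)))
    (triangle_class M (rotate (rotate (degenerate w u)))) = triangle_class M a"
proof -
  let ?\<omega> = "\<lambda>y. a (fst (snd y), fst (snd (snd y)), fst y + snd (snd (snd y)))"
  show ?thesis
  proof (rule m_class_face[where \<omega> = ?\<omega>])
    note U = TriD(1-3)[OF assms]
    show "continuous_on simplex3 ?\<omega>"
      by (rule continuous_on_compose2[OF TriD(4)[OF assms]]) (auto intro!: continuous_intros simp: simplex3_def simplex2_def)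
    show "?\<omega> ` simplex3 \<subseteq> M"
      using TriD(5)[OF assms] by (auto simp: simplex3_def simplex2_def image_subset_iff)
    show "a \<in> Tri u v w" "rotate (degenerate w v) \<in> Tri w v w" "rotate (rotate (degenerate w u)) \<in> Tri u w w"
      by (rule assms rotate_Tri[OF degenerate_Tri[OF U(3,2)]] rotate_Tri[OF rotate_Tri[OF degenerate_Tri[OF U(3,1)]]])+
    fix x0 x1 x2 :: real assume x: "0 \<le> x0" "0 \<le> x1" "0 \<le> x2" "x0 + x1 + x2 = 1"
    have "a (0, x1, x0 + x2) = L w v x1" "a (x0, 0, x1 + x2) = L w u x0"
      using TriD(7)[OF assms, of x1 "x0 + x2"] TriD(8)[OF assms, of x0 "x1 + x2"] x by auto
    moreover have "L v w (1 - x1) = L w v x1" "L u w (1 - x0) = L w u x0"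
      using L_reverse[of v w x1] L_reverse[of u w x0] U x by auto
    ultimately show "?\<omega> (x0, 0, x1, x2) = rotate (degenerate w v) (x0, x1, x2)"
      "?\<omega> (x1, x0, 0, x2) = rotate (rotate (degenerate w u)) (x0, x1, x2)"
      by simp_all
  qed simp_all
qed

end

text \<open>The tetrahedron subdivided at its barycenter; \<open>w i\<close> is placed on the part opposite to the
  vertex \<open>i\<close>, with the barycenter as its vertex \<open>0\<close>, or \<open>3\<close> for \<open>w3\<close>.\<close>

definition subdivide ::
  "(real \<times> real \<times> real \<times> real \<Rightarrow> 'a) \<Rightarrow> (real \<times> real \<times> real \<times> real \<Rightarrow> 'a) \<Rightarrow>
   (real \<times> real \<times> real \<times> real \<Rightarrow> 'a) \<Rightarrow> (real \<times> real \<times> real \<times> real \<Rightarrow> 'a) \<Rightarrow>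
   real \<times> real \<times> real \<times> real \<Rightarrow> 'a" where
  "subdivide w0 w1 w2 w3 = (\<lambda>(y0, y1, y2, y3).
     if y0 \<le> min y1 (min y2 y3) then w0 (4 * y0, y1 - y0, y2 - y0, y3 - y0)
     else if y1 \<le> min y2 y3 then w1 (4 * y1, y0 - y1, y2 - y1, y3 - y1)
     else if y2 \<le> y3 then w2 (4 * y2, y1 - y2, y0 - y2, y3 - y2)
     else w3 (y0 - y3, y1 - y3, y2 - y3, 4 * y3))"

lemma subdivide_image:
  assumes "w0 ` simplex3 \<subseteq> M" "w1 ` simplex3 \<subseteq> M" "w2 ` simplex3 \<subseteq> M" "w3 ` simplex3 \<subseteq> M"
  shows "subdivide w0 w1 w2 w3 ` simplex3 \<subseteq> M"
  using assms by (auto simp: subdivide_def simplex3_def image_subset_iff min_def)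

text \<open>The six equations of the hypothesis are the six inner walls, one for each pair of parts;
  a wall is spanned by the barycenter and the edge opposite to the two vertices that index the
  parts.\<close>

lemma subdivide_continuous:
  fixes w0 w1 w2 w3 :: "real \<times> real \<times> real \<times> real \<Rightarrow> 'a::topological_space"
  assumes w0: "continuous_on simplex3 w0" and w1: "continuous_on simplex3 w1"
    and w2: "continuous_on simplex3 w2" and w3: "continuous_on simplex3 w3"
    and m: "\<And>p q r. \<lbrakk>0 \<le> p; 0 \<le> q; 0 \<le> r; p + q + r = 1\<rbrakk> \<Longrightarrow>
      w0 (p, 0, q, r) = w1 (p, 0, q, r) \<and> w0 (p, q, 0, r) = w2 (p, q, 0, r) \<and> w0 (p, q, r, 0) = w3 (0, q, r, p) \<and>
      w1 (p, q, 0, r) = w2 (p, 0, q, r) \<and> w1 (p, q, r, 0) = w3 (q, 0, r, p) \<and> w2 (p, q, r, 0) = w3 (r, q, 0, p)"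
  shows "continuous_on simplex3 (subdivide w0 w1 w2 w3)"
proof -
  let ?y0 = "\<lambda>p::real \<times> real \<times> real \<times> real. fst p"
  let ?y1 = "\<lambda>p::real \<times> real \<times> real \<times> real. fst (snd p)"
  let ?y2 = "\<lambda>p::real \<times> real \<times> real \<times> real. fst (snd (snd p))"
  let ?y3 = "\<lambda>p::real \<times> real \<times> real \<times> real. snd (snd (snd p))"
  let ?f0 = "\<lambda>p. w0 (4 * ?y0 p, ?y1 p - ?y0 p, ?y2 p - ?y0 p, ?y3 p - ?y0 p)"
  let ?f1 = "\<lambda>p. w1 (4 * ?y1 p, ?y0 p - ?y1 p, ?y2 p - ?y1 p, ?y3 p - ?y1 p)"
  let ?f2 = "\<lambda>p. w2 (4 * ?y2 p, ?y1 p - ?y2 p, ?y0 p - ?y2 p, ?y3 p - ?y2 p)"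
  let ?f3 = "\<lambda>p. w3 (?y0 p - ?y3 p, ?y1 p - ?y3 p, ?y2 p - ?y3 p, 4 * ?y3 p)"
  let ?S1 = "{p \<in> simplex3. 0 \<le> ?y0 p - min (?y1 p) (min (?y2 p) (?y3 p))}"
  let ?S2 = "{p \<in> ?S1. 0 \<le> ?y1 p - min (?y2 p) (?y3 p)}"
  have 1: "continuous_on simplex3 (\<lambda>p. if ?y0 p - min (?y1 p) (min (?y2 p) (?y3 p)) \<le> 0 then ?f0 p
      else if ?y1 p - min (?y2 p) (?y3 p) \<le> 0 then ?f1 p else if ?y2 p - ?y3 p \<le> 0 then ?f2 p else ?f3 p)"
  proof (rule continuous_on_cases_le)
    show "continuous_on {p \<in> simplex3. ?y0 p - min (?y1 p) (min (?y2 p) (?y3 p)) \<le> 0} ?f0"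
      by (rule continuous_on_compose2[OF w0]) (auto intro!: continuous_intros simp: simplex3_def)
    show "continuous_on ?S1 (\<lambda>p. if ?y1 p - min (?y2 p) (?y3 p) \<le> 0 then ?f1 p
      else if ?y2 p - ?y3 p \<le> 0 then ?f2 p else ?f3 p)"
    proof (rule continuous_on_cases_le)
      show "continuous_on {p \<in> ?S1. ?y1 p - min (?y2 p) (?y3 p) \<le> 0} ?f1"
        by (rule continuous_on_compose2[OF w1]) (auto intro!: continuous_intros simp: simplex3_def)
      show "continuous_on ?S2 (\<lambda>p. if ?y2 p - ?y3 p \<le> 0 then ?f2 p else ?f3 p)"
      proof (rule continuous_on_cases_le)
        show "continuous_on {p \<in> ?S2. ?y2 p - ?y3 p \<le> 0} ?f2"
          by (rule continuous_on_compose2[OF w2]) (auto intro!: continuous_intros simp: simplex3_def)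
        show "continuous_on {p \<in> ?S2. 0 \<le> ?y2 p - ?y3 p} ?f3"
          by (rule continuous_on_compose2[OF w3]) (auto intro!: continuous_intros simp: simplex3_def)
        fix p assume p: "p \<in> ?S2" "?y2 p - ?y3 p = 0"
        obtain y0 y1 y2 y3 where q: "p = (y0, y1, y2, y3)" by (metis prod_cases4)
        have "y3 \<le> y0" using p by (simp add: q min_def split: if_splits)
        then show "?f2 p = ?f3 p"
          using p m[of "4 * y3" "y1 - y3" "y0 - y3"] by (simp add: q simplex3_def)
      qed (intro continuous_intros)
      fix p assume p: "p \<in> ?S1" "?y1 p - min (?y2 p) (?y3 p) = 0"
      obtain y0 y1 y2 y3 where q: "p = (y0, y1, y2, y3)" by (metis prod_cases4)
      show "?f1 p = (if ?y2 p - ?y3 p \<le> 0 then ?f2 p else ?f3 p)"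
      proof (cases "y2 \<le> y3")
        case True
        then show ?thesis using p m[of "4 * y2" "y0 - y2" "y3 - y2"] by (simp add: q simplex3_def)
      next
        case False
        then show ?thesis using p m[of "4 * y3" "y0 - y3" "y2 - y3"] by (simp add: q simplex3_def)
      qed
    qed (intro continuous_intros)
    fix p assume p: "p \<in> simplex3" "?y0 p - min (?y1 p) (min (?y2 p) (?y3 p)) = 0"
    obtain y0 y1 y2 y3 where q: "p = (y0, y1, y2, y3)" by (metis prod_cases4)
    show "?f0 p = (if ?y1 p - min (?y2 p) (?y3 p) \<le> 0 then ?f1 p
      else if ?y2 p - ?y3 p \<le> 0 then ?f2 p else ?f3 p)"
    proof (cases "y1 \<le> min y2 y3")
      case True
      then show ?thesis using p m[of "4 * y1" "y2 - y1" "y3 - y1"] by (simp add: q simplex3_def)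
    next
      case F: False
      show ?thesis
      proof (cases "y2 \<le> y3")
        case True
        then show ?thesis using F p m[of "4 * y2" "y1 - y2" "y3 - y2"] by (simp add: q simplex3_def)
      next
        case False
        then show ?thesis using F p m[of "4 * y3" "y1 - y3" "y2 - y3"] by (simp add: q simplex3_def)
      qed
    qed
  qed (intro continuous_intros)
  have 2: "subdivide w0 w1 w2 w3 = (\<lambda>p. if ?y0 p - min (?y1 p) (min (?y2 p) (?y3 p)) \<le> 0 then ?f0 p
      else if ?y1 p - min (?y2 p) (?y3 p) \<le> 0 then ?f1 p else if ?y2 p - ?y3 p \<le> 0 then ?f2 p else ?f3 p)"
    by (rule ext) (auto simp: subdivide_def case_prod_beta)
  show ?thesis unfolding 2 by (rule 1)
qed

lemma subdivide_faces:
  fixes w0 w1 w2 w3 :: "real \<times> real \<times> real \<times> real \<Rightarrow> 'a::topological_space"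
  assumes m: "\<And>p q r. \<lbrakk>0 \<le> p; 0 \<le> q; 0 \<le> r; p + q + r = 1\<rbrakk> \<Longrightarrow>
      w0 (p, 0, q, r) = w1 (p, 0, q, r) \<and> w0 (p, q, 0, r) = w2 (p, q, 0, r) \<and> w0 (p, q, r, 0) = w3 (0, q, r, p) \<and>
      w1 (p, q, 0, r) = w2 (p, 0, q, r) \<and> w1 (p, q, r, 0) = w3 (q, 0, r, p) \<and> w2 (p, q, r, 0) = w3 (r, q, 0, p)"
    and "0 \<le> x0" "0 \<le> x1" "0 \<le> x2" "x0 + x1 + x2 = 1"
  shows "subdivide w0 w1 w2 w3 (0, x0, x1, x2) = w0 (0, x0, x1, x2)"
    "subdivide w0 w1 w2 w3 (x0, 0, x1, x2) = w1 (0, x0, x1, x2)"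
    "subdivide w0 w1 w2 w3 (x1, x0, 0, x2) = w2 (0, x0, x1, x2)"
    "subdivide w0 w1 w2 w3 (x2, x0, x1, 0) = w3 (x2, x0, x1, 0)"
proof -
  show "subdivide w0 w1 w2 w3 (0, x0, x1, x2) = w0 (0, x0, x1, x2)"
    using assms(2-4) by (simp add: subdivide_def)
  show "subdivide w0 w1 w2 w3 (x0, 0, x1, x2) = w1 (0, x0, x1, x2)"
    using assms(2-5) m[of 0 x1 x2] by (cases "x0 = 0") (simp_all add: subdivide_def)
  show "subdivide w0 w1 w2 w3 (x1, x0, 0, x2) = w2 (0, x0, x1, x2)"
    using assms(2-5) m[of 0 x0 x2] m[of 0 x1 x2] by (cases "x1 = 0"; cases "x0 = 0") (simp_all add: subdivide_def)
  show "subdivide w0 w1 w2 w3 (x2, x0, x1, 0) = w3 (x2, x0, x1, 0)"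
    using assms(2-5) m[of 0 x0 x1] m[of 0 x2 x1] m[of 0 x0 x2]
    by (cases "x2 = 0"; cases "x0 = 0"; cases "x1 = 0") (simp_all add: subdivide_def)
qed

context triangle_space
begin

text \<open>The vertices 0, 1, 2, 3 carry \<open>x\<close>, \<open>u\<close>, \<open>v\<close>,
  \<open>w\<close> and the barycenter carries \<open>y\<close>. The parts are the fillings of the
  four other instances of \<open>m\<close>. The part at the face opposite to the vertex 0 rests on
  \<open>glue a b c\<close> as a wall; \<open>g\<close> is the wall between \<open>w1\<close> and
  \<open>w2\<close>, which see it from different sides, whence \<open>swap g\<close>.\<close>

lemma Tri_m_assoc:
  assumes a: "a \<in> Tri u v x" and b: "b \<in> Tri x v y" and c: "c \<in> Tri u x y"
    and e: "e \<in> Tri y v w" and f: "f \<in> Tri u y w" and g: "g \<in> Tri x y w"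
  shows "m_class M (triangle_class M a) (triangle_class M (glue b e g)) (triangle_class M (glue c (swap g) f))
    = triangle_class M (glue (glue a b c) e f)"
proof -
  define w0 where "w0 = fill (glue a b c) e f"
  define w1 where "w1 = fill b e g"
  define w2 where "w2 = fill c (swap g) f"
  define w3 where "w3 = fill a b c"
  note abc = glue_Tri[OF a b c] and sg = swap_Tri[OF g]
  note F0 = fill_faces[OF Tri_matching[OF abc e f], folded w0_def, simplified]
    and F1 = fill_faces[OF Tri_matching[OF b e g], folded w1_def, simplified]
    and F2 = fill_faces[OF Tri_matching[OF c sg f], folded w2_def, simplified]
    and F3 = fill_faces[OF Tri_matching[OF a b c], folded w3_def, simplified]
  have m: "w0 (p, 0, q, r) = w1 (p, 0, q, r) \<and> w0 (p, q, 0, r) = w2 (p, q, 0, r) \<and> w0 (p, q, r, 0) = w3 (0, q, r, p) \<and>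
      w1 (p, q, 0, r) = w2 (p, 0, q, r) \<and> w1 (p, q, r, 0) = w3 (q, 0, r, p) \<and> w2 (p, q, r, 0) = w3 (r, q, 0, p)"
    if pqr: "0 \<le> p" "0 \<le> q" "0 \<le> r" "p + q + r = 1" for p q r
  proof -
    have s: "(p, q, r) \<in> simplex2" "(q, p, r) \<in> simplex2" "(q, r, p) \<in> simplex2"
      using pqr by (auto simp: simplex2_def)
    have "glue a b c (q, r, p) = w3 (0, q, r, p)"
      by (simp add: glue_def w3_def)
    then show ?thesis
      using F0(2)[OF s(1)] F1(2)[OF s(1)] F0(3)[OF s(2)] F2(3)[OF s(2)] F0(1)[OF s(3)]
        F1(3)[OF s(2)] F2(2)[OF s(1)] F1(1)[OF s(3)] F3(2)[OF s(3)] F2(1)[OF s(3)] F3(3)[OF s(3)]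
      by simp
  qed
  have cont: "continuous_on simplex3 (subdivide w0 w1 w2 w3)"
    unfolding w0_def w1_def w2_def w3_def
    by (rule subdivide_continuous[OF Tri_fill(1)[OF abc e f] Tri_fill(1)[OF b e g]
        Tri_fill(1)[OF c sg f] Tri_fill(1)[OF a b c]]) (rule m[unfolded w0_def w1_def w2_def w3_def])
  have im: "subdivide w0 w1 w2 w3 ` simplex3 \<subseteq> M"
    unfolding w0_def w1_def w2_def w3_def
    by (rule subdivide_image[OF Tri_fill(2)[OF abc e f] Tri_fill(2)[OF b e g]
        Tri_fill(2)[OF c sg f] Tri_fill(2)[OF a b c]])
  show ?thesis
  proof (rule m_class_face[OF cont im a glue_Tri[OF b e g] glue_Tri[OF c sg f]])
    fix x0 x1 x2 :: real assume x: "0 \<le> x0" "0 \<le> x1" "0 \<le> x2" "x0 + x1 + x2 = 1"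
    then have s: "(x0, x1, x2) \<in> simplex2" by (simp add: simplex2_def)
    have sf: "subdivide w0 w1 w2 w3 (0, x0, x1, x2) = w0 (0, x0, x1, x2)"
      "subdivide w0 w1 w2 w3 (x0, 0, x1, x2) = w1 (0, x0, x1, x2)"
      "subdivide w0 w1 w2 w3 (x1, x0, 0, x2) = w2 (0, x0, x1, x2)"
      "subdivide w0 w1 w2 w3 (x2, x0, x1, 0) = w3 (x2, x0, x1, 0)"
      by (rule subdivide_faces; (rule x | rule m; assumption))+
    show "subdivide w0 w1 w2 w3 (x2, x0, x1, 0) = a (x0, x1, x2)"
      using sf(4) F3(1)[OF s] by simp
    show "subdivide w0 w1 w2 w3 (x0, 0, x1, x2) = glue b e g (x0, x1, x2)"
      using sf(2) by (simp add: glue_def w1_def)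
    show "subdivide w0 w1 w2 w3 (x1, x0, 0, x2) = glue c (swap g) f (x0, x1, x2)"
      using sf(3) by (simp add: glue_def w2_def)
    show "subdivide w0 w1 w2 w3 (0, x0, x1, x2) = glue (glue a b c) e f (x0, x1, x2)"
      using sf(1) by (simp add: glue_def w0_def)
  qed
qed

lemma Cell_E:
  assumes "A \<in> Cell u v w"
  obtains a where "a \<in> Tri u v w" "A = triangle_class M a"
  using assms unfolding Cell_def by blast

lemma CellI: "a \<in> Tri u v w \<Longrightarrow> triangle_class M a \<in> Cell u v w"
  unfolding Cell_def by blast

lemma triangle_class_Tri_eqI:
  "\<lbrakk>a \<in> Tri u v w; \<And>x0 x1 x2. \<lbrakk>0 \<le> x0; 0 \<le> x1; 0 \<le> x2; x0 + x1 + x2 = 1\<rbrakk> \<Longrightarrow> b (x0, x1, x2) = a (x0, x1, x2)\<rbrakk>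
    \<Longrightarrow> triangle_class M b = triangle_class M a"
  by (rule Tri_cong(2)) (auto simp: simplex2_def)

theorem triangle_calculus:
  assumes nonempty: "\<And>u v w. \<lbrakk>u \<in> U; v \<in> U; w \<in> U\<rbrakk> \<Longrightarrow> Tri u v w \<noteq> {}"
  shows "triangle_calculus U Cell (m_class M) (P_class M) (Q_class M) (\<lambda>u w. triangle_class M (degenerate u w))"
proof (unfold_locales, goal_cases)
  case (1 A u v w)
  then show ?case by (elim Cell_E) (use TriD in blast)
next
  case (2 u v w)
  then show ?case using nonempty by (simp add: Cell_def)
next
  case (3 A u v x B w C)
  then show ?case
    by (elim Cell_E) (simp add: m_class_eq CellI glue_Tri)
next
  case (4 A u v w)
  then show ?case by (elim Cell_E) (simp add: P_class_Tri CellI rotate_Tri)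
next
  case (5 A u v w)
  then show ?case by (elim Cell_E) (simp add: Q_class_Tri CellI swap_Tri)
next
  case (6 A u v w)
  then obtain a where a: "a \<in> Tri u v w" "A = triangle_class M a" by (rule Cell_E)
  have "triangle_class M (rotate (rotate (rotate a))) = triangle_class M a"
    by (rule triangle_class_Tri_eqI[OF a(1)]) simp
  then show ?case
    using a P_class_Tri[OF a(1)] P_class_Tri[OF rotate_Tri[OF a(1)]]
      P_class_Tri[OF rotate_Tri[OF rotate_Tri[OF a(1)]]] by simp
next
  case (7 A u v w)
  then obtain a where a: "a \<in> Tri u v w" "A = triangle_class M a" by (rule Cell_E)
  have "triangle_class M (swap (swap a)) = triangle_class M a"
    by (rule triangle_class_Tri_eqI[OF a(1)]) simp
  then show ?case
    using a Q_class_Tri[OF a(1)] Q_class_Tri[OF swap_Tri[OF a(1)]] by simp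
next
  case (8 A u v w)
  then obtain a where a: "a \<in> Tri u v w" "A = triangle_class M a" by (rule Cell_E)
  have "triangle_class M (rotate (rotate (swap a))) = triangle_class M (swap (rotate a))"
    by (rule triangle_class_Tri_eqI[OF swap_Tri[OF rotate_Tri[OF a(1)]]]) simp
  then show ?case
    using a Q_class_Tri[OF a(1)] P_class_Tri[OF swap_Tri[OF a(1)]] P_class_Tri[OF a(1)]
      P_class_Tri[OF rotate_Tri[OF swap_Tri[OF a(1)]]] Q_class_Tri[OF rotate_Tri[OF a(1)]] by simp
next
  case (9 A u v x B w C)
  obtain a where a: "a \<in> Tri u v x" "A = triangle_class M a" using 9(1) by (rule Cell_E)
  obtain b where b: "b \<in> Tri x v w" "B = triangle_class M b" using 9(2) by (rule Cell_E)
  obtain c where c: "c \<in> Tri u x w" "C = triangle_class M c" using 9(3) by (rule Cell_E)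
  show ?case
    using Tri_m_rotate[OF a(1) b(1) c(1)] m_class_eq[OF a(1) b(1) c(1)] P_class_Tri[OF a(1)]
      P_class_Tri[OF b(1)] P_class_Tri[OF c(1)] P_class_Tri[OF glue_Tri[OF a(1) b(1) c(1)]]
      a(2) b(2) c(2) by simp
next
  case (10 A u v x B w C)
  obtain a where a: "a \<in> Tri u v x" "A = triangle_class M a" using 10(1) by (rule Cell_E)
  obtain b where b: "b \<in> Tri x v w" "B = triangle_class M b" using 10(2) by (rule Cell_E)
  obtain c where c: "c \<in> Tri u x w" "C = triangle_class M c" using 10(3) by (rule Cell_E)
  show ?case
    using Tri_m_swap[OF a(1) b(1) c(1)] m_class_eq[OF a(1) b(1) c(1)] Q_class_Tri[OF a(1)]
      Q_class_Tri[OF b(1)] Q_class_Tri[OF c(1)] Q_class_Tri[OF glue_Tri[OF a(1) b(1) c(1)]]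
      a(2) b(2) c(2) by simp
next
  case (11 A u v x B y C E w F G)
  obtain a where a: "a \<in> Tri u v x" "A = triangle_class M a" using 11(1) by (rule Cell_E)
  obtain b where b: "b \<in> Tri x v y" "B = triangle_class M b" using 11(2) by (rule Cell_E)
  obtain c where c: "c \<in> Tri u x y" "C = triangle_class M c" using 11(3) by (rule Cell_E)
  obtain e where e: "e \<in> Tri y v w" "E = triangle_class M e" using 11(4) by (rule Cell_E)
  obtain f where f: "f \<in> Tri u y w" "F = triangle_class M f" using 11(5) by (rule Cell_E)
  obtain g where g: "g \<in> Tri x y w" "G = triangle_class M g" using 11(6) by (rule Cell_E)
  show ?case
    using Tri_m_assoc[OF a(1) b(1) c(1) e(1) f(1) g(1)] m_class_eq[OF a(1) b(1) c(1)]
      m_class_eq[OF glue_Tri[OF a(1) b(1) c(1)] e(1) f(1)] m_class_eq[OF b(1) e(1) g(1)]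
      Q_class_Tri[OF g(1)] m_class_eq[OF c(1) swap_Tri[OF g(1)] f(1)]
      a(2) b(2) c(2) e(2) f(2) g(2) by simp
next
  case (12 F u v x A w B)
  obtain f where f: "f \<in> Tri u v x" "F = triangle_class M f" using 12(1) by (rule Cell_E)
  obtain a where a: "a \<in> Tri x v w" "A = triangle_class M a" using 12(2) by (rule Cell_E)
  obtain b where b: "b \<in> Tri u x w" "B = triangle_class M b" using 12(3) by (rule Cell_E)
  show ?case
    using Tri_m_cancel[OF f(1) a(1) b(1)] m_class_eq[OF f(1) a(1) b(1)]
      Q_class_Tri[OF a(1)] P_class_Tri[OF swap_Tri[OF a(1)]] P_class_Tri[OF rotate_Tri[OF swap_Tri[OF a(1)]]]
      Q_class_Tri[OF b(1)] P_class_Tri[OF swap_Tri[OF b(1)]]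
      f(2) a(2) b(2) by simp
next
  case (13 u w)
  then show ?case by (intro CellI degenerate_Tri)
next
  case (14 u w)
  note d = degenerate_Tri[OF 14]
  have "triangle_class M (swap (degenerate u w)) = triangle_class M (degenerate u w)"
    by (rule triangle_class_Tri_eqI[OF d]) simp
  then show ?case using Q_class_Tri[OF d] by simp
next
  case (15 u)
  note d = degenerate_Tri[OF 15 15]
  have "triangle_class M (rotate (degenerate u u)) = triangle_class M (degenerate u u)"
    by (rule triangle_class_Tri_eqI[OF d]) (simp add: L_same[OF 15])
  then show ?case using P_class_Tri[OF d] by simp
next
  case (16 A u v w)
  then obtain a where a: "a \<in> Tri u v w" "A = triangle_class M a" by (rule Cell_E)
  note U = TriD(1-3)[OF a(1)]
  show ?case
    using Tri_m_degenerate[OF a(1)] P_class_Tri[OF degenerate_Tri[OF U(3,2)]]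
      P_class_Tri[OF degenerate_Tri[OF U(3,1)]] P_class_Tri[OF rotate_Tri[OF degenerate_Tri[OF U(3,1)]]] a(2)
    by simp
qed

end

section \<open>The fundamental group\<close>

lemma path_class_eq: "homotopic_paths M p q \<Longrightarrow> path_class M p = path_class M q"
  unfolding path_class_def by (auto intro: homotopic_paths_trans homotopic_paths_sym)

lemma loops_D:
  assumes "p \<in> loops M m0"
  shows "path p" "path_image p \<subseteq> M" "p 0 = m0" "p 1 = m0" "homotopic_paths M p p"
  using assms by (auto simp: loops_def pathstart_def pathfinish_def)

lemma loops_join: "\<lbrakk>p \<in> loops M m0; q \<in> loops M m0\<rbrakk> \<Longrightarrow> p +++ q \<in> loops M m0"
  by (auto simp: loops_def path_image_join)

lemma loops_homotopic:
  assumes "p \<in> loops M m0" "homotopic_paths M p q"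
  shows "q \<in> loops M m0"
  using assms(1) homotopic_paths_imp_path[OF assms(2)] homotopic_paths_imp_subset[OF assms(2)]
    homotopic_paths_imp_pathstart[OF assms(2)] homotopic_paths_imp_pathfinish[OF assms(2)]
  by (simp add: loops_def)

lemma loops_reverse: "p \<in> loops M m0 \<Longrightarrow> reversepath p \<in> loops M m0"
  by (auto simp: loops_def)

lemma loops_const: "m0 \<in> M \<Longrightarrow> (\<lambda>_. m0) \<in> loops M m0"
  by (auto simp: loops_def path_def path_image_def pathstart_def pathfinish_def)

lemma pi1_carrier: "x \<in> carrier (pi1 M m0) \<longleftrightarrow> (\<exists>p\<in>loops M m0. x = path_class M p)"
  by (auto simp: pi1_def)

lemma pi1_mult:
  assumes "p \<in> loops M m0" "q \<in> loops M m0"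
  shows "path_class M p \<otimes>\<^bsub>pi1 M m0\<^esub> path_class M q = path_class M (p +++ q)"
proof -
  have "path_class M (p' +++ q') = path_class M (p +++ q)"
    if "p' \<in> path_class M p" "q' \<in> path_class M q" for p' q'
  proof (rule path_class_eq[symmetric], rule homotopic_paths_join)
    show "homotopic_paths M p p'" "homotopic_paths M q q'"
      using that by (auto simp: path_class_def)
    show "pathfinish p = pathstart q"
      using assms by (auto simp: loops_def)
  qed
  moreover have "p \<in> path_class M p" "q \<in> path_class M q"
    using assms loops_D(5) by (auto simp: path_class_def)
  ultimately show ?thesis
    unfolding pi1_def monoid.simps by blast
qed

lemma homotopic_paths_const_join:
  assumes "p \<in> loops M m0"
  shows "homotopic_paths M ((\<lambda>_. m0) +++ p) p"
proof (rule homotopic_paths_sym, rule homotopic_paths_reparametrize)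
  show "((\<lambda>_. m0) +++ p) t = p (max 0 (2 * t - 1))" if "t \<in> {0..1}" for t
  proof (cases "t \<le> 1/2")
    case True
    then show ?thesis using loops_D(3)[OF assms] by (simp add: joinpaths_def max_absorb1)
  next
    case False
    then show ?thesis by (simp add: joinpaths_def)
  qed
qed (use loops_D[OF assms] in \<open>auto intro!: continuous_intros\<close>)

text \<open>The path runs through the unit interval from 1 to 0 and back to 1, followed by
  \<open>p\<close>. In the interval it contracts linearly to the point 1.\<close>

lemma homotopic_paths_reverse_join:
  assumes "p \<in> loops M m0"
  shows "homotopic_paths M (reversepath p +++ p) (\<lambda>_. m0)"
proof -
  let ?r = "\<lambda>t::real. 1 - t" and ?i = "\<lambda>t::real. t"
  have paths: "path (?r +++ ?i)" "path (\<lambda>_. 1::real)"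
    by (auto simp: path_def pathfinish_def pathstart_def intro!: path_join_imp[unfolded path_def] continuous_intros)
  have im: "(?r +++ ?i) t \<in> {0..1}" if "t \<in> {0..1}" for t
    using that by (auto simp: joinpaths_def)
  have "homotopic_paths {0..1} (?r +++ ?i) (\<lambda>_. 1)"
  proof (rule homotopic_paths_linear[OF paths])
    show "closed_segment ((?r +++ ?i) t) 1 \<subseteq> {0..1}" if "t \<in> {0..1}" for t
      using im[OF that] by (intro closed_segment_subset) auto
  qed (auto simp: pathstart_def pathfinish_def joinpaths_def)
  then have "homotopic_paths M (p \<circ> (?r +++ ?i)) (p \<circ> (\<lambda>_. 1))"
    by (rule homotopic_paths_continuous_image)
      (use loops_D[OF assms] in \<open>auto simp: path_def path_image_def\<close>)
  moreover have "p \<circ> (?r +++ ?i) = reversepath p +++ p" "p \<circ> (\<lambda>_. 1) = (\<lambda>_. m0)"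
    using loops_D(4)[OF assms] by (auto simp: joinpaths_def reversepath_def fun_eq_iff)
  ultimately show ?thesis using loops_D(4)[OF assms] by simp
qed

lemma group_pi1:
  assumes "m0 \<in> M"
  shows "group (pi1 M m0)"
proof (rule groupI)
  have one: "\<one>\<^bsub>pi1 M m0\<^esub> = path_class M (\<lambda>_. m0)" by (simp add: pi1_def)
  show "\<one>\<^bsub>pi1 M m0\<^esub> \<in> carrier (pi1 M m0)"
    unfolding one pi1_carrier using loops_const[OF assms] by blast
  fix x assume "x \<in> carrier (pi1 M m0)"
  then obtain p where p: "p \<in> loops M m0" "x = path_class M p" unfolding pi1_carrier by blast
  show "\<one>\<^bsub>pi1 M m0\<^esub> \<otimes>\<^bsub>pi1 M m0\<^esub> x = x"
    unfolding one p(2) pi1_mult[OF loops_const[OF assms] p(1)]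
    by (rule path_class_eq[OF homotopic_paths_const_join[OF p(1)]])
  have "path_class M (reversepath p) \<in> carrier (pi1 M m0)"
    unfolding pi1_carrier using loops_reverse[OF p(1)] by blast
  moreover have "path_class M (reversepath p) \<otimes>\<^bsub>pi1 M m0\<^esub> x = \<one>\<^bsub>pi1 M m0\<^esub>"
    unfolding one p(2) pi1_mult[OF loops_reverse[OF p(1)] p(1)]
    by (rule path_class_eq[OF homotopic_paths_reverse_join[OF p(1)]])
  ultimately show "\<exists>y\<in>carrier (pi1 M m0). y \<otimes>\<^bsub>pi1 M m0\<^esub> x = \<one>\<^bsub>pi1 M m0\<^esub>" by blast
  fix y assume "y \<in> carrier (pi1 M m0)"
  then obtain q where q: "q \<in> loops M m0" "y = path_class M q" unfolding pi1_carrier by blast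
  show "x \<otimes>\<^bsub>pi1 M m0\<^esub> y \<in> carrier (pi1 M m0)"
    unfolding p(2) q(2) pi1_mult[OF p(1) q(1)] pi1_carrier using loops_join[OF p(1) q(1)] by blast
  fix z assume "z \<in> carrier (pi1 M m0)"
  then obtain r where r: "r \<in> loops M m0" "z = path_class M r" unfolding pi1_carrier by blast
  have "homotopic_paths M (p +++ (q +++ r)) ((p +++ q) +++ r)"
    using p(1) q(1) r(1) by (intro homotopic_paths_assoc) (auto simp: loops_def)
  then show "x \<otimes>\<^bsub>pi1 M m0\<^esub> y \<otimes>\<^bsub>pi1 M m0\<^esub> z = x \<otimes>\<^bsub>pi1 M m0\<^esub> (y \<otimes>\<^bsub>pi1 M m0\<^esub> z)"
    unfolding p(2) q(2) r(2) pi1_mult[OF p(1) q(1)] pi1_mult[OF q(1) r(1)]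
      pi1_mult[OF loops_join[OF p(1) q(1)] r(1)] pi1_mult[OF p(1) loops_join[OF q(1) r(1)]]
    by (rule path_class_eq[symmetric])
qed

text \<open>The two sides at \<open>s = 0\<close> and \<open>s = 1\<close> of the square on which a homotopy of paths lives are
  collapsed to the vertices 2 and 0 of the triangle.\<close>

lemma triangle_of_homotopic_paths:
  fixes M :: "'a::topological_space set"
  assumes "homotopic_paths M (a +++ b) c" "pathfinish a = pathstart b"
  obtains T where "continuous_on simplex2 T" "T ` simplex2 \<subseteq> M"
    "\<And>p q. \<lbrakk>0 \<le> p; 0 \<le> q; p + q = 1\<rbrakk> \<Longrightarrow> T (p, q, 0) = b p"
    "\<And>p q. \<lbrakk>0 \<le> p; 0 \<le> q; p + q = 1\<rbrakk> \<Longrightarrow> T (0, p, q) = a p"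
    "\<And>p q. \<lbrakk>0 \<le> p; 0 \<le> q; p + q = 1\<rbrakk> \<Longrightarrow> T (p, 0, q) = c p"
proof -
  obtain K where K: "continuous_on ({0..1} \<times> {0..1}) K" "K \<in> ({0..1} \<times> {0..1}) \<rightarrow> M"
    "\<And>x. x \<in> {0..1} \<Longrightarrow> K (0, x) = (a +++ b) x" "\<And>x. x \<in> {0..1} \<Longrightarrow> K (1, x) = c x"
    "\<And>t::real. t \<in> {0..1} \<Longrightarrow> K (t, 0) = a 0 \<and> K (t, 1) = b 1"
    using assms(1) unfolding homotopic_paths pathstart_def pathfinish_def o_def
    by (auto simp: joinpaths_def)
  let ?I = "{0..1::real} \<times> {0..1::real}"
  \<comment> \<open>A point (t, s) consists of time and path parameter. Time 0 is put on the edges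
    [2,1] and [1,0], time 1 on the edge [2,0]. The quantity x0 + x1/2 equals s throughout, and x1
    decreases linearly in t from its maximum \<open>2 * min s (1 - s)\<close>.\<close>
  let ?x1 = "\<lambda>z::real \<times> real. (1 - fst z) * (2 * min (snd z) (1 - snd z))"
  define k where "k = (\<lambda>z. (snd z - ?x1 z / 2, ?x1 z, 1 - snd z - ?x1 z / 2))"
  have k_mem: "k z \<in> simplex2" if "z \<in> ?I" for z
  proof -
    obtain t s where z: "z = (t, s)" by fastforce
    have "0 \<le> ?x1 z" using that by (auto simp: z)
    moreover have "?x1 z \<le> 1 * (2 * min (snd z) (1 - snd z))"
      using that by (intro mult_right_mono) (auto simp: z)
    then have "?x1 z / 2 \<le> s" "?x1 z / 2 \<le> 1 - s"
      by (simp_all add: z)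
    ultimately show ?thesis by (simp add: k_def simplex2_def z)
  qed
  have k_onto: "\<exists>z\<in>?I. k z = x" if "x \<in> simplex2" for x
  proof -
    obtain x0 x1 x2 where x: "x = (x0, x1, x2)" by (metis prod_cases3)
    have s: "0 \<le> x0" "0 \<le> x1" "0 \<le> x2" "x0 + x1 + x2 = 1"
      using that by (auto simp: x simplex2_def)
    define \<sigma> where "\<sigma> = x0 + x1 / 2"
    define \<mu> where "\<mu> = 2 * min \<sigma> (1 - \<sigma>)"
    have \<mu>: "\<mu> = x1 + 2 * min x0 x2" using s by (auto simp: \<mu>_def \<sigma>_def min_def)
    \<comment> \<open>\<open>\<mu>\<close> vanishes only at the vertices 0 and 2, where a whole side
      of the square is collapsed and any time is a preimage.\<close>
    define \<tau> where "\<tau> = (if \<mu> = 0 then 0 else 1 - x1 / \<mu>)"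
    have "x1 \<le> \<mu>" using s by (simp add: \<mu>)
    then have "0 \<le> \<tau>" "\<tau> \<le> 1" "(1 - \<tau>) * \<mu> = x1"
      using s by (auto simp: \<tau>_def divide_le_eq)
    moreover have "0 \<le> \<sigma>" "\<sigma> \<le> 1" using s by (auto simp: \<sigma>_def)
    moreover have "k (\<tau>, \<sigma>) = x"
    proof -
      have "?x1 (\<tau>, \<sigma>) = x1" using \<open>(1 - \<tau>) * \<mu> = x1\<close> by (simp add: \<mu>_def)
      then have "k (\<tau>, \<sigma>) = (\<sigma> - x1 / 2, x1, 1 - \<sigma> - x1 / 2)" by (simp only: k_def snd_conv)
      then show ?thesis using s by (simp add: x \<sigma>_def)
    qed
    ultimately show ?thesis by (intro bexI[of _ "(\<tau>, \<sigma>)"]) auto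
  qed
  \<comment> \<open>A continuous surjection from a compact space to a Hausdorff space is a quotient
    map, so it suffices that \<open>K\<close> is constant on its fibres: points, and two sides on
    which the homotopy of paths fixes the ends.\<close>
  have q: "quotient_map (top_of_set ?I) (top_of_set simplex2) k"
  proof (rule continuous_closed_imp_quotient_map)
    show c: "continuous_map (top_of_set ?I) (top_of_set simplex2) k"
      using k_mem by (auto simp: k_def intro!: continuous_intros)
    have "compact_space (top_of_set ?I)"
      by (intro compact_space_subtopology) (simp add: compact_Times)
    then show "closed_map (top_of_set ?I) (top_of_set simplex2) k"
      by (rule continuous_imp_closed_map_gen[OF _ _ c])
        (intro Hausdorff_imp_kc_space Hausdorff_space_subtopology Hausdorff_space_euclidean)
    show "k ` topspace (top_of_set ?I) = topspace (top_of_set simplex2)"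
      unfolding topspace_euclidean_subtopology using k_mem k_onto by blast
  qed
  have respects: "K z = K z'" if "z \<in> ?I" "z' \<in> ?I" "k z = k z'" for z z'
  proof -
    obtain t s t' s' where z: "z = (t, s)" "z' = (t', s')" by fastforce
    have x1: "?x1 z = ?x1 z'" and "snd z - ?x1 z / 2 = snd z' - ?x1 z' / 2"
      using that(3) by (auto simp: k_def)
    then have s: "s' = s" by (simp add: z)
    show ?thesis
    proof (cases "s = 0 \<or> s = 1")
      case True
      then show ?thesis using K(5)[of t] K(5)[of t'] that by (auto simp: z s)
    next
      case False
      then have "min s (1 - s) \<noteq> 0" using that by (auto simp: z min_def)
      then show ?thesis using x1 by (simp add: z s)
    qed
  qed
  have Kc: "continuous_map (top_of_set ?I) (top_of_set M) K"
    using K(1,2) by simp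
  obtain T where T: "continuous_map (top_of_set simplex2) (top_of_set M) T"
    "\<And>z. z \<in> topspace (top_of_set ?I) \<Longrightarrow> T (k z) = K z"
  proof (rule quotient_map_lift_exists[OF q Kc], goal_cases)
    case (1 z z')
    then show ?case using respects unfolding topspace_euclidean_subtopology by blast
  next
    case (2 T)
    show ?case by (rule 2(1)[OF 2(2,4)])
  qed
  show thesis
  proof (rule that)
    show "continuous_on simplex2 T" "T ` simplex2 \<subseteq> M" using T(1) by auto
    fix p q :: real assume pq: "0 \<le> p" "0 \<le> q" "p + q = 1"
    then have q: "q = 1 - p" by simp
    have "k (0, 1/2 + p/2) = (p, q, 0)"
      using pq by (auto simp: k_def q min_def field_simps)
    then have "T (p, q, 0) = (a +++ b) (1/2 + p/2)"
      using T(2)[of "(0, 1/2 + p/2)"] K(3)[of "1/2 + p/2"] pq by simp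
    also have "\<dots> = b p"
      using assms(2) by (cases "p = 0") (use pq in \<open>auto simp: joinpaths_def pathstart_def pathfinish_def\<close>)
    finally show "T (p, q, 0) = b p" .
    have "k (0, p/2) = (0, p, q)"
      using pq by (auto simp: k_def q min_def field_simps)
    then have "T (0, p, q) = (a +++ b) (p/2)"
      using T(2)[of "(0, p/2)"] K(3)[of "p/2"] pq by simp
    then show "T (0, p, q) = a p"
      using pq by (auto simp: joinpaths_def)
    have "k (1, p) = (p, 0, q)" by (simp add: k_def q)
    then show "T (p, 0, q) = c p"
      using T(2)[of "(1, p)"] K(4)[of p] pq by simp
  qed
qed

section \<open>The triangle calculus of a space with a section of loops\<close>

locale loop_space =
  fixes M :: "'a::topological_space set" and m0 :: 'a and s :: "(real \<Rightarrow> 'a) set \<Rightarrow> real \<Rightarrow> 'a"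
  assumes base: "m0 \<in> M" and loop_section: "loop_section M m0 s"
begin

sublocale group "pi1 M m0"
  by (rule group_pi1[OF base])

abbreviation G where "G \<equiv> pi1 M m0"

text \<open>The section in homogeneous form. Only the quotient of the labels enters, so left
  translation of all labels changes nothing.\<close>

definition lift :: "(real \<Rightarrow> 'a) set \<Rightarrow> (real \<Rightarrow> 'a) set \<Rightarrow> real \<Rightarrow> 'a" where
  "lift u v = s (inv\<^bsub>G\<^esub> u \<otimes>\<^bsub>G\<^esub> v)"

lemma section_mem: "g \<in> carrier G \<Longrightarrow> s g \<in> g"
  and section_inv: "\<lbrakk>g \<in> carrier G; 0 \<le> t; t \<le> 1\<rbrakk> \<Longrightarrow> s (inv\<^bsub>G\<^esub> g) t = s g (1 - t)"
  and section_one: "\<lbrakk>0 \<le> t; t \<le> 1\<rbrakk> \<Longrightarrow> s \<one>\<^bsub>G\<^esub> t = m0"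
  using loop_section unfolding loop_section_def by auto

lemma section_loop:
  assumes "g \<in> carrier G"
  shows "s g \<in> loops M m0" "path_class M (s g) = g"
proof -
  obtain p where p: "p \<in> loops M m0" "g = path_class M p"
    using assms unfolding pi1_carrier by blast
  then have h: "homotopic_paths M p (s g)"
    using section_mem[OF assms] by (simp add: path_class_def)
  show "s g \<in> loops M m0"
    by (rule loops_homotopic[OF p(1) h])
  show "path_class M (s g) = g"
    by (rule trans[OF path_class_eq[OF h, symmetric] p(2)[symmetric]])
qed

lemma lift_loop: "\<lbrakk>u \<in> carrier G; v \<in> carrier G\<rbrakk> \<Longrightarrow> lift u v \<in> loops M m0"
  unfolding lift_def by (rule section_loop(1)) simp

sublocale triangle_space M m0 "carrier G" lift
proof
  fix u v assume G: "u \<in> carrier G" "v \<in> carrier G"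
  note l = loops_D[OF lift_loop[OF G]]
  show "continuous_on {0..1} (lift u v)" "lift u v ` {0..1} \<subseteq> M" "lift u v 1 = m0"
    using l by (auto simp: path_def path_image_def)
  fix t :: real assume t: "0 \<le> t" "t \<le> 1"
  show "lift u v (1 - t) = lift v u t"
    using section_inv[of "inv\<^bsub>G\<^esub> u \<otimes>\<^bsub>G\<^esub> v" t] G t by (simp add: lift_def inv_mult_group)
next
  fix u and t :: real assume "u \<in> carrier G" "0 \<le> t" "t \<le> 1"
  then show "lift u u t = m0" by (simp add: lift_def section_one)
qed

text \<open>In the fundamental group \<open>inv w \<otimes> v\<close> times
  \<open>inv v \<otimes> u\<close> is \<open>inv w \<otimes> u\<close>, so the first two edges
  joined are homotopic to the third one, and this homotopy folds to a triangle.\<close>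

lemma Tri_nonempty:
  assumes "u \<in> carrier G" "v \<in> carrier G" "w \<in> carrier G"
  shows "Tri u v w \<noteq> {}"
proof -
  have "path_class M (lift w v +++ lift v u) = (inv\<^bsub>G\<^esub> w \<otimes>\<^bsub>G\<^esub> v) \<otimes>\<^bsub>G\<^esub> (inv\<^bsub>G\<^esub> v \<otimes>\<^bsub>G\<^esub> u)"
    using pi1_mult[OF lift_loop lift_loop, of w v v u] section_loop(2) assms by (simp add: lift_def)
  also have "\<dots> = inv\<^bsub>G\<^esub> w \<otimes>\<^bsub>G\<^esub> (v \<otimes>\<^bsub>G\<^esub> inv\<^bsub>G\<^esub> v) \<otimes>\<^bsub>G\<^esub> u"
    using assms by (simp only: m_assoc m_closed inv_closed)
  also have "\<dots> = path_class M (lift w u)"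
    using assms section_loop(2)[of "inv\<^bsub>G\<^esub> w \<otimes>\<^bsub>G\<^esub> u"] by (simp add: lift_def)
  finally have "homotopic_paths M (lift w v +++ lift v u) (lift w u)"
    using loops_D(5)[OF lift_loop, of w u] assms by (auto simp: path_class_def)
  moreover have "pathfinish (lift w v) = pathstart (lift v u)"
    using loops_D(3,4)[OF lift_loop] assms by (simp add: pathfinish_def pathstart_def)
  ultimately obtain T where "continuous_on simplex2 T" "T ` simplex2 \<subseteq> M"
    "\<And>p q. \<lbrakk>0 \<le> p; 0 \<le> q; p + q = 1\<rbrakk> \<Longrightarrow> T (p, q, 0) = lift v u p"
    "\<And>p q. \<lbrakk>0 \<le> p; 0 \<le> q; p + q = 1\<rbrakk> \<Longrightarrow> T (0, p, q) = lift w v p"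
    "\<And>p q. \<lbrakk>0 \<le> p; 0 \<le> q; p + q = 1\<rbrakk> \<Longrightarrow> T (p, 0, q) = lift w u p"
    by (rule triangle_of_homotopic_paths) (rule that)
  then have "T \<in> Tri u v w" by (intro TriI assms)
  then show ?thesis by blast
qed

abbreviation deg where "deg u w \<equiv> triangle_class M (degenerate u w)"

sublocale T: triangle_calculus "carrier G" Cell "m_class M" "P_class M" "Q_class M" deg
  by (rule triangle_calculus) (rule Tri_nonempty)

lemma triangles_eq_Tri:
  assumes "g \<in> carrier G" "h \<in> carrier G"
  shows "triangles M m0 s g h = Tri g \<one>\<^bsub>G\<^esub> (inv\<^bsub>G\<^esub> h)"
proof -
  have e: "edge a 1 0 t = a (t, 1 - t, 0)" "edge a 2 1 t = a (0, t, 1 - t)" "edge a 2 0 t = a (t, 0, 1 - t)"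
    for a :: "real \<times> real \<times> real \<Rightarrow> 'a" and t
    by (simp_all add: edge_def linepath_def vert2_def)
  have l: "lift \<one>\<^bsub>G\<^esub> g = s g" "lift (inv\<^bsub>G\<^esub> h) \<one>\<^bsub>G\<^esub> = s h" "lift (inv\<^bsub>G\<^esub> h) g = s (h \<otimes>\<^bsub>G\<^esub> g)"
    using assms by (simp_all add: lift_def)
  have all: "(\<forall>p q. 0 \<le> p \<and> 0 \<le> q \<and> p + q = 1 \<longrightarrow> R p q) \<longleftrightarrow> (\<forall>t\<in>{0..1}. R t (1 - t))"
    for R :: "real \<Rightarrow> real \<Rightarrow> bool"
  proof (intro iffI allI impI ballI)
    fix p q :: real assume "\<forall>t\<in>{0..1}. R t (1 - t)" and pq: "0 \<le> p \<and> 0 \<le> q \<and> p + q = 1"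
    moreover have "q = 1 - p" "p \<in> {0..1}" using pq by auto
    ultimately show "R p q" by blast
  qed auto
  show ?thesis
    unfolding triangles_def Tri_def e l all using assms by auto
qed

lemma Cell_label:
  assumes "g \<in> carrier G" "h \<in> carrier G"
  shows "cell (Gamma_delta M m0 s) g h = Cell g \<one>\<^bsub>G\<^esub> (inv\<^bsub>G\<^esub> h)"
  using triangles_eq_Tri[OF assms] by (simp add: Gamma_delta_def Cell_def)

lemma Cell_translate:
  assumes "k \<in> carrier G" "u \<in> carrier G" "v \<in> carrier G" "w \<in> carrier G"
  shows "Cell (k \<otimes>\<^bsub>G\<^esub> u) (k \<otimes>\<^bsub>G\<^esub> v) (k \<otimes>\<^bsub>G\<^esub> w) = Cell u v w"
proof -
  have "inv\<^bsub>G\<^esub> (k \<otimes>\<^bsub>G\<^esub> x) \<otimes>\<^bsub>G\<^esub> (k \<otimes>\<^bsub>G\<^esub> y) = inv\<^bsub>G\<^esub> x \<otimes>\<^bsub>G\<^esub> y" if "x \<in> carrier G" "y \<in> carrier G" for x y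
  proof -
    have "inv\<^bsub>G\<^esub> (k \<otimes>\<^bsub>G\<^esub> x) \<otimes>\<^bsub>G\<^esub> (k \<otimes>\<^bsub>G\<^esub> y) = inv\<^bsub>G\<^esub> x \<otimes>\<^bsub>G\<^esub> (inv\<^bsub>G\<^esub> k \<otimes>\<^bsub>G\<^esub> k) \<otimes>\<^bsub>G\<^esub> y"
      using that assms by (simp only: m_assoc m_closed inv_closed inv_mult_group)
    then show ?thesis using that assms by simp
  qed
  then have "lift (k \<otimes>\<^bsub>G\<^esub> x) (k \<otimes>\<^bsub>G\<^esub> y) = lift x y" if "x \<in> carrier G" "y \<in> carrier G" for x y
    using that by (simp add: lift_def)
  then show ?thesis
    using assms by (simp add: Cell_def Tri_def)
qed

lemma deg_translate:
  assumes "k \<in> carrier G" "u \<in> carrier G" "w \<in> carrier G"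
  shows "deg (k \<otimes>\<^bsub>G\<^esub> u) (k \<otimes>\<^bsub>G\<^esub> w) = deg u w"
proof -
  have "inv\<^bsub>G\<^esub> (k \<otimes>\<^bsub>G\<^esub> w) \<otimes>\<^bsub>G\<^esub> (k \<otimes>\<^bsub>G\<^esub> u) = inv\<^bsub>G\<^esub> w \<otimes>\<^bsub>G\<^esub> (inv\<^bsub>G\<^esub> k \<otimes>\<^bsub>G\<^esub> k) \<otimes>\<^bsub>G\<^esub> u"
    using assms by (simp only: m_assoc m_closed inv_closed inv_mult_group)
  then show ?thesis using assms by (simp add: degenerate_def lift_def)
qed

end

context triangle_calculus
begin

text \<open>The prism over a triangle \<open>a\<close> with a single label, cut into three tetrahedra.\<close>

lemma tau_prism:
  assumes a: "a \<in> C u u u" and v: "v \<in> U"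
  shows "m (d v u) (m (P (d u v)) (P (P (d v u))) (m a (d u v) (d u v))) (P (d v u)) = tau v u a"
proof -
  have u: "u \<in> U" using C_U a by blast
  note duv = d_closed[OF u v] and dvu = d_closed[OF v u]
  have t: "tau v u a \<in> C v v v" using tau_closed[OF a v] .
  have "m a (d u v) (d u v) = m (st u u u (d u u) a) (d u v) (d u v)"
    using st_single[OF a] by simp
  also have "\<dots> = st u u v (m (d u u) (d u v) (d u v)) a"
    by (rule m_st_first[OF zero_closed[OF u] duv duv a])
  also have "m (d u u) (d u v) (d u v) = d u v"
    using m_degenerate1[OF duv] P_d[OF u] by simp
  finally have 1: "m a (d u v) (d u v) = st u u v (d u v) a" .
  have 2: "m (P (d u v)) (P (P (d v u))) (st u u v (d u v) a) = st u v v (P (P (d v u))) a"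
    using m_st_third[OF P_closed[OF duv] PP_closed[OF dvu] duv a] m_degenerate1[OF PP_closed[OF dvu]] by simp
  \<comment> \<open>The last tetrahedron has the label \<open>u\<close> only at its inner vertex and
    \<open>v\<close> at all others. So \<open>m_st\<close> has to transport \<open>a\<close> from
    \<open>u\<close> to \<open>v\<close>, and this is where \<open>tau\<close> enters.\<close>
  have "m (st v v u (d v u) (d v v)) (st u v v (P (P (d v u))) a) (st v u v (P (d v u)) (d v v)) =
    st v v v (m (d v u) (P (P (d v u))) (P (d v u))) (plus v (plus v (d v v) (tau v u a)) (d v v))"
    by (rule m_st[OF dvu PP_closed[OF dvu] P_closed[OF dvu] zero_closed[OF v] a zero_closed[OF v]])
  moreover have "m (d v u) (P (P (d v u))) (P (d v u)) = d v v"
    using m_fold[OF P_closed[OF dvu]] PPQ[OF dvu] Q_d[OF v u] by simp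
  ultimately have "m (d v u) (st u v v (P (P (d v u))) a) (P (d v u)) = st v v v (d v v) (tau v u a)"
    using st_zero[OF dvu] st_zero[OF P_closed[OF dvu]] plus_zero_left[OF v t] plus_zero_right[OF v t] by simp
  then show ?thesis unfolding 1 2 using st_single[OF t] by simp
qed

end

section \<open>The second homotopy group\<close>

lemma square_boundary_iff:
  "(u, v) \<in> square_boundary \<longleftrightarrow> 0 \<le> u \<and> u \<le> 1 \<and> 0 \<le> v \<and> v \<le> 1 \<and> (u = 0 \<or> u = 1 \<or> v = 0 \<or> v = 1)"
  by (auto simp: square_boundary_def)

lemma square_boundary_subset: "square_boundary \<subseteq> unit_square"
  by (auto simp: square_boundary_def)

lemma mem_spheroid_class:
  "f' \<in> spheroid_class M m0 f \<longleftrightarrow>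
     (\<exists>h. continuous_on ({0..1::real} \<times> unit_square) h \<and> h ` ({0..1} \<times> unit_square) \<subseteq> M \<and>
        (\<forall>z\<in>unit_square. h (0, z) = f z) \<and> (\<forall>z\<in>unit_square. h (1, z) = f' z) \<and>
        (\<forall>t\<in>{0..1}. \<forall>z\<in>square_boundary. h (t, z) = m0))"
  unfolding spheroid_class_def mem_Collect_eq
proof (subst homotopic_with, goal_cases)
  case (1 h k)
  then have "h x = k x" if "x \<in> square_boundary" for x
    using that square_boundary_subset by (metis subsetD topspace_euclidean_subtopology)
  then show ?case by auto
next
  case 2
  show ?case by (auto simp: image_subset_iff)
qed

lemma spheroid_class_I:
  assumes "continuous_on ({0..1::real} \<times> unit_square) h" "h ` ({0..1} \<times> unit_square) \<subseteq> M"
    "\<And>z. z \<in> unit_square \<Longrightarrow> h (0, z) = f z" "\<And>z. z \<in> unit_square \<Longrightarrow> h (1, z) = f' z"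
    "\<And>t z. \<lbrakk>0 \<le> t; t \<le> 1; z \<in> square_boundary\<rbrakk> \<Longrightarrow> h (t, z) = m0"
  shows "f' \<in> spheroid_class M m0 f"
  unfolding mem_spheroid_class
proof (intro exI[of _ h] conjI ballI)
  fix t :: real and z assume "t \<in> {0..1}" "z \<in> square_boundary"
  then show "h (t, z) = m0" using assms(5)[of t z] by simp
qed (rule assms; assumption)+

lemma spheroid_class_E:
  assumes "f' \<in> spheroid_class M m0 f"
  obtains h where "continuous_on ({0..1} \<times> unit_square) h" "h ` ({0..1} \<times> unit_square) \<subseteq> M"
    "\<And>z. z \<in> unit_square \<Longrightarrow> h (0::real, z) = f z" "\<And>z. z \<in> unit_square \<Longrightarrow> h (1, z) = f' z"
    "\<And>t z. \<lbrakk>t \<in> {0..1}; z \<in> square_boundary\<rbrakk> \<Longrightarrow> h (t, z) = m0"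
proof -
  obtain h where h: "continuous_on ({0..1} \<times> unit_square) h" "h ` ({0..1} \<times> unit_square) \<subseteq> M"
    "\<forall>z\<in>unit_square. h (0::real, z) = f z" "\<forall>z\<in>unit_square. h (1, z) = f' z"
    "\<forall>t\<in>{0..1}. \<forall>z\<in>square_boundary. h (t, z) = m0"
    using assms unfolding mem_spheroid_class by (elim exE conjE) (rule that)
  show thesis
    by (rule that[OF h(1,2) bspec[OF h(3)] bspec[OF h(4)] bspec[OF bspec[OF h(5)]]])
qed

lemma spheroid_class_sym: "f' \<in> spheroid_class M m0 f \<Longrightarrow> f \<in> spheroid_class M m0 f'"
  unfolding spheroid_class_def mem_Collect_eq by (rule homotopic_with_symD)

lemma spheroid_class_trans:
  "\<lbrakk>f' \<in> spheroid_class M m0 f; f'' \<in> spheroid_class M m0 f'\<rbrakk> \<Longrightarrow> f'' \<in> spheroid_class M m0 f"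
  unfolding spheroid_class_def mem_Collect_eq by (rule homotopic_with_trans)

lemma spheroid_class_eq: "f' \<in> spheroid_class M m0 f \<Longrightarrow> spheroid_class M m0 f' = spheroid_class M m0 f"
  using spheroid_class_trans spheroid_class_sym by blast

lemma spheroidsD:
  assumes "f \<in> spheroids M m0"
  shows "continuous_on unit_square f" "f ` unit_square \<subseteq> M" "z \<in> square_boundary \<Longrightarrow> f z = m0"
  using assms by (simp_all only: spheroids_def mem_Collect_eq)

lemma spheroidsI:
  assumes "continuous_on unit_square f" "f ` unit_square \<subseteq> M" "\<And>z. z \<in> square_boundary \<Longrightarrow> f z = m0"
  shows "f \<in> spheroids M m0"
  unfolding spheroids_def using assms by blast

lemma spheroid_class_linear:
  fixes \<omega> :: "'e::real_normed_vector \<Rightarrow> 'a::topological_space"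
  assumes \<omega>: "continuous_on K \<omega>" "\<omega> ` K \<subseteq> M" "convex K"
    and f: "continuous_on unit_square f" "f ` unit_square \<subseteq> K"
    and g: "continuous_on unit_square g" "g ` unit_square \<subseteq> K"
    and bd: "\<And>t z. \<lbrakk>0 \<le> t; t \<le> 1; z \<in> square_boundary\<rbrakk>
      \<Longrightarrow> \<omega> ((1 - t) *\<^sub>R f z + t *\<^sub>R g z) = m0"
  shows "(\<lambda>z. \<omega> (g z)) \<in> spheroid_class M m0 (\<lambda>z. \<omega> (f z))"
proof (rule spheroid_class_I[where h = "\<lambda>p. \<omega> ((1 - fst p) *\<^sub>R f (snd p) + fst p *\<^sub>R g (snd p))"])
  have K: "(1 - t) *\<^sub>R f z + t *\<^sub>R g z \<in> K" if "0 \<le> t" "t \<le> 1" "z \<in> unit_square" for t z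
    using f(2) g(2) that by (intro convexD_alt[OF \<omega>(3)]) blast+
  show "continuous_on ({0..1} \<times> unit_square) (\<lambda>p. \<omega> ((1 - fst p) *\<^sub>R f (snd p) + fst p *\<^sub>R g (snd p)))"
  proof (rule continuous_on_compose2[OF \<omega>(1)])
    show "continuous_on ({0..1} \<times> unit_square) (\<lambda>p. (1 - fst p) *\<^sub>R f (snd p) + fst p *\<^sub>R g (snd p))"
      by (intro continuous_intros continuous_on_compose2[OF f(1)] continuous_on_compose2[OF g(1)]) auto
    show "(\<lambda>p. (1 - fst p) *\<^sub>R f (snd p) + fst p *\<^sub>R g (snd p)) ` ({0..1} \<times> unit_square) \<subseteq> K"
      by (rule image_subsetI) (auto intro!: K simp del: mem_Sigma_iff simp: mem_Times_iff)
  qed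
  show "(\<lambda>p. \<omega> ((1 - fst p) *\<^sub>R f (snd p) + fst p *\<^sub>R g (snd p))) ` ({0..1} \<times> unit_square) \<subseteq> M"
    by (rule image_subsetI) (auto intro!: subsetD[OF \<omega>(2)] imageI K simp del: mem_Sigma_iff simp: mem_Times_iff)
qed (use bd in simp_all)

subsection \<open>Squares and triangles\<close>

text \<open>In the coordinates (x1, x2) the square of side 1/2 at the vertex 0 is enlarged to the
  unit square and the rest is clipped to its boundary. This is no homeomorphism, but it is
  invertible up to homotopy.\<close>

definition to_square :: "real \<times> real \<times> real \<Rightarrow> real \<times> real" where
  "to_square = (\<lambda>(x0, x1, x2). (min 1 (2 * x1), min 1 (2 * x2)))"

text \<open>In the coordinates (x1, x2) this is the identity below the line u + v = 1 and the
  orthogonal projection onto that line above it.\<close>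

definition to_triangle :: "real \<times> real \<Rightarrow> real \<times> real \<times> real" where
  "to_triangle = (\<lambda>(u, v). (max 0 (1 - u - v), u - max 0 (u + v - 1) / 2, v - max 0 (u + v - 1) / 2))"

lemma to_square: "continuous_on S to_square" "x \<in> simplex2 \<Longrightarrow> to_square x \<in> unit_square"
  "x \<in> simplex2_boundary \<Longrightarrow> to_square x \<in> square_boundary"
proof -
  show "continuous_on S to_square"
    unfolding to_square_def case_prod_beta by (intro continuous_intros)
  show "x \<in> simplex2 \<Longrightarrow> to_square x \<in> unit_square"
    by (cases x) (auto simp: to_square_def simplex2_def)
  assume x: "x \<in> simplex2_boundary"
  obtain x0 x1 x2 where "x = (x0, x1, x2)" by (metis prod_cases3)
  then show "to_square x \<in> square_boundary"
    using x by (auto simp: to_square_def simplex2_boundary_def simplex2_def square_boundary_iff min_def)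
qed

lemma to_triangle: "continuous_on S to_triangle" "z \<in> unit_square \<Longrightarrow> to_triangle z \<in> simplex2"
  "z \<in> square_boundary \<Longrightarrow> to_triangle z \<in> simplex2_boundary"
proof -
  show "continuous_on S to_triangle"
    unfolding to_triangle_def case_prod_beta by (intro continuous_intros) auto
  show "z \<in> unit_square \<Longrightarrow> to_triangle z \<in> simplex2"
    by (cases z) (auto simp: to_triangle_def simplex2_def max_def field_simps)
  assume z: "z \<in> square_boundary"
  obtain u v where "z = (u, v)" by fastforce
  then show "to_triangle z \<in> simplex2_boundary"
    using z by (auto simp: to_triangle_def simplex2_boundary_def simplex2_def square_boundary_iff max_def field_simps)
qed

text \<open>The composite maps each side of the square into itself, so straight segments between a
  boundary point and its image stay in the boundary. The next lemma is the same for the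
  triangle.\<close>

lemma segment_to_square_to_triangle:
  fixes t :: real
  assumes "z \<in> square_boundary" "0 \<le> t" "t \<le> 1"
  shows "(1 - t) *\<^sub>R z + t *\<^sub>R to_square (to_triangle z) \<in> square_boundary"
proof -
  obtain u v where z: "z = (u, v)" by fastforce
  obtain u' v' where z': "to_square (to_triangle z) = (u', v')" by fastforce
  have b: "0 \<le> u" "u \<le> 1" "0 \<le> v" "v \<le> 1" "0 \<le> u'" "u' \<le> 1" "0 \<le> v'" "v' \<le> 1"
  proof -
    have "z \<in> unit_square" using assms(1) square_boundary_subset by blast
    moreover from this have "to_square (to_triangle z) \<in> unit_square" by (intro to_square(2) to_triangle(2))
    ultimately show "0 \<le> u" "u \<le> 1" "0 \<le> v" "v \<le> 1" "0 \<le> u'" "u' \<le> 1" "0 \<le> v'" "v' \<le> 1"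
      unfolding z' by (simp_all add: z)
  qed
  have e: "u = 0 \<Longrightarrow> u' = 0" "v = 0 \<Longrightarrow> v' = 0" "u = 1 \<Longrightarrow> u' = 1" "v = 1 \<Longrightarrow> v' = 1"
    using z' b by (auto simp: z to_square_def to_triangle_def max_def min_def split: if_splits)
  have c: "(1 - t) * p + t * q \<in> {0..1}" if "0 \<le> p" "p \<le> 1" "0 \<le> q" "q \<le> 1" for p q :: real
    using convexD_alt[of "{0..1::real}" p q t] that assms by simp
  show ?thesis
    using c[of u u'] c[of v v'] b assms(1) e unfolding z' unfolding z by (auto simp: square_boundary_iff z)
qed

lemma segment_to_triangle_to_square:
  fixes t :: real
  assumes "x \<in> simplex2_boundary" "0 \<le> t" "t \<le> 1"
  shows "(1 - t) *\<^sub>R x + t *\<^sub>R to_triangle (to_square x) \<in> simplex2_boundary"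
proof -
  obtain x0 x1 x2 where x: "x = (x0, x1, x2)" by (metis prod_cases3)
  obtain y0 y1 y2 where y: "to_triangle (to_square x) = (y0, y1, y2)" by (metis prod_cases3)
  have xs: "x \<in> simplex2" using assms(1) simplex2_boundary_subset by blast
  have s: "(1 - t) *\<^sub>R x + t *\<^sub>R to_triangle (to_square x) \<in> simplex2"
    using convexD_alt[OF convex_simplex2 xs to_triangle(2)[OF to_square(2)[OF xs]] assms(2,3)] .
  have "x0 = 0 \<or> x1 = 0 \<or> x2 = 0" using assms(1) by (simp add: x simplex2_boundary_def)
  moreover have "x0 = 0 \<Longrightarrow> y0 = 0" "x1 = 0 \<Longrightarrow> y1 = 0" "x2 = 0 \<Longrightarrow> y2 = 0"
    using y xs by (auto simp: x to_square_def to_triangle_def simplex2_def max_def min_def field_simps split: if_splits)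
  ultimately show ?thesis
    using s unfolding y unfolding x by (auto simp: simplex2_boundary_def)
qed

definition Phi :: "'a::topological_space set \<Rightarrow> (real \<times> real \<Rightarrow> 'a) set \<Rightarrow> (real \<times> real \<times> real \<Rightarrow> 'a) set" where
  "Phi M X = (\<Union>f\<in>X. triangle_class M (\<lambda>x. f (to_square x)))"

lemma spheroid_class_refl:
  assumes "f \<in> spheroids M m0"
  shows "f \<in> spheroid_class M m0 f"
proof (rule spheroid_class_I[where h = "\<lambda>p. f (snd p)"])
  show "continuous_on ({0..1::real} \<times> unit_square) (\<lambda>p. f (snd p))"
    by (rule continuous_on_compose2[OF spheroidsD(1)[OF assms]]) (auto intro!: continuous_intros)
qed (use spheroidsD(2,3)[OF assms] in auto)

lemma spheroid_class_spheroids: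
  assumes "f \<in> spheroids M m0" "f' \<in> spheroid_class M m0 f"
  shows "f' \<in> spheroids M m0"
proof -
  have h: "homotopic_with_canon (\<lambda>h. \<forall>z\<in>square_boundary. h z = m0) unit_square M f f'"
    using assms(2) by (simp add: spheroid_class_def)
  show ?thesis
    using homotopic_with_imp_continuous[OF h] homotopic_with_imp_subset2[OF h] homotopic_with_imp_property[OF h]
    unfolding spheroids_def by blast
qed

lemma to_square_class:
  assumes "f' \<in> spheroid_class M m0 f" "f \<in> spheroids M m0"
  shows "(\<lambda>x. f' (to_square x)) \<in> triangle_class M (\<lambda>x. f (to_square x))"
proof -
  obtain h where h: "continuous_on ({0..1} \<times> unit_square) h" "h ` ({0..1} \<times> unit_square) \<subseteq> M"
    "\<And>z. z \<in> unit_square \<Longrightarrow> h (0::real, z) = f z" "\<And>z. z \<in> unit_square \<Longrightarrow> h (1, z) = f' z"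
    "\<And>t z. \<lbrakk>t \<in> {0..1}; z \<in> square_boundary\<rbrakk> \<Longrightarrow> h (t, z) = m0"
    by (rule spheroid_class_E[OF assms(1)]) (rule that)
  show ?thesis
  proof (rule triangle_class_I[where h = "\<lambda>p. h (fst p, to_square (snd p))"])
    have mem: "(fst p, to_square (snd p)) \<in> {0..1} \<times> unit_square"
      if "p \<in> {0..1} \<times> simplex2" for p :: "real \<times> real \<times> real \<times> real"
      using that by (intro SigmaI to_square(2)) (simp_all only: mem_Times_iff)
    show "continuous_on ({0..1} \<times> simplex2) (\<lambda>p. h (fst p, to_square (snd p)))"
    proof (rule continuous_on_compose2[OF h(1)])
      show "continuous_on ({0..1} \<times> simplex2) (\<lambda>p. (fst p, to_square (snd p)))"
        by (intro continuous_intros continuous_on_compose2[OF to_square(1)[of UNIV]]) auto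
    qed (rule image_subsetI, rule mem)
    show "(\<lambda>p. h (fst p, to_square (snd p))) ` ({0..1} \<times> simplex2) \<subseteq> M"
      by (rule image_subsetI) (rule subsetD[OF h(2)], rule imageI, rule mem)
  qed (use h(3-5) to_square(2,3) spheroidsD(3)[OF assms(2)] in auto)
qed

lemma Phi_eq:
  assumes "f \<in> spheroids M m0"
  shows "Phi M (spheroid_class M m0 f) = triangle_class M (\<lambda>x. f (to_square x))"
proof -
  have "triangle_class M (\<lambda>x. f' (to_square x)) = triangle_class M (\<lambda>x. f (to_square x))"
    if "f' \<in> spheroid_class M m0 f" for f'
    by (rule triangle_class_eq[OF to_square_class[OF that assms]])
  then show ?thesis unfolding Phi_def using spheroid_class_refl[OF assms] by blast
qed

lemma to_triangle_class:
  assumes "a' \<in> triangle_class M a" "\<And>x. x \<in> simplex2_boundary \<Longrightarrow> a x = m0"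
  shows "(\<lambda>z. a' (to_triangle z)) \<in> spheroid_class M m0 (\<lambda>z. a (to_triangle z))"
proof -
  obtain h where h: "continuous_on ({0..1} \<times> simplex2) h" "h ` ({0..1} \<times> simplex2) \<subseteq> M"
    "\<And>x. x \<in> simplex2 \<Longrightarrow> h (0::real, x) = a x" "\<And>x. x \<in> simplex2 \<Longrightarrow> h (1, x) = a' x"
    "\<And>t x. \<lbrakk>t \<in> {0..1}; x \<in> simplex2_boundary\<rbrakk> \<Longrightarrow> h (t, x) = a x"
    by (rule triangle_class_E[OF assms(1)]) (rule that)
  show ?thesis
  proof (rule spheroid_class_I[where h = "\<lambda>p. h (fst p, to_triangle (snd p))"])
    show "continuous_on ({0..1} \<times> unit_square) (\<lambda>p. h (fst p, to_triangle (snd p)))"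
      by (rule continuous_on_compose2[OF h(1)])
        (auto intro!: continuous_intros continuous_on_compose2[OF to_triangle(1)[of UNIV]] to_triangle(2))
    show "(\<lambda>p. h (fst p, to_triangle (snd p))) ` ({0..1} \<times> unit_square) \<subseteq> M"
    proof (rule image_subsetI)
      fix p :: "real \<times> real \<times> real" assume "p \<in> {0..1} \<times> unit_square"
      then have "(fst p, to_triangle (snd p)) \<in> {0..1} \<times> simplex2"
        by (intro SigmaI to_triangle(2)) (simp_all only: mem_Times_iff)
      then show "h (fst p, to_triangle (snd p)) \<in> M" using h(2) by blast
    qed
  next
    fix t :: real and z assume "0 \<le> t" "t \<le> 1" "z \<in> square_boundary"
    then show "h (fst (t, z), to_triangle (snd (t, z))) = m0"
      using h(5)[of t "to_triangle z"] to_triangle(3) assms(2) by simp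
  next
    fix z assume "z \<in> unit_square"
    note z = to_triangle(2)[OF this]
    show "h (fst (0, z), to_triangle (snd (0, z))) = a (to_triangle z)"
      "h (fst (1, z), to_triangle (snd (1, z))) = a' (to_triangle z)"
      using h(3,4)[OF z] by simp_all
  qed
qed

lemma spheroid_to_square_to_triangle:
  assumes "f \<in> spheroids M m0"
  shows "(\<lambda>z. f (to_square (to_triangle z))) \<in> spheroid_class M m0 f"
proof -
  note f = spheroidsD[OF assms]
  show ?thesis
  proof (rule spheroid_class_linear[OF f(1,2), where f = "\<lambda>z. z", simplified])
    show "convex unit_square" by (intro convex_Times) auto
    show "continuous_on unit_square (\<lambda>z. to_square (to_triangle z))"
      by (rule continuous_on_compose2[OF to_square(1)[of UNIV] to_triangle(1)]) auto
    show "(\<lambda>z. to_square (to_triangle z)) ` unit_square \<subseteq> unit_square"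
      by (rule image_subsetI) (rule to_square(2)[OF to_triangle(2)])
  qed (rule f(3)[OF segment_to_square_to_triangle])
qed

context loop_space
begin

lemma Tri_single_boundary:
  assumes "a \<in> Tri u u u" "x \<in> simplex2_boundary"
  shows "a x = m0"
proof -
  obtain x0 x1 x2 where x: "x = (x0, x1, x2)" by (metis prod_cases3)
  note u = TriD(1)[OF assms(1)]
  have s: "0 \<le> x0" "0 \<le> x1" "0 \<le> x2" "x0 + x1 + x2 = 1" "x0 = 0 \<or> x1 = 0 \<or> x2 = 0"
    using assms(2) by (auto simp: x simplex2_boundary_def simplex2_def)
  then show ?thesis
    using TriD(6)[OF assms(1), of x0 x1] TriD(7)[OF assms(1), of x1 x2] TriD(8)[OF assms(1), of x0 x2]
      L_same[OF u, of x0] L_same[OF u, of x1] by (auto simp: x)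
qed

lemma Tri_single:
  assumes "u \<in> carrier G" "continuous_on simplex2 a" "a ` simplex2 \<subseteq> M"
    "\<And>x. x \<in> simplex2_boundary \<Longrightarrow> a x = m0"
  shows "a \<in> Tri u u u"
proof (rule TriI[OF assms(1) assms(1) assms(1-3)])
  fix p q :: real assume pq: "0 \<le> p" "0 \<le> q" "p + q = 1"
  then have "(p, q, 0) \<in> simplex2_boundary" "(0, p, q) \<in> simplex2_boundary" "(p, 0, q) \<in> simplex2_boundary"
    by (auto simp: simplex2_boundary_def simplex2_def)
  then show "a (p, q, 0) = lift u u p" "a (0, p, q) = lift u u p" "a (p, 0, q) = lift u u p"
    using assms(4) L_same[OF assms(1), of p] pq by auto
qed

lemma spheroid_Tri:
  assumes "f \<in> spheroids M m0" "u \<in> carrier G"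
  shows "(\<lambda>x. f (to_square x)) \<in> Tri u u u"
proof (rule Tri_single[OF assms(2)])
  note f = spheroidsD[OF assms(1)]
  show "continuous_on simplex2 (\<lambda>x. f (to_square x))"
    by (rule continuous_on_compose2[OF f(1) to_square(1)]) (rule image_subsetI, rule to_square(2))
  show "(\<lambda>x. f (to_square x)) ` simplex2 \<subseteq> M"
    by (rule image_subsetI) (rule subsetD[OF f(2)], rule imageI, rule to_square(2))
  show "f (to_square x) = m0" if "x \<in> simplex2_boundary" for x
    by (rule f(3)[OF to_square(3)[OF that]])
qed

lemma pi2_carrier: "x \<in> carrier (pi2 M m0) \<longleftrightarrow> (\<exists>f\<in>spheroids M m0. x = spheroid_class M m0 f)"
  by (auto simp: pi2_def)

text \<open>The inverse is induced by \<open>to_triangle\<close>: both composites are joined to the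
  identity by straight lines that keep the boundary within itself, where the maps in question have
  the constant value \<open>m0\<close>.\<close>

lemma Phi_bij:
  assumes "u \<in> carrier G"
  shows "bij_betw (Phi M) (carrier (pi2 M m0)) (Cell u u u)"
  unfolding bij_betw_def
proof
  show "inj_on (Phi M) (carrier (pi2 M m0))"
  proof (rule inj_onI)
    fix x y assume "x \<in> carrier (pi2 M m0)" "y \<in> carrier (pi2 M m0)" and eq: "Phi M x = Phi M y"
    then obtain f g where f: "f \<in> spheroids M m0" "x = spheroid_class M m0 f"
      and g: "g \<in> spheroids M m0" "y = spheroid_class M m0 g" unfolding pi2_carrier by blast
    have "triangle_class M (\<lambda>x. f (to_square x)) = triangle_class M (\<lambda>x. g (to_square x))"
      using eq unfolding f(2) g(2) Phi_eq[OF f(1)] Phi_eq[OF g(1)] .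
    then have "(\<lambda>x. g (to_square x)) \<in> triangle_class M (\<lambda>x. f (to_square x))"
      using Tri_class_refl[OF spheroid_Tri[OF g(1) assms]] by simp
    then have "(\<lambda>z. g (to_square (to_triangle z))) \<in> spheroid_class M m0 (\<lambda>z. f (to_square (to_triangle z)))"
      by (rule to_triangle_class) (rule Tri_single_boundary[OF spheroid_Tri[OF f(1) assms]])
    then have "spheroid_class M m0 (\<lambda>z. g (to_square (to_triangle z))) = spheroid_class M m0 (\<lambda>z. f (to_square (to_triangle z)))"
      by (rule spheroid_class_eq)
    then show "x = y"
      using spheroid_class_eq[OF spheroid_to_square_to_triangle[OF f(1)]]
        spheroid_class_eq[OF spheroid_to_square_to_triangle[OF g(1)]] by (simp add: f(2) g(2))
  qed
  show "Phi M ` carrier (pi2 M m0) = Cell u u u"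
  proof (intro equalityI subsetI)
    fix A assume "A \<in> Phi M ` carrier (pi2 M m0)"
    then obtain f where f: "f \<in> spheroids M m0" "A = Phi M (spheroid_class M m0 f)"
      unfolding pi2_def by auto
    then show "A \<in> Cell u u u"
      unfolding f(2) Phi_eq[OF f(1)] by (intro CellI spheroid_Tri assms)
  next
    fix A assume "A \<in> Cell u u u"
    then obtain a where a: "a \<in> Tri u u u" "A = triangle_class M a" by (rule Cell_E)
    define f where "f = (\<lambda>z. a (to_triangle z))"
    have f: "f \<in> spheroids M m0"
    proof (rule spheroidsI)
      show "continuous_on unit_square f" unfolding f_def
        by (rule continuous_on_compose2[OF TriD(4)[OF a(1)] to_triangle(1)]) (rule image_subsetI, rule to_triangle(2))
      show "f ` unit_square \<subseteq> M" unfolding f_def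
        by (rule image_subsetI) (rule subsetD[OF TriD(5)[OF a(1)]], rule imageI, rule to_triangle(2))
      show "f z = m0" if "z \<in> square_boundary" for z
        unfolding f_def by (rule Tri_single_boundary[OF a(1) to_triangle(3)[OF that]])
    qed
    have "(\<lambda>x. a (to_triangle (to_square x))) \<in> triangle_class M (\<lambda>x. a x)"
    proof (rule triangle_class_linear[OF TriD(4,5)[OF a(1)] convex_simplex2])
      show "continuous_on simplex2 (\<lambda>x. to_triangle (to_square x))"
        by (rule continuous_on_compose2[OF to_triangle(1)[of UNIV] to_square(1)]) auto
      show "(\<lambda>x. to_triangle (to_square x)) ` simplex2 \<subseteq> simplex2"
        by (rule image_subsetI) (rule to_triangle(2)[OF to_square(2)])
      show "a ((1 - t) *\<^sub>R x + t *\<^sub>R to_triangle (to_square x)) = a x"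
        if "0 \<le> t" "t \<le> 1" "x \<in> simplex2_boundary" for t x
        using Tri_single_boundary[OF a(1) segment_to_triangle_to_square[OF that(3,1,2)]]
          Tri_single_boundary[OF a(1) that(3)] by simp
    qed auto
    then have "triangle_class M (\<lambda>x. a (to_triangle (to_square x))) = triangle_class M a"
      by (rule triangle_class_eq)
    then have "A = Phi M (spheroid_class M m0 f)"
      using Phi_eq[OF f] a(2) by (simp add: f_def)
    then show "A \<in> Phi M ` carrier (pi2 M m0)"
      using f unfolding pi2_carrier[symmetric] by (auto simp: pi2_def)
  qed
qed

end

subsection \<open>The group structure\<close>

lemma spheroid_join_spheroids:
  fixes M :: "'a::topological_space set"
  assumes "f \<in> spheroids M m0" "f' \<in> spheroids M m0"
  shows "spheroid_join f f' \<in> spheroids M m0"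
proof (rule spheroidsI)
  note f = spheroidsD[OF assms(1)] and f' = spheroidsD[OF assms(2)]
  have "continuous_on unit_square
    (\<lambda>z. if fst z - 1/2 \<le> 0 then f (2 * fst z, snd z) else f' (2 * fst z - 1, snd z))"
  proof (rule continuous_on_cases_le)
    show "continuous_on {z \<in> unit_square. fst z - 1/2 \<le> 0} (\<lambda>z. f (2 * fst z, snd z))"
      by (rule continuous_on_compose2[OF f(1)]) (auto intro!: continuous_intros)
    show "continuous_on {z \<in> unit_square. 0 \<le> fst z - 1/2} (\<lambda>z. f' (2 * fst z - 1, snd z))"
      by (rule continuous_on_compose2[OF f'(1)]) (auto intro!: continuous_intros)
    fix z :: "real \<times> real" assume z: "z \<in> unit_square" "fst z - 1/2 = 0"
    then have "(2 * fst z, snd z) \<in> square_boundary" "(2 * fst z - 1, snd z) \<in> square_boundary"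
      by (auto simp: square_boundary_iff)
    then show "f (2 * fst z, snd z) = f' (2 * fst z - 1, snd z)"
      using f(3) f'(3) by simp
  qed (intro continuous_intros)
  moreover have "spheroid_join f f' =
    (\<lambda>z. if fst z - 1/2 \<le> 0 then f (2 * fst z, snd z) else f' (2 * fst z - 1, snd z))"
    by (auto simp: spheroid_join_def case_prod_beta)
  ultimately show "continuous_on unit_square (spheroid_join f f')" by simp
  show "spheroid_join f f' ` unit_square \<subseteq> M"
    using f(2) f'(2) by (auto simp: spheroid_join_def image_subset_iff)
  fix z assume z: "z \<in> square_boundary"
  obtain u v where "z = (u, v)" by fastforce
  then show "spheroid_join f f' z = m0"
    using z f(3)[of "(2 * u, v)"] f'(3)[of "(2 * u - 1, v)"]
    by (auto simp: spheroid_join_def square_boundary_iff)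
qed

text \<open>Clipping moves outside coordinates to the boundary of the square, where a spheroid is
  \<open>m0\<close>; so \<open>f (clip p, clip q)\<close> is \<open>f\<close> extended by
  \<open>m0\<close> to the whole plane.\<close>

definition clip :: "real \<Rightarrow> real" where
  "clip y = max 0 (min 1 y)"

lemma clip: "0 \<le> clip y" "clip y \<le> 1" "y \<le> 0 \<Longrightarrow> clip y = 0" "1 \<le> y \<Longrightarrow> clip y = 1"
  "0 \<le> y \<Longrightarrow> clip y = min 1 y"
  by (auto simp: clip_def)

text \<open>Two squares placed side by side in the triangle. At \<open>r = 0\<close> they form the two halves of
  the square that carries \<open>spheroid_join\<close>; at \<open>r = 1\<close> they lie in two of the three parts of the
  barycentric subdivision. The form of the third coordinate keeps them disjoint.\<close>

definition two_squares ::
  "(real \<times> real \<Rightarrow> 'a) \<Rightarrow> (real \<times> real \<Rightarrow> 'a) \<Rightarrow> real \<times> real \<times> real \<times> real \<Rightarrow> 'a" where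
  "two_squares f f' = (\<lambda>(r, x0, x1, x2).
     let \<phi> = (4 + 2 * r) * x2; \<psi> = 2 * (x0 - r * x2) in
     if max (\<phi> - 1) (\<psi> - 1) \<le> 0 then f (clip \<phi>, clip \<psi>)
     else f' (clip (\<phi> - 1 + r * (\<psi> - 1)), clip (2 * (x0 - r * x1))))"

lemma two_squares_continuous:
  fixes M :: "'a::topological_space set"
  assumes "f \<in> spheroids M m0" "f' \<in> spheroids M m0"
  shows "continuous_on ({0..1} \<times> simplex2) (two_squares f f')"
proof -
  note f = spheroidsD[OF assms(1)] and f' = spheroidsD[OF assms(2)]
  let ?\<phi> = "\<lambda>p::real \<times> real \<times> real \<times> real. (4 + 2 * fst p) * snd (snd (snd p))"
  let ?\<psi> = "\<lambda>p::real \<times> real \<times> real \<times> real. 2 * (fst (snd p) - fst p * snd (snd (snd p)))"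
  let ?\<phi>' = "\<lambda>p. ?\<phi> p - 1 + fst p * (?\<psi> p - 1)"
  let ?\<psi>' = "\<lambda>p::real \<times> real \<times> real \<times> real. 2 * (fst (snd p) - fst p * fst (snd (snd p)))"
  let ?S = "{0..1::real} \<times> simplex2"
  have 1: "continuous_on ?S (\<lambda>p. if max (?\<phi> p - 1) (?\<psi> p - 1) \<le> 0 then f (clip (?\<phi> p), clip (?\<psi> p))
     else f' (clip (?\<phi>' p), clip (?\<psi>' p)))"
  proof (rule continuous_on_cases_le)
    show "continuous_on {p \<in> ?S. max (?\<phi> p - 1) (?\<psi> p - 1) \<le> 0} (\<lambda>p. f (clip (?\<phi> p), clip (?\<psi> p)))"
      unfolding clip_def by (rule continuous_on_compose2[OF f(1)]) (auto intro!: continuous_intros)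
    show "continuous_on {p \<in> ?S. 0 \<le> max (?\<phi> p - 1) (?\<psi> p - 1)} (\<lambda>p. f' (clip (?\<phi>' p), clip (?\<psi>' p)))"
      unfolding clip_def by (rule continuous_on_compose2[OF f'(1)]) (auto intro!: continuous_intros)
    fix p assume p: "p \<in> ?S" and "max (?\<phi> p - 1) (?\<psi> p - 1) = 0"
    then have e: "?\<phi> p \<le> 1" "?\<psi> p \<le> 1" "?\<phi> p = 1 \<or> ?\<psi> p = 1"
      by (auto simp: max_def split: if_splits)
    have "0 \<le> fst p" using p by auto
    \<comment> \<open>On the interface neither \<open>?\<phi>\<close> nor \<open>?\<psi>\<close>
      exceeds 1, so \<open>?\<phi>'\<close> is at most 0 there. Hence both branches take the value
      \<open>m0\<close>.\<close>
    then have "fst p * (?\<psi> p - 1) \<le> 0" using e(2) by (intro mult_nonneg_nonpos) auto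
    then have "clip (?\<phi>' p) = 0" using e(1) by (intro clip(3)) simp
    then have "f' (clip (?\<phi>' p), clip (?\<psi>' p)) = m0"
      using clip(1,2) by (intro f'(3)) (simp add: square_boundary_iff)
    moreover have "f (clip (?\<phi> p), clip (?\<psi> p)) = m0"
      using e(3) clip(1,2,4) by (intro f(3)) (auto simp: square_boundary_iff)
    ultimately show "f (clip (?\<phi> p), clip (?\<psi> p)) = f' (clip (?\<phi>' p), clip (?\<psi>' p))" by simp
  qed (intro continuous_intros)
  have 2: "two_squares f f' = (\<lambda>p. if max (?\<phi> p - 1) (?\<psi> p - 1) \<le> 0 then f (clip (?\<phi> p), clip (?\<psi> p))
     else f' (clip (?\<phi>' p), clip (?\<psi>' p)))"
    by (rule ext) (simp add: two_squares_def case_prod_beta Let_def)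
  show ?thesis unfolding 2 by (rule 1)
qed

lemma two_squares_boundary:
  assumes f: "f \<in> spheroids M m0" "f' \<in> spheroids M m0"
    and r: "0 \<le> r" "r \<le> 1" and x: "(x0, x1, x2) \<in> simplex2_boundary"
  shows "two_squares f f' (r, x0, x1, x2) = m0"
proof -
  define \<phi> \<psi> \<phi>' \<psi>' where "\<phi> = (4 + 2 * r) * x2" and "\<psi> = 2 * (x0 - r * x2)"
    and "\<phi>' = \<phi> - 1 + r * (\<psi> - 1)" and "\<psi>' = 2 * (x0 - r * x1)"
  have H: "two_squares f f' (r, x0, x1, x2) =
    (if max (\<phi> - 1) (\<psi> - 1) \<le> 0 then f (clip \<phi>, clip \<psi>) else f' (clip \<phi>', clip \<psi>'))"
    by (simp add: two_squares_def Let_def \<phi>_def \<psi>_def \<phi>'_def \<psi>'_def)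
  have s: "0 \<le> x0" "0 \<le> x1" "0 \<le> x2" "x0 + x1 + x2 = 1" "x0 = 0 \<or> x1 = 0 \<or> x2 = 0"
    using x by (auto simp: simplex2_boundary_def simplex2_def)
  have F: "f (clip p, clip q) = m0" and F': "f' (clip p, clip q) = m0"
    if "p \<le> 0 \<or> 1 \<le> p \<or> q \<le> 0 \<or> 1 \<le> q" for p q
    using that clip by (auto intro!: spheroidsD(3)[OF f(1)] spheroidsD(3)[OF f(2)] simp: square_boundary_iff)
  consider "x0 = 0" | "x2 = 0" | "x1 = 0" using s(5) by blast
  then show ?thesis
  proof cases
    case 1
    have "0 \<le> r * x2" "0 \<le> r * x1" using r s by auto
    then have "\<psi> \<le> 0" "\<psi>' \<le> 0" using 1 by (auto simp: \<psi>_def \<psi>'_def)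
    then show ?thesis unfolding H using F F' by auto
  next
    case 2
    have "\<phi> \<le> 0" using 2 by (simp add: \<phi>_def)
    moreover have "r * (2 * x0 - 1) \<le> r * 1"
      using r s 2 by (intro mult_left_mono) auto
    then have "r * (2 * x0 - 1) \<le> 1" using r by simp
    then have "\<phi>' \<le> 0" using 2 by (simp add: \<phi>'_def \<phi>_def \<psi>_def)
    ultimately show ?thesis unfolding H using F F' by auto
  next
    \<comment> \<open>On this edge no single coordinate is clipped throughout. The first square is
      left through \<open>\<psi>\<close> wherever \<open>\<phi>\<close> is at most 1, and the second
      one through \<open>\<psi>'\<close> or \<open>\<phi>'\<close>.\<close>
    case 3
    then have x0: "x0 = 1 - x2" using s by simp
    have rx: "r * x2 \<le> x2" "0 \<le> r * x2" using r s by (auto intro: mult_left_le_one_le)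
    have f1: "1 \<le> \<psi>" if "\<phi> \<le> 1"
    proof -
      have "4 * x2 \<le> 1" using that rx by (simp add: \<phi>_def algebra_simps)
      then show ?thesis using rx by (simp add: \<psi>_def x0)
    qed
    have f2: "1 \<le> \<psi>' \<or> 1 \<le> \<phi>'"
    proof (cases "1 \<le> \<psi>'")
      case False
      then have x2: "1 \<le> 2 * x2" by (simp add: \<psi>'_def 3 x0)
      have "r * r \<le> r" "r * r \<le> 1" "r * r \<ge> 0" using r by (auto intro: mult_left_le_one_le mult_le_one)
      then have "(2 - r * r) * 1 \<le> (2 - r * r) * (2 * x2)"
        using x2 by (intro mult_left_mono) auto
      \<comment> \<open>With \<open>x2\<close> at least 1/2 this formula gives the lower bound
        \<open>1 + r - r * r\<close>, which is at least 1.\<close>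
      moreover have "\<phi>' = (2 - r * r) * (2 * x2) - 1 + r"
        by (simp add: \<phi>'_def \<phi>_def \<psi>_def x0 algebra_simps)
      ultimately show ?thesis using \<open>r * r \<le> r\<close> by simp
    qed auto
    show ?thesis unfolding H using F[of \<phi> \<psi>] F'[of \<phi>' \<psi>'] f1 f2 by auto
  qed
qed

lemma two_squares_0:
  assumes f: "f \<in> spheroids M m0" "f' \<in> spheroids M m0" and x: "(x0, x1, x2) \<in> simplex2"
  shows "two_squares f f' (0, x0, x1, x2) = spheroid_join f f' (min 1 (2 * x2), min 1 (2 * x0))"
proof -
  have s: "0 \<le> x0" "0 \<le> x1" "0 \<le> x2" "x0 + x1 + x2 = 1" using x by (auto simp: simplex2_def)
  have H: "two_squares f f' (0, x0, x1, x2) =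
    (if 4 * x2 \<le> 1 \<and> 2 * x0 \<le> 1 then f (4 * x2, 2 * x0) else f' (clip (4 * x2 - 1), clip (2 * x0)))"
    using s by (auto simp: two_squares_def Let_def clip)
  show ?thesis
  proof (cases "4 * x2 \<le> 1")
    case True
    then have "clip (4 * x2 - 1) = 0" "min 1 (2 * x2) \<le> 1/2" "min 1 (2 * x2) = 2 * x2" by (auto simp: clip)
    then have "spheroid_join f f' (min 1 (2 * x2), min 1 (2 * x0)) = f (4 * x2, min 1 (2 * x0))"
      and "f' (clip (4 * x2 - 1), clip (2 * x0)) = m0"
      using clip(1,2)[of "2 * x0"] by (auto simp: spheroid_join_def intro!: spheroidsD(3)[OF f(2)] simp: square_boundary_iff)
    moreover have "f (4 * x2, 1) = m0"
      using True s by (auto intro!: spheroidsD(3)[OF f(1)] simp: square_boundary_iff)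
    ultimately show ?thesis using True by (auto simp: H min_def)
  next
    case False
    then have "\<not> min 1 (2 * x2) \<le> 1/2" by (auto simp: min_def)
    moreover have "clip (4 * x2 - 1) = 2 * min 1 (2 * x2) - 1" "clip (2 * x0) = min 1 (2 * x0)"
      using False s by (auto simp: clip min_def)
    ultimately show ?thesis using False by (simp add: H spheroid_join_def)
  qed
qed

text \<open>The factor 6 is the factor 3 of \<open>fill\<close> times the factor 2 of
  \<open>to_square\<close>, and x0 + x1 + x2 = 1 brings the second square into the form produced by
  \<open>glue\<close>. The middle part of the subdivision carries the constant triangle, so there
  both sides are \<open>m0\<close>.\<close>

lemma two_squares_1:
  assumes f: "f \<in> spheroids M m0" "f' \<in> spheroids M m0" and x: "(x0, x1, x2) \<in> simplex2"
    and c: "\<And>x. x \<in> simplex2 \<Longrightarrow> c x = m0"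
  shows "two_squares f f' (1, x0, x1, x2) =
    glue (rotate (rotate (\<lambda>x. f (to_square x)))) c (rotate (rotate (\<lambda>x. f' (to_square x)))) (x0, x1, x2)"
proof -
  have s: "0 \<le> x0" "0 \<le> x1" "0 \<le> x2" "x0 + x1 + x2 = 1" using x by (auto simp: simplex2_def)
  have H: "two_squares f f' (1, x0, x1, x2) =
    (if 6 * x2 \<le> 1 \<and> 2 * (x0 - x2) \<le> 1 then f (clip (6 * x2), clip (2 * (x0 - x2)))
     else f' (clip (2 * (x2 - x1)), clip (2 * (x0 - x1))))"
  proof -
    have e: "6 * x2 - 1 + (2 * (x0 - x2) - 1) = 2 * (x2 - x1)" using s by (simp add: algebra_simps)
    show ?thesis unfolding two_squares_def Let_def prod.case mult_1 e[symmetric] by simp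
  qed
  have F: "f (clip p, clip q) = m0" and F': "f' (clip p, clip q) = m0"
    if "p \<le> 0 \<or> 1 \<le> p \<or> q \<le> 0 \<or> 1 \<le> q" for p q
    using that clip by (auto intro!: spheroidsD(3)[OF f(1)] spheroidsD(3)[OF f(2)] simp: square_boundary_iff)
  show ?thesis
  proof (cases "x2 \<le> min x0 x1")
    case True
    then have g: "glue (rotate (rotate (\<lambda>x. f (to_square x)))) c (rotate (rotate (\<lambda>x. f' (to_square x)))) (x0, x1, x2)
       = f (min 1 (6 * x2), min 1 (2 * (x0 - x2)))"
      by (simp add: glue_def fill_def to_square_def)
    have e: "clip (6 * x2) = min 1 (6 * x2)" "clip (2 * (x0 - x2)) = min 1 (2 * (x0 - x2))"
      using True s by (auto intro!: clip(5))
    show ?thesis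
    proof (cases "6 * x2 \<le> 1 \<and> 2 * (x0 - x2) \<le> 1")
      case A: True
      then show ?thesis unfolding H g e by simp
    next
      case A: False
      have "f (min 1 (6 * x2), min 1 (2 * (x0 - x2))) = m0"
        unfolding e[symmetric] by (rule F) (use A in auto)
      moreover have "f' (clip (2 * (x2 - x1)), clip (2 * (x0 - x1))) = m0"
        by (rule F') (use True in auto)
      ultimately show ?thesis by (simp only: H g if_not_P[OF A])
    qed
  next
    case A: False
    show ?thesis
    proof (cases "x0 \<le> x1")
      case True
      then have lt: "x0 < x2" using A by auto
      have "(3 * x0, x1 - x0, x2 - x0) \<in> simplex2" using s True lt by (simp add: simplex2_def)
      then have g: "glue (rotate (rotate (\<lambda>x. f (to_square x)))) c (rotate (rotate (\<lambda>x. f' (to_square x)))) (x0, x1, x2) = m0"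
        using A True c by (simp add: glue_def fill_def)
      have "f (clip (6 * x2), clip (2 * (x0 - x2))) = m0" by (rule F) (use lt in auto)
      moreover have "f' (clip (2 * (x2 - x1)), clip (2 * (x0 - x1))) = m0" by (rule F') (use True in auto)
      ultimately show ?thesis unfolding H g by simp
    next
      case B: False
      then have lt: "x1 < x2" "x1 < x0" using A by auto
      have g: "glue (rotate (rotate (\<lambda>x. f (to_square x)))) c (rotate (rotate (\<lambda>x. f' (to_square x)))) (x0, x1, x2)
         = f' (min 1 (2 * (x2 - x1)), min 1 (2 * (x0 - x1)))"
        using A B by (simp add: glue_def fill_def to_square_def)
      have N: "\<not> (6 * x2 \<le> 1 \<and> 2 * (x0 - x2) \<le> 1)" using s lt by auto
      have "clip (2 * (x2 - x1)) = min 1 (2 * (x2 - x1))" "clip (2 * (x0 - x1)) = min 1 (2 * (x0 - x1))"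
        using lt by (auto intro!: clip(5))
      then show ?thesis by (simp only: H if_not_P[OF N] g)
    qed
  qed
qed

context loop_space
begin

text \<open>\<open>P\<close> is trivial on cells with a single label, so the representative of the
  class may be rotated. The rotated representatives are those between which
  \<open>two_squares\<close> interpolates.\<close>

lemma Phi_rotate:
  assumes "f \<in> spheroids M m0" "u \<in> carrier G"
  shows "rotate (rotate (\<lambda>x. f (to_square x))) \<in> Tri u u u"
    "Phi M (spheroid_class M m0 f) = triangle_class M (rotate (rotate (\<lambda>x. f (to_square x))))"
proof -
  let ?a = "\<lambda>x. f (to_square x)"
  note a = spheroid_Tri[OF assms]
  show "rotate (rotate ?a) \<in> Tri u u u" by (rule rotate_Tri[OF rotate_Tri[OF a]])
  have "P_class M (P_class M (triangle_class M ?a)) = triangle_class M ?a"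
    using T.P_single[OF assms(2) CellI[OF a]] by simp
  then show "Phi M (spheroid_class M m0 f) = triangle_class M (rotate (rotate ?a))"
    unfolding Phi_eq[OF assms(1)] P_class_Tri[OF a] P_class_Tri[OF rotate_Tri[OF a]] by simp
qed

lemma Phi_join:
  assumes f: "f \<in> spheroids M m0" "f' \<in> spheroids M m0" and u: "u \<in> carrier G"
  shows "Phi M (spheroid_class M m0 (spheroid_join f f')) =
    T.plus u (Phi M (spheroid_class M m0 f)) (Phi M (spheroid_class M m0 f'))"
proof -
  let ?a = "rotate (rotate (\<lambda>x. f (to_square x)))" and ?b = "rotate (rotate (\<lambda>x. f' (to_square x)))"
  let ?j = "rotate (rotate (\<lambda>x. spheroid_join f f' (to_square x)))"
  note a = Phi_rotate[OF f(1) u] and b = Phi_rotate[OF f(2) u]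
    and j = Phi_rotate[OF spheroid_join_spheroids[OF f] u]
  have c: "degenerate u u x = m0" if "x \<in> simplex2" for x
    using that L_same[OF u] by (cases x) (auto simp: simplex2_def)
  have jx: "?j (x0, x1, x2) = spheroid_join f f' (min 1 (2 * x2), min 1 (2 * x0))" for x0 x1 x2
    by (simp add: to_square_def)
  have "glue ?a (degenerate u u) ?b \<in> triangle_class M ?j"
  proof (rule triangle_class_I[OF two_squares_continuous[OF f]])
    show "two_squares f f' ` ({0..1} \<times> simplex2) \<subseteq> M"
    proof (rule image_subsetI)
      fix p :: "real \<times> real \<times> real \<times> real" assume "p \<in> {0..1} \<times> simplex2"
      show "two_squares f f' p \<in> M"
        using subsetD[OF spheroidsD(2)[OF f(1)]] subsetD[OF spheroidsD(2)[OF f(2)]] clip(1,2)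
        by (cases p) (simp add: two_squares_def Let_def)
    qed
  next
    fix x assume x: "x \<in> simplex2"
    obtain x0 x1 x2 where e: "x = (x0, x1, x2)" by (metis prod_cases3)
    show "two_squares f f' (0, x) = ?j x" unfolding e jx by (rule two_squares_0[OF f x[unfolded e]])
    show "two_squares f f' (1, x) = glue ?a (degenerate u u) ?b x"
      unfolding e by (rule two_squares_1[OF f x[unfolded e] c])
  next
    fix t :: real and x assume t: "0 \<le> t" "t \<le> 1" and x: "x \<in> simplex2_boundary"
    obtain x0 x1 x2 where e: "x = (x0, x1, x2)" by (metis prod_cases3)
    show "two_squares f f' (t, x) = ?j x"
      using two_squares_boundary[OF f t x[unfolded e]] Tri_single_boundary[OF j(1) x] by (simp add: e)
  qed
  then have "triangle_class M (glue ?a (degenerate u u) ?b) = triangle_class M ?j"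
    by (rule triangle_class_eq)
  then show ?thesis
    unfolding a(2) b(2) j(2) T.plus_def m_class_eq[OF a(1) degenerate_Tri[OF u u] b(1)] by simp
qed

text \<open>Independence of the representatives is read off through the injective map
  \<open>Phi\<close>, whose value on a join depends by \<open>Phi_join\<close> only on the two
  classes.\<close>

lemma pi2_mult:
  assumes f: "f \<in> spheroids M m0" "f' \<in> spheroids M m0"
  shows "spheroid_class M m0 f \<otimes>\<^bsub>pi2 M m0\<^esub> spheroid_class M m0 f' = spheroid_class M m0 (spheroid_join f f')"
proof -
  have "spheroid_class M m0 (spheroid_join g g') = spheroid_class M m0 (spheroid_join f f')"
    if g: "g \<in> spheroid_class M m0 f" "g' \<in> spheroid_class M m0 f'" for g g'
  proof -
    have gs: "g \<in> spheroids M m0" "g' \<in> spheroids M m0"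
      using spheroid_class_spheroids f g by blast+
    have "Phi M (spheroid_class M m0 (spheroid_join g g')) = Phi M (spheroid_class M m0 (spheroid_join f f'))"
      using Phi_join[OF gs one_closed] Phi_join[OF f one_closed] spheroid_class_eq[OF g(1)] spheroid_class_eq[OF g(2)]
      by simp
    moreover have "spheroid_class M m0 (spheroid_join g g') \<in> carrier (pi2 M m0)"
      "spheroid_class M m0 (spheroid_join f f') \<in> carrier (pi2 M m0)"
      unfolding pi2_carrier using spheroid_join_spheroids f gs by blast+
    ultimately show ?thesis
      using Phi_bij[OF one_closed] by (meson bij_betw_def inj_onD)
  qed
  then show ?thesis
    unfolding pi2_def monoid.simps using spheroid_class_refl[OF f(1)] spheroid_class_refl[OF f(2)] by blast
qed

lemma Phi_mult:
  assumes "x \<in> carrier (pi2 M m0)" "y \<in> carrier (pi2 M m0)" "u \<in> carrier G"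
  shows "Phi M (x \<otimes>\<^bsub>pi2 M m0\<^esub> y) = T.plus u (Phi M x) (Phi M y)"
    and "x \<otimes>\<^bsub>pi2 M m0\<^esub> y \<in> carrier (pi2 M m0)"
proof -
  obtain f f' where f: "f \<in> spheroids M m0" "x = spheroid_class M m0 f"
    and f': "f' \<in> spheroids M m0" "y = spheroid_class M m0 f'"
    using assms unfolding pi2_carrier by blast
  show "Phi M (x \<otimes>\<^bsub>pi2 M m0\<^esub> y) = T.plus u (Phi M x) (Phi M y)"
    unfolding f(2) f'(2) pi2_mult[OF f(1) f'(1)] by (rule Phi_join[OF f(1) f'(1) assms(3)])
  show "x \<otimes>\<^bsub>pi2 M m0\<^esub> y \<in> carrier (pi2 M m0)"
    unfolding f(2) f'(2) pi2_mult[OF f(1) f'(1)] pi2_carrier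
    using spheroid_join_spheroids[OF f(1) f'(1)] by blast
qed

lemma spheroids_const: "(\<lambda>_. m0) \<in> spheroids M m0"
  by (rule spheroidsI) (use base in auto)

lemma pi2_one: "\<one>\<^bsub>pi2 M m0\<^esub> \<in> carrier (pi2 M m0)" "Phi M \<one>\<^bsub>pi2 M m0\<^esub> = deg \<one>\<^bsub>G\<^esub> \<one>\<^bsub>G\<^esub>"
proof -
  have one: "\<one>\<^bsub>pi2 M m0\<^esub> = spheroid_class M m0 (\<lambda>_. m0)" by (simp add: pi2_def)
  show "\<one>\<^bsub>pi2 M m0\<^esub> \<in> carrier (pi2 M m0)"
    unfolding one pi2_carrier using spheroids_const by blast
  show "Phi M \<one>\<^bsub>pi2 M m0\<^esub> = deg \<one>\<^bsub>G\<^esub> \<one>\<^bsub>G\<^esub>"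
    unfolding one Phi_eq[OF spheroids_const]
    by (rule triangle_class_Tri_eqI[OF degenerate_Tri[OF one_closed one_closed]])
      (simp add: L_same[OF one_closed])
qed

text \<open>All group laws, commutativity included, are pulled back along \<open>Phi\<close> from
  the cells with a single label, where the calculus has proved them; no homotopies of squares are
  constructed.\<close>

lemma comm_group_pi2: "comm_group (pi2 M m0)"
proof -
  let ?A = "pi2 M m0" and ?u = "\<one>\<^bsub>G\<^esub>"
  note u = one_closed
  note bij = Phi_bij[OF u]
  have inj: "x = y" if "x \<in> carrier ?A" "y \<in> carrier ?A" "Phi M x = Phi M y" for x y
    using bij that by (meson bij_betw_def inj_onD)
  have mem: "Phi M x \<in> Cell ?u ?u ?u" if "x \<in> carrier ?A" for x
    using bij that by (meson bij_betwE)
  note mult = Phi_mult(1)[OF _ _ u] and closed = Phi_mult(2)[OF _ _ u]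
  show ?thesis
  proof (rule comm_groupI)
    show "\<one>\<^bsub>?A\<^esub> \<in> carrier ?A" by (rule pi2_one)
    fix x assume x: "x \<in> carrier ?A"
    show "\<one>\<^bsub>?A\<^esub> \<otimes>\<^bsub>?A\<^esub> x = x"
      by (rule inj[OF closed[OF pi2_one(1) x] x])
        (simp add: mult[OF pi2_one(1) x] pi2_one(2) T.plus_zero_left[OF u mem[OF x]])
    have "Q_class M (Phi M x) \<in> Phi M ` carrier ?A"
      using T.Q_closed[OF mem[OF x]] bij_betw_imp_surj_on[OF bij] by simp
    then obtain z where z: "z \<in> carrier ?A" "Phi M z = Q_class M (Phi M x)" by auto
    have "z \<otimes>\<^bsub>?A\<^esub> x = \<one>\<^bsub>?A\<^esub>"
      by (rule inj[OF closed[OF z(1) x] pi2_one(1)])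
        (simp add: mult[OF z(1) x] z(2) pi2_one(2) T.plus_Q[OF u mem[OF x]]
          T.plus_commute[OF u T.Q_closed[OF mem[OF x]] mem[OF x]])
    then show "\<exists>z\<in>carrier ?A. z \<otimes>\<^bsub>?A\<^esub> x = \<one>\<^bsub>?A\<^esub>" using z(1) by blast
    fix y assume y: "y \<in> carrier ?A"
    show "x \<otimes>\<^bsub>?A\<^esub> y \<in> carrier ?A" by (rule closed[OF x y])
    show "x \<otimes>\<^bsub>?A\<^esub> y = y \<otimes>\<^bsub>?A\<^esub> x"
      by (rule inj[OF closed[OF x y] closed[OF y x]])
        (simp add: mult[OF x y] mult[OF y x] T.plus_commute[OF u mem[OF x] mem[OF y]])
    fix z assume z: "z \<in> carrier ?A"
    show "x \<otimes>\<^bsub>?A\<^esub> y \<otimes>\<^bsub>?A\<^esub> z = x \<otimes>\<^bsub>?A\<^esub> (y \<otimes>\<^bsub>?A\<^esub> z)"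
      by (rule inj[OF closed[OF closed[OF x y] z] closed[OF x closed[OF y z]]])
        (simp add: mult[OF closed[OF x y] z] mult[OF x y] mult[OF x closed[OF y z]] mult[OF y z]
          T.plus_assoc[OF u mem[OF x] mem[OF y] mem[OF z]])
  qed
qed

end

subsection \<open>The action of the fundamental group\<close>

text \<open>As \<open>l\<close> grows from 0 to 1 this interpolates between \<open>f\<close> and \<open>spheroid_drag p f\<close>, with
  the constant value \<open>p (1 - l)\<close> on the boundary.\<close>

definition shell :: "real \<Rightarrow> (real \<Rightarrow> 'a) \<Rightarrow> (real \<times> real \<Rightarrow> 'a) \<Rightarrow> real \<times> real \<Rightarrow> 'a" where
  "shell l p f = (\<lambda>(u, v). let r = (1 + l) * max \<bar>2 * u - 1\<bar> \<bar>2 * v - 1\<bar> in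
     if r \<le> 1 then f (1/2 + (1 + l) * (u - 1/2), 1/2 + (1 + l) * (v - 1/2)) else p (2 - r))"

lemma shell_1: "shell 1 p f = spheroid_drag p f"
  by (rule ext) (auto simp: shell_def spheroid_drag_def Let_def)

lemma radius_boundary: "(u, v) \<in> square_boundary \<Longrightarrow> max \<bar>2 * u - 1\<bar> \<bar>2 * v - 1\<bar> = 1"
  by (auto simp: square_boundary_iff max_def)

lemma shell_boundary:
  assumes "f \<in> spheroids M m0" "p 1 = m0" "z \<in> square_boundary" "0 \<le> l"
  shows "shell l p f z = p (1 - l)"
proof -
  obtain u v where z: "z = (u, v)" by fastforce
  have r: "max \<bar>2 * u - 1\<bar> \<bar>2 * v - 1\<bar> = 1" using radius_boundary assms(3) by (simp add: z)
  show ?thesis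
  proof (cases "l = 0")
    case True
    then show ?thesis using spheroidsD(3)[OF assms(1,3)] assms(2) by (simp add: shell_def r z)
  next
    case False
    then show ?thesis using assms(4) by (simp add: shell_def r z)
  qed
qed

lemma shell_0:
  assumes "z \<in> unit_square"
  shows "shell 0 p f z = f z"
  using assms by (cases z) (auto simp: shell_def)

lemma shell_point:
  assumes "(1 + l) * max \<bar>2 * u - 1\<bar> \<bar>2 * v - 1\<bar> \<le> (1::real)" "0 \<le> l"
  shows "(1/2 + (1 + l) * (u - 1/2), 1/2 + (1 + l) * (v - 1/2)) \<in> unit_square"
    and "(1 + l) * max \<bar>2 * u - 1\<bar> \<bar>2 * v - 1\<bar> = 1 \<Longrightarrow>
      (1/2 + (1 + l) * (u - 1/2), 1/2 + (1 + l) * (v - 1/2)) \<in> square_boundary"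
proof -
  have e: "(1 + l) * max \<bar>2 * u - 1\<bar> \<bar>2 * v - 1\<bar> = max \<bar>2 * ((1 + l) * (u - 1/2))\<bar> \<bar>2 * ((1 + l) * (v - 1/2))\<bar>"
  proof -
    have "\<bar>2 * ((1 + l) * (w - 1/2))\<bar> = (1 + l) * \<bar>2 * w - 1\<bar>" for w
    proof -
      have "2 * ((1 + l) * (w - 1/2)) = (1 + l) * (2 * w - 1)" by (simp add: algebra_simps)
      then show ?thesis using assms(2) by (simp only: abs_mult)
    qed
    then show ?thesis using assms(2) by (simp only: max_mult_distrib_left) simp
  qed
  define p where "p = (1 + l) * (u - 1/2)"
  define q where "q = (1 + l) * (v - 1/2)"
  have pq: "max \<bar>2 * p\<bar> \<bar>2 * q\<bar> \<le> 1" using assms(1) unfolding e p_def q_def .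
  then show "(1/2 + (1 + l) * (u - 1/2), 1/2 + (1 + l) * (v - 1/2)) \<in> unit_square"
    unfolding p_def[symmetric] q_def[symmetric] by (auto simp: max_def abs_le_iff split: if_splits)
  assume "(1 + l) * max \<bar>2 * u - 1\<bar> \<bar>2 * v - 1\<bar> = 1"
  then have "max \<bar>2 * p\<bar> \<bar>2 * q\<bar> = 1" unfolding e p_def q_def .
  then show "(1/2 + (1 + l) * (u - 1/2), 1/2 + (1 + l) * (v - 1/2)) \<in> square_boundary"
    unfolding p_def[symmetric] q_def[symmetric] square_boundary_iff
    by (auto simp: max_def abs_if split: if_splits)
qed

lemma shell_radius: "(u, v) \<in> unit_square \<Longrightarrow> \<lbrakk>0 \<le> l; l \<le> 1\<rbrakk> \<Longrightarrow> (1 + l) * max \<bar>2 * u - 1\<bar> \<bar>2 * v - 1\<bar> \<le> (2::real)"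
  using mult_mono[of "1 + l" 2 "max \<bar>2 * u - 1\<bar> \<bar>2 * v - 1\<bar>" 1] by (auto simp: abs_le_iff)

text \<open>Two families are covered: constant \<open>l = 1\<close> with a varying path, which shows
  that dragging depends only on the homotopy class of the path, and growing \<open>l\<close> with a
  fixed path, the free homotopy behind \<open>Phi_drag\<close>.\<close>

lemma shell_continuous:
  fixes M :: "'a::topological_space set"
  assumes f: "f \<in> spheroids M m0"
    and K: "continuous_on ({0..1} \<times> {0..1}) K" "\<And>t. t \<in> {0..1} \<Longrightarrow> K (t, 1) = m0"
    and l: "continuous_on {0..1::real} l" "\<And>t. t \<in> {0..1} \<Longrightarrow> 0 \<le> l t \<and> l t \<le> 1"
  shows "continuous_on ({0..1} \<times> unit_square) (\<lambda>p. shell (l (fst p)) (\<lambda>s::real. K (fst p, s)) f (snd p))"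
proof -
  let ?S = "{0..1::real} \<times> unit_square"
  let ?l = "\<lambda>p::real \<times> real \<times> real. 1 + l (fst p)"
  let ?u = "\<lambda>p::real \<times> real \<times> real. fst (snd p)"
  let ?v = "\<lambda>p::real \<times> real \<times> real. snd (snd p)"
  let ?r = "\<lambda>p. ?l p * max \<bar>2 * ?u p - 1\<bar> \<bar>2 * ?v p - 1\<bar>"
  have lc: "continuous_on S (\<lambda>p. l (fst p))" if "S \<subseteq> ?S" for S
    by (rule continuous_on_compose2[OF l(1)]) (use that in \<open>auto intro!: continuous_intros\<close>)
  have lb: "0 \<le> l (fst p)" "l (fst p) \<le> 1" if "p \<in> ?S" for p
    using l(2)[of "fst p"] that by auto
  have 1: "continuous_on ?S (\<lambda>p. if ?r p - 1 \<le> 0 then f (1/2 + ?l p * (?u p - 1/2), 1/2 + ?l p * (?v p - 1/2))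
     else K (fst p, 2 - ?r p))"
  proof (rule continuous_on_cases_le)
    show "continuous_on {p \<in> ?S. ?r p - 1 \<le> 0} (\<lambda>p. f (1/2 + ?l p * (?u p - 1/2), 1/2 + ?l p * (?v p - 1/2)))"
    proof (rule continuous_on_compose2[OF spheroidsD(1)[OF f]])
      show "(\<lambda>p. (1/2 + ?l p * (?u p - 1/2), 1/2 + ?l p * (?v p - 1/2))) ` {p \<in> ?S. ?r p - 1 \<le> 0} \<subseteq> unit_square"
        by (rule image_subsetI, rule shell_point(1)) (use lb in auto)
    qed (intro continuous_intros lc Collect_restrict)
    show "continuous_on {p \<in> ?S. 0 \<le> ?r p - 1} (\<lambda>p. K (fst p, 2 - ?r p))"
    proof (rule continuous_on_compose2[OF K(1)])
      show "(\<lambda>p. (fst p, 2 - ?r p)) ` {p \<in> ?S. 0 \<le> ?r p - 1} \<subseteq> {0..1} \<times> {0..1}"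
      proof (rule image_subsetI)
        fix p assume p: "p \<in> {p \<in> ?S. 0 \<le> ?r p - 1}"
        then have "?r p \<le> 2" using lb[of p] by (intro shell_radius) auto
        then show "(fst p, 2 - ?r p) \<in> {0..1} \<times> {0..1}" using p by auto
      qed
    qed (intro continuous_intros lc Collect_restrict)
    fix p assume p: "p \<in> ?S" "?r p - 1 = 0"
    have "f (1/2 + ?l p * (?u p - 1/2), 1/2 + ?l p * (?v p - 1/2)) = m0"
      by (rule spheroidsD(3)[OF f], rule shell_point(2)) (use p lb[OF p(1)] in auto)
    moreover have "K (fst p, 2 - ?r p) = m0" using p K(2)[of "fst p"] by auto
    ultimately show "f (1/2 + ?l p * (?u p - 1/2), 1/2 + ?l p * (?v p - 1/2)) = K (fst p, 2 - ?r p)" by simp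
  qed (intro continuous_intros lc order_refl)
  have 2: "(\<lambda>p. shell (l (fst p)) (\<lambda>s. K (fst p, s)) f (snd p)) =
     (\<lambda>p. if ?r p - 1 \<le> 0 then f (1/2 + ?l p * (?u p - 1/2), 1/2 + ?l p * (?v p - 1/2)) else K (fst p, 2 - ?r p))"
    by (rule ext) (simp add: shell_def case_prod_beta Let_def)
  show ?thesis unfolding 2 by (rule 1)
qed

lemma shell_image:
  assumes "f \<in> spheroids M m0" "p ` {0..1} \<subseteq> M" "z \<in> unit_square" "0 \<le> l" "l \<le> 1"
  shows "shell l p f z \<in> M"
proof -
  obtain u v where z: "z = (u, v)" by fastforce
  show ?thesis
  proof (cases "(1 + l) * max \<bar>2 * u - 1\<bar> \<bar>2 * v - 1\<bar> \<le> 1")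
    case True
    then show ?thesis
      using subsetD[OF spheroidsD(2)[OF assms(1)] imageI[OF shell_point(1)[OF True assms(4)]]]
      by (simp add: shell_def z)
  next
    case False
    then have "2 - (1 + l) * max \<bar>2 * u - 1\<bar> \<bar>2 * v - 1\<bar> \<in> {0..1}"
      using shell_radius[of u v l] assms(3-5) by (simp add: z)
    then have "p (2 - (1 + l) * max \<bar>2 * u - 1\<bar> \<bar>2 * v - 1\<bar>) \<in> M"
      using assms(2) by blast
    then show ?thesis using False by (simp add: shell_def z)
  qed
qed

lemma spheroid_drag_class:
  fixes M :: "'a::topological_space set"
  assumes f: "f \<in> spheroids M m0" and p: "p \<in> loops M m0" and q: "homotopic_paths M p q"
  shows "spheroid_drag q f \<in> spheroid_class M m0 (spheroid_drag p f)"
proof -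
  obtain K where K: "continuous_on ({0..1} \<times> {0..1}) K" "K \<in> ({0..1} \<times> {0..1}) \<rightarrow> M"
    "\<And>x. x \<in> {0..1} \<Longrightarrow> K (0, x) = p x" "\<And>x. x \<in> {0..1} \<Longrightarrow> K (1, x) = q x"
    "\<And>t::real. t \<in> {0..1} \<Longrightarrow> K (t, 0) = m0" "\<And>t. t \<in> {0..1} \<Longrightarrow> K (t, 1) = m0"
    using q loops_D(3,4)[OF p] unfolding homotopic_paths pathstart_def pathfinish_def o_def by auto
  have cong: "shell 1 k f z = shell 1 k' f z" if "z \<in> unit_square" "\<And>x. x \<in> {0..1} \<Longrightarrow> k x = k' x" for k k' z
  proof -
    obtain u v where z: "z = (u, v)" by fastforce
    have "(1 + 1) * max \<bar>2 * u - 1\<bar> \<bar>2 * v - 1\<bar> \<le> 2" using that(1) by (intro shell_radius) (auto simp: z)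
    then show ?thesis using that(2) by (auto simp: shell_def Let_def z)
  qed
  have KM: "(\<lambda>s. K (t, s)) ` {0..1} \<subseteq> M" if "t \<in> {0..1}" for t
    using K(2) that by auto
  show ?thesis
    unfolding shell_1[symmetric]
  proof (rule spheroid_class_I[OF shell_continuous[OF f K(1,6), where l = "\<lambda>_. 1"]])
    show "(\<lambda>p. shell 1 (\<lambda>s. K (fst p, s)) f (snd p)) ` ({0..1} \<times> unit_square) \<subseteq> M"
      by (rule image_subsetI, rule shell_image[OF f KM]) auto
  next
    fix z :: "real \<times> real" assume z: "z \<in> unit_square"
    show "shell 1 (\<lambda>s. K (fst (0, z), s)) f (snd (0, z)) = shell 1 p f z"
      "shell 1 (\<lambda>s. K (fst (1, z), s)) f (snd (1, z)) = shell 1 q f z"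
      unfolding fst_conv snd_conv by (rule cong[OF z K(3)] cong[OF z K(4)]; assumption)+
  next
    fix t :: real and z assume "0 \<le> t" "t \<le> 1" "z \<in> square_boundary"
    then show "shell 1 (\<lambda>s. K (fst (t, z), s)) f (snd (t, z)) = m0"
      using shell_boundary[OF f, of "\<lambda>s. K (t, s)" z 1] K(5,6)[of t] by simp
  qed auto
qed

text \<open>Membership is read off from the homotopy of \<open>spheroid_drag p f\<close> with itself
  that comes from the constant homotopy of \<open>p\<close>.\<close>

lemma spheroid_drag_spheroids:
  assumes "f \<in> spheroids M m0" "p \<in> loops M m0"
  shows "spheroid_drag p f \<in> spheroids M m0"
proof -
  have "spheroid_drag p f \<in> spheroid_class M m0 (spheroid_drag p f)"
    by (rule spheroid_drag_class[OF assms loops_D(5)[OF assms(2)]])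
  then have h: "homotopic_with_canon (\<lambda>h. \<forall>z\<in>square_boundary. h z = m0) unit_square M
      (spheroid_drag p f) (spheroid_drag p f)"
    by (simp add: spheroid_class_def)
  show ?thesis
    using homotopic_with_imp_continuous[OF h] homotopic_with_imp_subset2[OF h] homotopic_with_imp_property[OF h]
    unfolding spheroids_def by blast
qed

context loop_space
begin

text \<open>A free homotopy of spheres is a map on a prism, bottom labelled \<open>u\<close> and top
  labelled \<open>v\<close>. Cut into tetrahedra, it becomes the three nested instances of
  \<open>m\<close> that \<open>tau_prism\<close> evaluates to the transport.\<close>

lemma prism_class:
  fixes H :: "real \<times> real \<times> real \<times> real \<Rightarrow> 'a"
  assumes H: "continuous_on ({0..1} \<times> simplex2) H" "H ` ({0..1} \<times> simplex2) \<subseteq> M"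
    and bd: "\<And>t x. \<lbrakk>0 \<le> t; t \<le> 1; x \<in> simplex2_boundary\<rbrakk> \<Longrightarrow> H (t, x) = lift v u (1 - t)"
    and G: "u \<in> carrier G" "v \<in> carrier G"
  shows "triangle_class M (\<lambda>x. H (1, x)) = T.tau v u (triangle_class M (\<lambda>x. H (0, x)))"
    and "(\<lambda>x. H (0, x)) \<in> Tri u u u"
proof -
  have cont: "continuous_on simplex3 (\<lambda>y. H (g y))" if "continuous_on simplex3 g" "g ` simplex3 \<subseteq> {0..1} \<times> simplex2" for g
    by (rule continuous_on_compose2[OF H(1) that])
  have im: "(\<lambda>y. H (g y)) ` simplex3 \<subseteq> M" if "g ` simplex3 \<subseteq> {0..1} \<times> simplex2" for g
    using H(2) that by blast
  have rev: "lift v u (1 - t) = lift u v t" if "0 \<le> t" "t \<le> 1" for t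
    using L_reverse[OF G(2,1) that] .
  have bd': "H (t, x0, x1, x2) = lift v u (1 - t)"
    if "0 \<le> t" "t \<le> 1" "0 \<le> x0" "0 \<le> x1" "0 \<le> x2" "x0 + x1 + x2 = 1" "x0 = 0 \<or> x1 = 0 \<or> x2 = 0" for t x0 x1 x2
    using bd[OF that(1,2), of "(x0, x1, x2)"] that by (simp add: simplex2_boundary_def simplex2_def)
  show x: "(\<lambda>x. H (0, x)) \<in> Tri u u u"
  proof (rule Tri_single[OF G(1)])
    show "continuous_on simplex2 (\<lambda>x. H (0, x))"
      by (rule continuous_on_compose2[OF H(1)]) (auto intro!: continuous_intros)
    show "(\<lambda>x. H (0, x)) ` simplex2 \<subseteq> M" using H(2) by auto
    show "H (0, x) = m0" if "x \<in> simplex2_boundary" for x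
      using bd[OF _ _ that, of 0] L_end[OF G(2,1)] by simp
  qed
  note duv = degenerate_Tri[OF G] and dvu = degenerate_Tri[OF G(2,1)]
  \<comment> \<open>The staircase decomposition of the prism, time being the first coordinate. Each
    tetrahedron lifts one more vertex of the triangle from bottom to top, in the order 2, 1, 0, and
    its own vertex 0 is the bottom vertex left behind. The walls between them are \<open>?q1\<close>
    and \<open>?q2\<close>.\<close>
  let ?g1 = "\<lambda>y::real \<times> real \<times> real \<times> real. (snd (snd (snd y)), fst (snd y), fst (snd (snd y)), fst y + snd (snd (snd y)))"
  let ?g2 = "\<lambda>y::real \<times> real \<times> real \<times> real. (fst (snd (snd y)) + snd (snd (snd y)), fst (snd y), fst y + fst (snd (snd y)), snd (snd (snd y)))"
  let ?g3 = "\<lambda>y::real \<times> real \<times> real \<times> real. (fst (snd y) + fst (snd (snd y)) + snd (snd (snd y)), fst y + fst (snd y), fst (snd (snd y)), snd (snd (snd y)))"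
  have g1: "continuous_on simplex3 ?g1" "?g1 ` simplex3 \<subseteq> {0..1} \<times> simplex2"
    by (auto intro!: continuous_intros simp: simplex3_def simplex2_def)
  have g2: "continuous_on simplex3 ?g2" "?g2 ` simplex3 \<subseteq> {0..1} \<times> simplex2"
    by (auto intro!: continuous_intros simp: simplex3_def simplex2_def)
  have g3: "continuous_on simplex3 ?g3" "?g3 ` simplex3 \<subseteq> {0..1} \<times> simplex2"
    by (auto intro!: continuous_intros simp: simplex3_def simplex2_def)
  let ?q1 = "\<lambda>x. H (snd (snd x), x)"
  let ?q2 = "\<lambda>x. H (fst (snd x) + snd (snd x), x)"
  have 1: "m_class M (triangle_class M (\<lambda>x. H (0, x))) (deg u v) (deg u v) = triangle_class M ?q1"
    by (rule m_class_face[OF cont[OF g1] im[OF g1(2)] x duv duv]) (simp_all add: bd')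
  have q1: "?q1 \<in> Tri u u v"
  proof -
    have "triangle_class M ?q1 = triangle_class M (glue (\<lambda>x. H (0, x)) (degenerate u v) (degenerate u v))"
      using 1 m_class_eq[OF x duv duv] by simp
    moreover have "?q1 \<in> triangle_class M ?q1"
    proof (rule triangle_class_refl)
      show "continuous_on simplex2 ?q1"
        by (rule continuous_on_compose2[OF H(1)]) (auto intro!: continuous_intros simp: simplex2_def)
      show "?q1 ` simplex2 \<subseteq> M" using H(2) by (auto simp: simplex2_def image_subset_iff)
    qed
    ultimately have "?q1 \<in> triangle_class M (glue (\<lambda>x. H (0, x)) (degenerate u v) (degenerate u v))"
      by simp
    then show ?thesis by (rule Tri_class[OF glue_Tri[OF x duv duv]])
  qed
  have 2: "m_class M (triangle_class M (rotate (degenerate u v))) (triangle_class M (rotate (rotate (degenerate v u))))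
      (triangle_class M ?q1) = triangle_class M ?q2"
  proof (rule m_class_face[OF cont[OF g2] im[OF g2(2)] rotate_Tri[OF duv] rotate_Tri[OF rotate_Tri[OF dvu]] q1])
    fix x0 x1 x2 :: real assume s: "0 \<le> x0" "0 \<le> x1" "0 \<le> x2" "x0 + x1 + x2 = 1"
    then have e: "x1 + x2 = 1 - x0" by simp
    show "H (?g2 (x0, 0, x1, x2)) = rotate (rotate (degenerate v u)) (x0, x1, x2)"
      using s bd'[of "x1 + x2" 0 "x0 + x1" x2] rev[of "1 - x0"] by (simp add: e)
  qed (simp_all add: bd')
  have q2: "?q2 \<in> Tri u v v"
  proof -
    note i = rotate_Tri[OF duv] rotate_Tri[OF rotate_Tri[OF dvu]] q1
    have "triangle_class M ?q2 = triangle_class M (glue (rotate (degenerate u v)) (rotate (rotate (degenerate v u))) ?q1)"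
      using 2 m_class_eq[OF i] by simp
    moreover have "?q2 \<in> triangle_class M ?q2"
    proof (rule triangle_class_refl)
      show "continuous_on simplex2 ?q2"
        by (rule continuous_on_compose2[OF H(1)]) (auto intro!: continuous_intros simp: simplex2_def)
      show "?q2 ` simplex2 \<subseteq> M" using H(2) by (auto simp: simplex2_def image_subset_iff)
    qed
    ultimately have "?q2 \<in> triangle_class M (glue (rotate (degenerate u v)) (rotate (rotate (degenerate v u))) ?q1)"
      by simp
    then show ?thesis by (rule Tri_class[OF glue_Tri[OF i]])
  qed
  have 3: "m_class M (deg v u) (triangle_class M ?q2) (triangle_class M (rotate (degenerate v u))) =
    triangle_class M (\<lambda>x. H (1, x))"
  proof (rule m_class_face[OF cont[OF g3] im[OF g3(2)] dvu q2 rotate_Tri[OF dvu]])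
    fix x0 x1 x2 :: real assume s: "0 \<le> x0" "0 \<le> x1" "0 \<le> x2" "x0 + x1 + x2 = 1"
    then have e: "x0 + x1 = 1 - x2" "x0 + x2 = 1 - x1" "x2 + x0 + x1 = 1" "x1 + x0 + x2 = 1" by simp_all
    have le: "x1 \<le> 1" "x2 \<le> 1" using s by linarith+
    show "H (?g3 (x2, x0, x1, 0)) = degenerate v u (x0, x1, x2)"
      using s bd'[of "x0 + x1" "x2 + x0" x1 0] rev[of "1 - x2"] le by (simp add: e)
    show "H (?g3 (x1, x0, 0, x2)) = rotate (degenerate v u) (x0, x1, x2)"
      using s bd'[of "x0 + x2" "x1 + x0" 0 x2] rev[of "1 - x1"] le by (simp add: e)
  qed simp_all
  show "triangle_class M (\<lambda>x. H (1, x)) = T.tau v u (triangle_class M (\<lambda>x. H (0, x)))"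
    using T.tau_prism[OF CellI[OF x] G(2)] 1 2 3 P_class_Tri[OF duv] P_class_Tri[OF dvu]
      P_class_Tri[OF rotate_Tri[OF dvu]] by simp
qed

text \<open>The growing shell is a free homotopy from \<open>f\<close> to the dragged spheroid
  during which the boundary runs backwards along \<open>s g\<close>. So it is a prism with bottom
  label \<open>g\<close> and top label \<open>\<one>\<close>.\<close>

lemma Phi_drag:
  assumes g: "g \<in> carrier G" and f: "f \<in> spheroids M m0"
  shows "Phi M (spheroid_class M m0 (spheroid_drag (s g) f)) = T.tau \<one>\<^bsub>G\<^esub> g (Phi M (spheroid_class M m0 f))"
proof -
  note l = loops_D[OF section_loop(1)[OF g]]
  let ?h = "\<lambda>p. shell (fst p) (s g) f (snd p)"
  have h: "continuous_on ({0..1} \<times> unit_square) ?h"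
  proof (rule shell_continuous[OF f, where K = "\<lambda>p. s g (snd p)" and l = "\<lambda>t. t", unfolded snd_conv])
    show "continuous_on ({0..1} \<times> {0..1}) (\<lambda>p. s g (snd p))"
      by (rule continuous_on_compose2[OF l(1)[unfolded path_def]]) (auto intro!: continuous_intros)
  qed (simp_all add: l(4))
  have hM: "shell t (s g) f z \<in> M" if "0 \<le> t" "t \<le> 1" "z \<in> unit_square" for t z
    by (rule shell_image[OF f]) (use that l(2) in \<open>auto simp: path_image_def\<close>)
  have mem: "(fst p, to_square (snd p)) \<in> {0..1} \<times> unit_square"
    if "p \<in> {0..1} \<times> simplex2" for p :: "real \<times> real \<times> real \<times> real"
    using that by (intro SigmaI to_square(2)) (simp_all only: mem_Times_iff)
  let ?H = "\<lambda>p. shell (fst p) (s g) f (to_square (snd p))"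
  have "continuous_on ({0..1} \<times> simplex2) (\<lambda>p. ?h (fst p, to_square (snd p)))"
  proof (rule continuous_on_compose2[OF h])
    show "continuous_on ({0..1} \<times> simplex2) (\<lambda>p. (fst p, to_square (snd p)))"
      by (intro continuous_intros continuous_on_compose2[OF to_square(1)[of UNIV]]) auto
  qed (rule image_subsetI, rule mem)
  then have H: "continuous_on ({0..1} \<times> simplex2) ?H" by simp
  have HM: "?H ` ({0..1} \<times> simplex2) \<subseteq> M"
  proof (rule image_subsetI)
    fix p :: "real \<times> real \<times> real \<times> real" assume "p \<in> {0..1} \<times> simplex2"
    from mem[OF this] show "?H p \<in> M" by (intro hM) (simp_all only: mem_Times_iff fst_conv snd_conv atLeastAtMost_iff)
  qed
  have bd: "?H (t, x) = lift \<one>\<^bsub>G\<^esub> g (1 - t)" if "0 \<le> t" "t \<le> 1" "x \<in> simplex2_boundary" for t x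
    using shell_boundary[where p = "s g", OF f l(4) to_square(3)[OF that(3)] that(1)] g by (simp add: lift_def)
  have "triangle_class M (\<lambda>x. ?H (1, x)) = T.tau \<one>\<^bsub>G\<^esub> g (triangle_class M (\<lambda>x. ?H (0, x)))"
    and x: "(\<lambda>x. ?H (0, x)) \<in> Tri g g g"
    using prism_class[OF H HM bd g one_closed] by blast+
  moreover have "triangle_class M (\<lambda>x. f (to_square x)) = triangle_class M (\<lambda>x. ?H (0, x))"
    by (rule Tri_cong(2)[OF x]) (simp add: shell_0[OF to_square(2)])
  ultimately show ?thesis
    unfolding Phi_eq[OF f] Phi_eq[OF spheroid_drag_spheroids[OF f section_loop(1)[OF g]]]
    by (simp add: shell_1)
qed

text \<open>Independence of the path needs a homotopy; independence of the spheroid follows from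
  \<open>Phi_drag\<close> and the injectivity of \<open>Phi\<close>.\<close>

lemma pi1_act_eq:
  assumes g: "g \<in> carrier G" and f: "f \<in> spheroids M m0"
  shows "pi1_act M m0 g (spheroid_class M m0 f) = spheroid_class M m0 (spheroid_drag (s g) f)"
proof -
  have "spheroid_class M m0 (spheroid_drag p f') = spheroid_class M m0 (spheroid_drag (s g) f)"
    if p: "p \<in> g" and f': "f' \<in> spheroid_class M m0 f" for p f'
  proof -
    have fs: "f' \<in> spheroids M m0" using spheroid_class_spheroids[OF f f'] .
    have "homotopic_paths M (s g) p"
      using p section_loop(2)[OF g] unfolding path_class_def by blast
    then have "spheroid_class M m0 (spheroid_drag p f') = spheroid_class M m0 (spheroid_drag (s g) f')"
      by (intro spheroid_class_eq spheroid_drag_class[OF fs section_loop(1)[OF g]])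
    moreover have "Phi M (spheroid_class M m0 (spheroid_drag (s g) f')) = Phi M (spheroid_class M m0 (spheroid_drag (s g) f))"
      using Phi_drag[OF g fs] Phi_drag[OF g f] spheroid_class_eq[OF f'] by simp
    moreover have "spheroid_class M m0 (spheroid_drag (s g) f') \<in> carrier (pi2 M m0)"
      "spheroid_class M m0 (spheroid_drag (s g) f) \<in> carrier (pi2 M m0)"
      unfolding pi2_carrier using spheroid_drag_spheroids section_loop(1)[OF g] f fs by blast+
    ultimately show ?thesis
      using Phi_bij[OF one_closed] by (metis bij_betw_def inj_onD)
  qed
  then show ?thesis
    unfolding pi1_act_def using spheroid_class_refl[OF f] section_mem[OF g] by blast
qed

lemma Phi_act:
  assumes "g \<in> carrier G" "x \<in> carrier (pi2 M m0)"
  shows "Phi M (pi1_act M m0 g x) = T.tau \<one>\<^bsub>G\<^esub> g (Phi M x)" "pi1_act M m0 g x \<in> carrier (pi2 M m0)"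
proof -
  obtain f where f: "f \<in> spheroids M m0" "x = spheroid_class M m0 f"
    using assms(2) unfolding pi2_carrier by blast
  show "Phi M (pi1_act M m0 g x) = T.tau \<one>\<^bsub>G\<^esub> g (Phi M x)"
    unfolding f(2) pi1_act_eq[OF assms(1) f(1)] by (rule Phi_drag[OF assms(1) f(1)])
  show "pi1_act M m0 g x \<in> carrier (pi2 M m0)"
    unfolding f(2) pi1_act_eq[OF assms(1) f(1)] pi2_carrier
    using spheroid_drag_spheroids[OF f(1) section_loop(1)[OF assms(1)]] by blast
qed

end

section \<open>Existence of a symmetric section\<close>

context delta_classification
begin

section \<open>The symmetric group acting on index pairs and on cells\<close>

definition rot2 :: "'g \<times> 'g \<Rightarrow> 'g \<times> 'g" where
  "rot2 = (\<lambda>(g, h). (h, inv g \<otimes> inv h))"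

definition swap2 :: "'g \<times> 'g \<Rightarrow> 'g \<times> 'g" where
  "swap2 = (\<lambda>(g, h). (inv g, h \<otimes> g))"

definition over :: "('g \<times> 'g) \<times> 't \<Rightarrow> bool" where
  "over = (\<lambda>((g, h), x). g \<in> carrier G \<and> h \<in> carrier G \<and> x \<in> C g \<one> (inv h))"

definition stepP :: "('g \<times> 'g) \<times> 't \<Rightarrow> ('g \<times> 'g) \<times> 't" where
  "stepP z = (rot2 (fst z), P (snd z))"

definition stepQ :: "('g \<times> 'g) \<times> 't \<Rightarrow> ('g \<times> 'g) \<times> 't" where
  "stepQ z = (swap2 (fst z), Q (snd z))"

text \<open>The orbit under the symmetric group on three letters generated by \<open>P\<close> and \<open>Q\<close>.\<close>

definition orbit :: "('g \<times> 'g) \<times> 't \<Rightarrow> (('g \<times> 'g) \<times> 't) set" where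
  "orbit z = {z, stepP z, stepP (stepP z), stepQ z, stepP (stepQ z), stepP (stepP (stepQ z))}"

definition pair_orbit :: "'g \<times> 'g \<Rightarrow> ('g \<times> 'g) set" where
  "pair_orbit y = {y, rot2 y, rot2 (rot2 y), swap2 y, rot2 (swap2 y), rot2 (rot2 (swap2 y))}"

lemma over_stepP: assumes "over z" shows "over (stepP z)"
proof -
  obtain g h x where z: "z = ((g, h), x)" by (metis prod.exhaust)
  have G: "g \<in> carrier G" "h \<in> carrier G" and x: "x \<in> C g \<one> (inv h)"
    using assms by (auto simp: over_def z)
  have "C h \<one> (inv (inv g \<otimes> inv h)) = C \<one> (inv h) g"
    using C_label[of \<one> "inv h" g] G by (simp add: group_simps)
  then show ?thesis
    using T.P_closed[OF x] G by (simp add: over_def stepP_def rot2_def z)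
qed

lemma over_stepQ: assumes "over z" shows "over (stepQ z)"
proof -
  obtain g h x where z: "z = ((g, h), x)" by (metis prod.exhaust)
  have G: "g \<in> carrier G" "h \<in> carrier G" and x: "x \<in> C g \<one> (inv h)"
    using assms by (auto simp: over_def z)
  have "C (inv g) \<one> (inv (h \<otimes> g)) = C \<one> g (inv h)"
    using C_label[of \<one> g "inv h"] G by (simp add: group_simps)
  then show ?thesis
    using T.Q_closed[OF x] G by (simp add: over_def stepQ_def swap2_def z)
qed

lemma step_relations:
  assumes "over z"
  shows "stepP (stepP (stepP z)) = z" "stepQ (stepQ z) = z" "stepQ (stepP z) = stepP (stepP (stepQ z))"
proof -
  obtain g h x where z: "z = ((g, h), x)" by (metis prod.exhaust)
  have G: "g \<in> carrier G" "h \<in> carrier G" and x: "x \<in> C g \<one> (inv h)"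
    using assms by (auto simp: over_def z)
  show "stepP (stepP (stepP z)) = z"
    using T.PPP[OF x] G by (simp add: stepP_def rot2_def z group_simps)
  show "stepQ (stepQ z) = z"
    using T.QQ[OF x] G by (simp add: stepQ_def swap2_def z group_simps)
  show "stepQ (stepP z) = stepP (stepP (stepQ z))"
    using T.PPQ[OF x] G by (simp add: stepP_def stepQ_def rot2_def swap2_def z group_simps)
qed

text \<open>The six elements of \<open>orbit\<close> are the normal forms of the symmetric group:
  powers of \<open>P\<close> with or without a preceding \<open>Q\<close>. The three relations bring
  any further \<open>P\<close> or \<open>Q\<close> back to this list; the last claim is that the
  group has inverses.\<close>

lemma orbit_closed:
  assumes "over z" "y \<in> orbit z"
  shows "stepP y \<in> orbit z" "stepQ y \<in> orbit z" "over y" "z \<in> orbit y"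
proof -
  note o = over_stepP over_stepQ
  have 1: "over (stepP z)" "over (stepP (stepP z))" "over (stepQ z)" "over (stepP (stepQ z))"
    "over (stepP (stepP (stepQ z)))" using assms(1) by (intro o; assumption)+
  note r0 = step_relations[OF assms(1)] and r1 = step_relations[OF 1(1)] and r2 = step_relations[OF 1(2)]
    and r3 = step_relations[OF 1(3)] and r4 = step_relations[OF 1(4)] and r5 = step_relations[OF 1(5)]
  consider "y = z" | "y = stepP z" | "y = stepP (stepP z)" | "y = stepQ z" | "y = stepP (stepQ z)"
    | "y = stepP (stepP (stepQ z))" using assms(2) unfolding orbit_def by blast
  then have "stepP y \<in> orbit z \<and> stepQ y \<in> orbit z \<and> over y \<and> z \<in> orbit y"
    by cases (simp_all add: orbit_def assms(1) 1 r0 r1 r2 r3 r4 r5)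
  then show "stepP y \<in> orbit z" "stepQ y \<in> orbit z" "over y" "z \<in> orbit y" by blast+
qed

lemma orbit_eq:
  assumes "over z" "y \<in> orbit z"
  shows "orbit y = orbit z"
proof -
  have *: "orbit b \<subseteq> orbit a" if "over a" "b \<in> orbit a" for a b
  proof -
    note c = orbit_closed(1,2)[OF that(1)]
    show ?thesis unfolding orbit_def[of b]
      using that(2) c(1)[OF that(2)] c(1)[OF c(1)[OF that(2)]] c(2)[OF that(2)]
        c(1)[OF c(2)[OF that(2)]] c(1)[OF c(1)[OF c(2)[OF that(2)]]] by blast
  qed
  show ?thesis
    using *[OF assms] *[OF orbit_closed(3,4)[OF assms]] by blast
qed

lemma fst_orbit: "fst ` orbit z = pair_orbit (fst z)"
  by (simp add: orbit_def pair_orbit_def stepP_def stepQ_def)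

lemma over_exists: "\<lbrakk>g \<in> carrier G; h \<in> carrier G\<rbrakk> \<Longrightarrow> \<exists>x. over ((g, h), x)"
  using T.C_nonempty[of g \<one> "inv h"] by (auto simp: over_def)

lemma pair_orbit_eq:
  assumes "over (y, x)" "y' \<in> pair_orbit y"
  shows "pair_orbit y' = pair_orbit y"
proof -
  obtain z where z: "z \<in> orbit (y, x)" "y' = fst z"
    using assms(2) fst_orbit[of "(y, x)"] by (metis fst_conv imageE)
  have "fst ` orbit z = fst ` orbit (y, x)" using orbit_eq[OF assms(1) z(1)] by simp
  then show ?thesis by (simp add: fst_orbit z(2))
qed

text \<open>Two of the three labels \<open>g\<close>, \<open>\<one>\<close>, \<open>inv h\<close>
  coincide, so that a degenerate triangle carries these labels. The condition is invariant under
  permutations of the labels.\<close>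

definition degenerate_pair :: "'g \<times> 'g \<Rightarrow> bool" where
  "degenerate_pair = (\<lambda>(g, h). g = \<one> \<or> h = \<one> \<or> h \<otimes> g = \<one>)"

lemma degenerate_pair_step:
  assumes "g \<in> carrier G" "h \<in> carrier G"
  shows "degenerate_pair (rot2 (g, h)) \<longleftrightarrow> degenerate_pair (g, h)"
    "degenerate_pair (swap2 (g, h)) \<longleftrightarrow> degenerate_pair (g, h)"
proof -
  have "inv g \<otimes> inv h = \<one> \<longleftrightarrow> h \<otimes> g = \<one>"
    using assms inv_mult_group[of h g] inv_eq_1_iff[of "h \<otimes> g"] by simp
  then show "degenerate_pair (rot2 (g, h)) \<longleftrightarrow> degenerate_pair (g, h)"
    "degenerate_pair (swap2 (g, h)) \<longleftrightarrow> degenerate_pair (g, h)"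
    using assms by (auto simp: degenerate_pair_def rot2_def swap2_def group_simps)
qed

context
  assumes no2: "\<And>g. \<lbrakk>g \<in> carrier G; g \<otimes> g = \<one>\<rbrakk> \<Longrightarrow> g = \<one>"
    and no3: "\<And>g. \<lbrakk>g \<in> carrier G; g \<otimes> (g \<otimes> g) = \<one>\<rbrakk> \<Longrightarrow> g = \<one>"
begin

text \<open>The only place where elements of order 2 and 3 have to be excluded.\<close>

lemma orbit_free:
  assumes "over (y, x)" "\<not> degenerate_pair y" "(y, x') \<in> orbit (y, x)"
  shows "x' = x"
proof -
  obtain g h where y: "y = (g, h)" by fastforce
  have G: "g \<in> carrier G" "h \<in> carrier G" using assms(1) by (auto simp: over_def y)
  have ne: "g \<noteq> \<one>" "h \<noteq> \<one>" "h \<otimes> g \<noteq> \<one>"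
    using assms(2) by (auto simp: degenerate_pair_def y)
  have inv_self: "inv g \<noteq> g"
  proof
    assume "inv g = g"
    then have "g \<otimes> g = \<one>" using l_inv[OF G(1)] by simp
    then show False using no2[OF G(1)] ne(1) by blast
  qed
  have 1: "rot2 y \<noteq> y"
  proof
    assume "rot2 y = y"
    then have "h = g" and e: "inv g \<otimes> inv h = h" by (auto simp: rot2_def y)
    then have "inv (g \<otimes> g) = g" using G by (simp add: inv_mult_group)
    then have "g \<otimes> (g \<otimes> g) = \<one>" using l_inv[of "g \<otimes> g"] G by simp
    then show False using no3[OF G(1)] ne(1) by blast
  qed
  have 2: "rot2 (rot2 y) \<noteq> y"
  proof
    assume "rot2 (rot2 y) = y"
    then have "rot2 (rot2 (rot2 y)) = rot2 y" by simp
    moreover have "rot2 (rot2 (rot2 y)) = y" using G by (simp add: rot2_def y group_simps)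
    ultimately show False using 1 by simp
  qed
  have 3: "swap2 y \<noteq> y" using inv_self by (simp add: swap2_def y)
  have 4: "rot2 (swap2 y) \<noteq> y" using ne(2) G by (simp add: rot2_def swap2_def y)
  have 5: "rot2 (rot2 (swap2 y)) \<noteq> y"
  proof
    assume "rot2 (rot2 (swap2 y)) = y"
    then have "inv h = g" using G by (simp add: rot2_def swap2_def y group_simps)
    then have "h \<otimes> g = \<one>" using r_inv[OF G(2)] by simp
    then show False using ne(3) by blast
  qed
  show ?thesis
    using assms(3) 1 2 3 4 5 unfolding orbit_def stepP_def stepQ_def by auto
qed

text \<open>The choice is made from the orbit as a set. Pairs in one orbit have equal
  \<open>pair_orbit\<close> and thus obtain the same base pair.\<close>

definition base_pair :: "'g \<times> 'g \<Rightarrow> 'g \<times> 'g" where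
  "base_pair y = (SOME y'. y' \<in> pair_orbit y)"

text \<open>One cell is chosen over the base pair, and its orbit is spread out; freeness makes the
  cell over each pair of the orbit unique.\<close>

definition free_value :: "'g \<times> 'g \<Rightarrow> 't" where
  "free_value y = (THE x. (y, x) \<in> orbit (base_pair y, SOME x. over (base_pair y, x)))"

text \<open>On degenerate pairs the degenerate cell is taken, rotated so that its two equal labels
  are at the right vertices. If all labels are equal the three choices agree by
  \<open>P_d\<close>.\<close>

definition section_value :: "'g \<Rightarrow> 'g \<Rightarrow> 't" where
  "section_value g h = (if g = \<one> then d \<one> (inv h) else if h = \<one> then P (P (d \<one> g))
     else if h \<otimes> g = \<one> then P (d g \<one>) else free_value (g, h))"

lemma free_value:
  assumes "over (y, x)" "\<not> degenerate_pair y"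
  shows "over (y, free_value y)" "free_value (rot2 y) = P (free_value y)" "free_value (swap2 y) = Q (free_value y)"
proof -
  define x0 where "x0 y = (SOME x. over (base_pair y, x))" for y
  have key: "over (y, free_value y) \<and> (y, free_value y) \<in> orbit (base_pair y, x0 y) \<and>
      (\<forall>x'. (y, x') \<in> orbit (base_pair y, x0 y) \<longrightarrow> free_value y = x')"
    if y: "over (y, x)" "\<not> degenerate_pair y" for y x
  proof -
    have base: "base_pair y \<in> pair_orbit y"
      unfolding base_pair_def by (rule someI[of _ y]) (simp add: pair_orbit_def)
    then obtain z where z: "z \<in> orbit (y, x)" "base_pair y = fst z"
      using fst_orbit[of "(y, x)"] by (metis fst_conv imageE)
    have "over (base_pair y, snd z)" using orbit_closed(3)[OF y(1) z(1)] by (simp add: z(2))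
    then have o: "over (base_pair y, x0 y)" unfolding x0_def by (rule someI)
    have "y \<in> pair_orbit (base_pair y)"
      using pair_orbit_eq[OF y(1) base] by (simp add: pair_orbit_def)
    then obtain w where w: "w \<in> orbit (base_pair y, x0 y)" "y = fst w"
      using fst_orbit[of "(base_pair y, x0 y)"] by (metis fst_conv imageE)
    have mem: "(y, snd w) \<in> orbit (base_pair y, x0 y)" using w by simp
    have ow: "over (y, snd w)" by (rule orbit_closed(3)[OF o mem])
    have unique: "x' = snd w" if "(y, x') \<in> orbit (base_pair y, x0 y)" for x'
      using orbit_free[OF ow y(2)] that orbit_eq[OF o mem] by simp
    have "free_value y = snd w"
      unfolding free_value_def x0_def[symmetric] using mem unique by (rule the_equality)
    then show ?thesis using mem ow unique by metis
  qed
  note k = key[OF assms]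
  show "over (y, free_value y)" using k by blast
  obtain g h where y: "y = (g, h)" by fastforce
  have G: "g \<in> carrier G" "h \<in> carrier G" using assms(1) by (auto simp: over_def y)
  have over': "over (rot2 y, P x)" "over (swap2 y, Q x)"
    using over_stepP[OF assms(1)] over_stepQ[OF assms(1)] by (simp_all add: stepP_def stepQ_def)
  have nd: "\<not> degenerate_pair (rot2 y)" "\<not> degenerate_pair (swap2 y)"
    using assms(2) degenerate_pair_step[OF G] by (simp_all add: y)
  \<comment> \<open>All pairs of the orbit share base pair and chosen cell, so the images of the
    value at \<open>y\<close> under \<open>stepP\<close> and \<open>stepQ\<close> lie in the same
    orbit of cells, and uniqueness identifies them with the values at \<open>rot2 y\<close> and
    \<open>swap2 y\<close>.\<close>
  have "pair_orbit (rot2 y) = pair_orbit y" "pair_orbit (swap2 y) = pair_orbit y"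
    by (rule pair_orbit_eq[OF assms(1)], simp add: pair_orbit_def)+
  then have b: "base_pair (rot2 y) = base_pair y" "base_pair (swap2 y) = base_pair y"
    "x0 (rot2 y) = x0 y" "x0 (swap2 y) = x0 y"
    by (simp_all add: base_pair_def x0_def)
  have o: "over (base_pair y, x0 y)"
  proof -
    have "base_pair y \<in> pair_orbit y"
      unfolding base_pair_def by (rule someI[of _ y]) (simp add: pair_orbit_def)
    then obtain z where z: "z \<in> orbit (y, x)" "base_pair y = fst z"
      using fst_orbit[of "(y, x)"] by (metis fst_conv imageE)
    have "over (base_pair y, snd z)" using orbit_closed(3)[OF assms(1) z(1)] by (simp add: z(2))
    then show ?thesis unfolding x0_def by (rule someI)
  qed
  have "stepP (y, free_value y) \<in> orbit (base_pair y, x0 y)" "stepQ (y, free_value y) \<in> orbit (base_pair y, x0 y)"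
    using k orbit_closed(1,2)[OF o] by blast+
  then show "free_value (rot2 y) = P (free_value y)" "free_value (swap2 y) = Q (free_value y)"
    using key[OF over'(1) nd(1)] key[OF over'(2) nd(2)] by (simp_all add: b stepP_def stepQ_def)
qed

lemma d_label:
  assumes "g \<in> carrier G"
  shows "d g \<one> = d \<one> (inv g)" "d (inv g) \<one> = d \<one> g"
  using d_translate[of g \<one> "inv g"] d_translate[of "inv g" \<one> g] assms by simp_all

text \<open>Free orbits are settled by \<open>free_value\<close>. On degenerate pairs the stabiliser
  is nontrivial, and the value must be fixed by it; this is what \<open>Q_d\<close> and
  \<open>P_d\<close> ensure.\<close>

lemma section_value:
  assumes G: "g \<in> carrier G" "h \<in> carrier G"
  shows "section_value g h \<in> C g \<one> (inv h)"
    "P (section_value g h) = section_value h (inv g \<otimes> inv h)"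
    "Q (section_value g h) = section_value (inv g) (h \<otimes> g)"
proof -
  have "section_value g h \<in> C g \<one> (inv h) \<and> P (section_value g h) = section_value h (inv g \<otimes> inv h) \<and>
    Q (section_value g h) = section_value (inv g) (h \<otimes> g)"
  proof (cases "degenerate_pair (g, h)")
    case False
    obtain x where x: "over ((g, h), x)" using over_exists[OF G] by blast
    have s: "section_value g' h' = free_value (g', h')" if "\<not> degenerate_pair (g', h')" for g' h'
      using that by (auto simp: section_value_def degenerate_pair_def)
    have nd: "\<not> degenerate_pair (h, inv g \<otimes> inv h)" "\<not> degenerate_pair (inv g, h \<otimes> g)"
      using False degenerate_pair_step[OF G] by (simp_all add: rot2_def swap2_def)
    show ?thesis
      using free_value[OF x False] unfolding s[OF False] s[OF nd(1)] s[OF nd(2)]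
      by (simp add: over_def rot2_def swap2_def)
  next
    case True
    note dc = T.d_closed[OF one_closed] and PPP = T.PPP_d[OF one_closed]
      and Qd = T.Q_d[OF one_closed] and d1 = T.P_d[OF one_closed]
    \<comment> \<open>A reflection exchanges the two proper rotations of a degenerate cell, since it
      fixes the cell itself.\<close>
    have PQd: "Q (P (d \<one> k)) = P (P (d \<one> k))" "Q (P (P (d \<one> k))) = P (d \<one> k)" if "k \<in> carrier G" for k
      using T.PPQ[OF dc[OF that]] T.PPQ[OF T.P_closed[OF dc[OF that]]] Qd[OF that] PPP[OF that] by simp_all
    consider "g = \<one>" | "g \<noteq> \<one>" "h = \<one>" | "g \<noteq> \<one>" "h \<noteq> \<one>" "h \<otimes> g = \<one>"
      using True by (auto simp: degenerate_pair_def)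
    then show ?thesis
    proof cases
      case 1
      show ?thesis
      proof (cases "h = \<one>")
        case True
        then show ?thesis using 1 dc[OF one_closed] d1 Qd[OF one_closed] by (simp add: section_value_def)
      next
        case False
        then have "inv h \<noteq> \<one>" using G by simp
        then show ?thesis
          using 1 False G dc[of "inv h"] Qd[of "inv h"] d_label(1)[OF G(2)] by (simp add: section_value_def)
      qed
    next
      case 2
      then have "inv g \<noteq> \<one>" using G by simp
      then show ?thesis
        using 2 G T.PP_closed[OF dc[OF G(1)]] PPP[OF G(1)] PQd[OF G(1)] d_label(2)[OF G(1)]
        by (simp add: section_value_def)
    next
      case 3
      have h: "h = inv g" by (rule inv_equality[OF 3(3) G, symmetric])
      have "inv g \<noteq> \<one>" using 3 G by simp
      then show ?thesis
        using 3(1) G T.P_closed[OF T.d_closed[OF G(1) one_closed]] PQd[of "inv g"] d_label[OF G(1)]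
        by (simp add: section_value_def h)
    qed
  qed
  then show "section_value g h \<in> C g \<one> (inv h)"
    "P (section_value g h) = section_value h (inv g \<otimes> inv h)"
    "Q (section_value g h) = section_value (inv g) (h \<otimes> g)" by blast+
qed

theorem symmetric_section_exists:
  "symmetric_section (\<lambda>u v w. section_value (inv v \<otimes> u) (inv w \<otimes> v))"
  unfolding symmetric_section_def
proof (intro ballI conjI)
  fix u v w assume G: "u \<in> carrier G" "v \<in> carrier G" "w \<in> carrier G"
  have i: "inv v \<otimes> u \<in> carrier G" "inv w \<otimes> v \<in> carrier G" using G by auto
  note s = section_value[OF i]
  show "section_value (inv v \<otimes> u) (inv w \<otimes> v) \<in> C u v w"
    using s(1) C_label[OF G] G by (simp add: group_simps)
  show "P (section_value (inv v \<otimes> u) (inv w \<otimes> v)) = section_value (inv w \<otimes> v) (inv u \<otimes> w)"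
    using s(2) G by (simp add: group_simps)
  show "Q (section_value (inv v \<otimes> u) (inv w \<otimes> v)) = section_value (inv u \<otimes> v) (inv w \<otimes> u)"
    using s(3) G by (simp add: group_simps)
  fix k assume "k \<in> carrier G"
  then show "section_value (inv (k \<otimes> v) \<otimes> (k \<otimes> u)) (inv (k \<otimes> w) \<otimes> (k \<otimes> v)) =
      section_value (inv v \<otimes> u) (inv w \<otimes> v)"
    using G by (simp add: group_simps)
qed

end

end

section \<open>The classification\<close>

context loop_space
begin

lemma delta_classification:
  "delta_classification G (pi2 M m0) Cell (m_class M) (P_class M) (Q_class M) deg
     (pi1_act M m0) (Phi M) (Gamma_delta M m0 s)"
proof -
  interpret A: comm_group "pi2 M m0" by (rule comm_group_pi2)
  show ?thesis
  proof (unfold_locales, goal_cases)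
    case (1 k u v w) then show ?case by (rule Cell_translate)
  next
    case (2 k u w) then show ?case by (rule deg_translate)
  next
    case 3 show ?case by (rule Phi_bij[OF one_closed])
  next
    case (4 a b) then show ?case by (rule Phi_mult(1)[OF _ _ one_closed])
  next
    case (5 g a) then show ?case by (rule Phi_act(2))
  next
    case (6 g a) then show ?case by (rule Phi_act(1))
  next
    case (7 g h) then show ?case by (rule Cell_label)
  next
    case (8 g h k) show ?case by (intro ext) (simp add: Gamma_delta_def m_class_def)
  next
    case (9 g h) show ?case by (intro ext) (simp add: Gamma_delta_def P_class_def rotate_def)
  next
    case (10 g h) show ?case by (intro ext) (simp add: Gamma_delta_def Q_class_def swap_def)
  qed
qed

end

theorem mainTheorem4:
  fixes M :: "'a::topological_space set" and m0 :: 'a and n :: nat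
    and s :: "(real \<Rightarrow> 'a) set \<Rightarrow> real \<Rightarrow> 'a"
  assumes "manifold n M" and "m0 \<in> M"
    and "\<forall>g\<in>carrier (pi1 M m0). group.ord (pi1 M m0) g \<noteq> 2 \<and> group.ord (pi1 M m0) g \<noteq> 3"
    and "loop_section M m0 s"
  shows "\<exists>\<alpha>\<in>carrier (ZS3 (pi1 M m0) (pi2 M m0) (pi1_act M m0)).
           delta_isomorphic (pi1 M m0) (Gamma_delta M m0 s)
             (T_delta (pi1 M m0) (pi2 M m0) (pi1_act M m0) \<alpha>) \<and>
           (\<exists>\<xi>\<in>carrier (HS3 (pi1 M m0) (pi2 M m0) (pi1_act M m0)). \<alpha> \<in> \<xi> \<and>
             (\<forall>\<alpha>'\<in>\<xi>. delta_isomorphic (pi1 M m0) (Gamma_delta M m0 s)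
               (T_delta (pi1 M m0) (pi2 M m0) (pi1_act M m0) \<alpha>')))"
proof -
  interpret L: loop_space M m0 s
    by unfold_locales fact+
  interpret D: delta_classification "pi1 M m0" "pi2 M m0" L.Cell "m_class M" "P_class M" "Q_class M"
    L.deg "pi1_act M m0" "Phi M" "Gamma_delta M m0 s"
    by (rule L.delta_classification)
  have trivial: "g = \<one>\<^bsub>pi1 M m0\<^esub>"
    if g: "g \<in> carrier (pi1 M m0)" and p: "p = 2 \<or> p = 3" and 1: "g [^]\<^bsub>pi1 M m0\<^esub> p = \<one>\<^bsub>pi1 M m0\<^esub>"
    for g and p :: nat
  proof -
    have dvd: "L.ord g dvd p" using L.pow_eq_id[OF g] 1 by simp
    then have "L.ord g \<le> 3" using p dvd_imp_le[OF dvd] by auto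
    \<comment> \<open>\<open>ord\<close> has the value 0 on elements of infinite order, so the upper
      bound does not exclude these; divisibility does.\<close>
    moreover have "L.ord g \<noteq> 0"
    proof
      assume "L.ord g = 0"
      then have "p = 0" using dvd by simp
      then show False using p by simp
    qed
    ultimately have "L.ord g = 1" using assms(3) g by force
    then show ?thesis using L.ord_eq_1[OF g] by simp
  qed
  have "g = \<one>\<^bsub>pi1 M m0\<^esub>" if "g \<in> carrier (pi1 M m0)" "g \<otimes>\<^bsub>pi1 M m0\<^esub> g = \<one>\<^bsub>pi1 M m0\<^esub>" for g
    by (rule trivial[OF that(1), of 2]) (use that in \<open>simp_all add: numeral_2_eq_2\<close>)
  moreover have "g = \<one>\<^bsub>pi1 M m0\<^esub>"
    if "g \<in> carrier (pi1 M m0)" "g \<otimes>\<^bsub>pi1 M m0\<^esub> (g \<otimes>\<^bsub>pi1 M m0\<^esub> g) = \<one>\<^bsub>pi1 M m0\<^esub>" for g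
    by (rule trivial[OF that(1), of 3]) (use that in \<open>simp_all add: numeral_3_eq_3 L.m_assoc\<close>)
  ultimately show ?thesis
    by (rule D.classification[OF D.symmetric_section_exists])
qed

end
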